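(* Let $G$ be a finite group. If $G$ is not solvable and $P^*(G)$ is claw-free, then $G$ is an almost simple group.
   Context: For a group $G$, the power graph $P(G)$ is the simple undirected graph whose vertices are the elements of $G$, two distinct vertices $u,v$ being adjacent if and only if one of them is a power of the other (equivalently, one of $\langle u\rangle,\langle v\rangle$ is contained in the other). The reduced power graph $P^*(G)$ is the subgraph of $P(G)$ induced by the non-identity elements. A graph is claw-free if it has no induced subgraph isomorphic to the complete bipartite graph $K_{1,3}$. A finite group $G$ is almost simple if $S\leq G\leq \mathrm{Aut}(S)$ (up to isomorphism, with $S$ identified with its group of inner automorphisms) for some finite non-abelian simple group $S$. *)

theory Defs
  imports
    "HOL-Algebra.Bij"
    "HOL-Algebra.SimpleGroups"
    "HOL-Algebra.Solvable_Groups"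
    "Graph_Theory.Graph_Theory"
begin

text \<open>Undirected graphs are rendered, as in the Graph Theory library, as symmetric digraphs.
  Powers have integer exponents, so that \<open>v\<close> is a power of \<open>u\<close> iff \<open>v\<close> lies in the cyclic
  subgroup generated by \<open>u\<close>, also when \<open>G\<close> is infinite.\<close>

definition power_graph :: "('a, 'b) monoid_scheme \<Rightarrow> 'a pair_pre_digraph" where
  "power_graph G =
    \<lparr> pverts = carrier G,
      parcs = {(u, v). u \<in> carrier G \<and> v \<in> carrier G \<and> u \<noteq> v \<and>
        ((\<exists>k::int. v = u [^]\<^bsub>G\<^esub> k) \<or> (\<exists>k::int. u = v [^]\<^bsub>G\<^esub> k))} \<rparr>"

definition reduced_power_graph :: "('a, 'b) monoid_scheme \<Rightarrow> ('a, 'a \<times> 'a) pre_digraph" where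
  "reduced_power_graph G =
    induce_subgraph (with_proj (power_graph G)) (carrier G - {\<one>\<^bsub>G\<^esub>})"

text \<open>The predicate \<^const>\<open>complete_bipartite_digraph\<close> is invariant under isomorphism: it
  describes all graphs isomorphic to the complete bipartite graph.\<close>

definition claw_free :: "('v, 'e) pre_digraph \<Rightarrow> bool" where
  "claw_free \<Gamma> \<longleftrightarrow> \<not> (\<exists>H. induced_subgraph H \<Gamma> \<and> complete_bipartite_digraph 1 3 H)"

definition inner_automorphisms :: "('a, 'b) monoid_scheme \<Rightarrow> ('a \<Rightarrow> 'a) set" where
  "inner_automorphisms S =
    {\<lambda>x \<in> carrier S. g \<otimes>\<^bsub>S\<^esub> x \<otimes>\<^bsub>S\<^esub> inv\<^bsub>S\<^esub> g | g. g \<in> carrier S}"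

text \<open>HOL cannot quantify over the type of the elements of \<open>S\<close>. Taking \<open>S\<close> over the element type
  of \<open>G\<close> loses no generality: \<open>S\<close> has trivial centre, hence is isomorphic to its group of inner
  automorphisms, which embeds into \<open>G\<close>; so a copy of \<open>S\<close> lives on a subset of \<open>carrier G\<close>.\<close>

definition almost_simple :: "('a, 'b) monoid_scheme \<Rightarrow> bool" where
  "almost_simple G \<longleftrightarrow> group G \<and> finite (carrier G) \<and>
    (\<exists>(S :: 'a monoid) H. simple_group S \<and> finite (carrier S) \<and> \<not> comm_group S \<and>
      subgroup H (AutoGroup S) \<and> inner_automorphisms S \<subseteq> H \<and>
      G \<cong> (AutoGroup S)\<lparr>carrier := H\<rparr>)"

end

theory Submission
  imports
    Defs
    "HOL-Algebra.Sylow"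
    "HOL-Algebra.Multiplicative_Group"
    "HOL-Algebra.Group_Action"
    "HOL-Algebra.Left_Coset"
begin

text \<open>Write \<open>\<langle>x\<rangle>\<close> for the cyclic subgroup generated by \<open>x\<close>. The leaves of a claw in the reduced power
  graph lie either all below or all above its centre \<open>v\<close>, because an element of \<open>\<langle>v\<rangle>\<close> is joined to
  every element that has \<open>v\<close> as a power. So the hypothesis says that no \<open>\<langle>v\<rangle>\<close> contains three pairwise
  incomparable elements, and that no \<open>v \<noteq> 1\<close> is contained in three pairwise incomparable cyclic
  subgroups.

  This makes centralizers small. If \<open>z\<close> has prime order \<open>p\<close>, then its centralizer contains at most one
  subgroup of prime order other than \<open>p\<close> (\<open>prime_order_centralizer_unique\<close>), and it follows that the
  centralizer is solvable (\<open>centralizer_solvable\<close>). Also, an element whose order is divisible by \<open>p\<close>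
  has at most \<open>2p\<close> roots of degree \<open>p\<close> (\<open>card_roots_le\<close>).

  The main step is that \<open>G\<close> is solvable as soon as it has a nontrivial abelian normal subgroup
  (\<open>solvable_if_abelian_normal\<close>). Only an elementary abelian normal \<open>p\<close>-subgroup \<open>V\<close> of order greater
  than \<open>p\<close> needs work. Elements of prime order \<open>q \<noteq> p\<close> act on it without fixed points
  (\<open>acts_freely\<close>), so that the Sylow \<open>q\<close>-subgroups are cyclic (\<open>sylow_cyclic\<close>). Let \<open>q\<close> be the least prime
  divisor of \<open>|G|\<close> other than \<open>p\<close>. Either the transfer into a Sylow \<open>q\<close>-subgroup shows that \<open>G\<close> has a
  nontrivial abelian quotient (\<open>abelian_quotient_if_no_fusion\<close>), and induction applies to the kernel; or
  some \<open>p\<close>-element \<open>u\<close> acts nontrivially on a subgroup \<open>\<langle>y\<rangle>\<close> of order \<open>q\<close>. In the second case let \<open>p\<close>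
  be odd first. Since \<open>y\<close> acts freely, some \<open>h\<close> in \<open>\<langle>y\<rangle>u\<close> has a nontrivial norm on \<open>V\<close>
  (\<open>ex_norm_nontrivial\<close>). But the norm of \<open>v\<close> under \<open>h\<close> is the power \<open>(vh)\<^sup>p\<close>, and changing \<open>v\<close> by
  elements of the kernel of the norm produces too many roots of the same element
  (\<open>norm_trivial_if_odd\<close>). For \<open>p = 2\<close> the same count of roots leaves only \<open>|V| \<le> 16\<close>, if \<open>V\<close> is taken
  equal to its centralizer, and the few possible groups \<open>G/V\<close> are solvable or do not occur
  (\<open>solvable_if_inversion\<close>).

  Now let \<open>G\<close> be non-solvable and let \<open>N\<close> be a minimal normal subgroup. By the main step, applied to \<open>N\<close>
  as well as to \<open>G\<close>, no nontrivial normal subgroup of \<open>N\<close> is solvable. Two nontrivial normal subgroups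
  of \<open>N\<close> with trivial intersection would centralize each other and hence be solvable; so \<open>N\<close> is
  simple. For the same reason the centralizer of \<open>N\<close> is trivial (\<open>simple_normal_subgroup\<close>), and \<open>G\<close>
  embeds into the automorphism group of \<open>N\<close> by conjugation.\<close>

section \<open>Conjugation, centralizers and cyclic subgroups\<close>

definition (in group) conjg :: "'a \<Rightarrow> 'a \<Rightarrow> 'a" where
  "conjg g x = g \<otimes> x \<otimes> inv g"

definition (in group) centralizer :: "'a set \<Rightarrow> 'a set" where
  "centralizer X = {g \<in> carrier G. \<forall>x\<in>X. g \<otimes> x = x \<otimes> g}"

abbreviation (in group) cyc :: "'a \<Rightarrow> 'a set" where
  "cyc x \<equiv> generate G {x}"

context group
begin

lemma inv_mult_cancel [simp]:
  "\<lbrakk>x \<in> carrier G; y \<in> carrier G\<rbrakk> \<Longrightarrow> inv x \<otimes> (x \<otimes> y) = y"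
  "\<lbrakk>x \<in> carrier G; y \<in> carrier G\<rbrakk> \<Longrightarrow> x \<otimes> (inv x \<otimes> y) = y"
  by (simp_all add: m_assoc[symmetric])

lemmas group_norm = m_assoc inv_mult_group

lemma conjg_closed [simp, intro]: "\<lbrakk>g \<in> carrier G; x \<in> carrier G\<rbrakk> \<Longrightarrow> conjg g x \<in> carrier G"
  by (simp add: conjg_def)

lemma conjg_mult: "\<lbrakk>g \<in> carrier G; x \<in> carrier G; y \<in> carrier G\<rbrakk>
  \<Longrightarrow> conjg g (x \<otimes> y) = conjg g x \<otimes> conjg g y"
  by (simp add: conjg_def group_norm)

lemma conjg_conjg: "\<lbrakk>g \<in> carrier G; h \<in> carrier G; x \<in> carrier G\<rbrakk>
  \<Longrightarrow> conjg g (conjg h x) = conjg (g \<otimes> h) x"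
  by (simp add: conjg_def group_norm)

lemma conjg_by_one [simp]: "x \<in> carrier G \<Longrightarrow> conjg \<one> x = x"
  by (simp add: conjg_def)

lemma conjg_one [simp]: "g \<in> carrier G \<Longrightarrow> conjg g \<one> = \<one>"
  by (simp add: conjg_def)

lemma conjg_m_inv: "\<lbrakk>g \<in> carrier G; x \<in> carrier G\<rbrakk> \<Longrightarrow> conjg g (inv x) = inv (conjg g x)"
  by (simp add: conjg_def group_norm)

lemma conjg_inv_conjg [simp]:
  "\<lbrakk>g \<in> carrier G; x \<in> carrier G\<rbrakk> \<Longrightarrow> conjg (inv g) (conjg g x) = x"
  "\<lbrakk>g \<in> carrier G; x \<in> carrier G\<rbrakk> \<Longrightarrow> conjg g (conjg (inv g) x) = x"
  by (simp_all add: conjg_conjg)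

lemma conjg_inject [simp]:
  "\<lbrakk>g \<in> carrier G; x \<in> carrier G; y \<in> carrier G\<rbrakk> \<Longrightarrow> conjg g x = conjg g y \<longleftrightarrow> x = y"
  by (metis conjg_inv_conjg(1))

lemma conjg_eq_one_iff [simp]:
  "\<lbrakk>g \<in> carrier G; x \<in> carrier G\<rbrakk> \<Longrightarrow> conjg g x = \<one> \<longleftrightarrow> x = \<one>"
  by (metis conjg_inject conjg_one one_closed)

lemma conjg_nat_pow: "\<lbrakk>g \<in> carrier G; x \<in> carrier G\<rbrakk> \<Longrightarrow> conjg g (x [^] (n::nat)) = conjg g x [^] n"
  by (induction n) (simp_all add: conjg_mult)

lemma conjg_eq_self_iff: "\<lbrakk>g \<in> carrier G; x \<in> carrier G\<rbrakk> \<Longrightarrow> conjg g x = x \<longleftrightarrow> g \<otimes> x = x \<otimes> g"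
  by (simp add: conjg_def inv_solve_right')

lemma ord_conjg [simp]: "\<lbrakk>g \<in> carrier G; x \<in> carrier G\<rbrakk> \<Longrightarrow> ord (conjg g x) = ord x"
  by (subst ord_unique) (simp_all add: conjg_nat_pow[symmetric] pow_eq_id)

lemma conjg_mult_eq: "\<lbrakk>g \<in> carrier G; x \<in> carrier G\<rbrakk> \<Longrightarrow> conjg g x \<otimes> g = g \<otimes> x"
  by (simp add: conjg_def group_norm)

lemma commutes_pow_pow:
  assumes "x \<in> carrier G" "y \<in> carrier G" "x \<otimes> y = y \<otimes> x"
  shows "x [^] (m::nat) \<otimes> y [^] (n::nat) = y [^] n \<otimes> x [^] m"
  using assms group_commutes_pow[of x y m] group_commutes_pow[of y "x [^] m" n] by simp

lemma commutes_inv: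
  assumes "x \<in> carrier G" "y \<in> carrier G" "x \<otimes> y = y \<otimes> x"
  shows "x \<otimes> inv y = inv y \<otimes> x"
proof -
  have "x \<otimes> inv y = inv y \<otimes> (y \<otimes> x) \<otimes> inv y"
    using assms(1,2) by (simp add: group_norm)
  also have "\<dots> = inv y \<otimes> (x \<otimes> y) \<otimes> inv y"
    using assms(3) by simp
  also have "\<dots> = inv y \<otimes> x"
    using assms(1,2) by (simp add: group_norm)
  finally show ?thesis .
qed

lemma subgroup_centralizer: "X \<subseteq> carrier G \<Longrightarrow> subgroup (centralizer X) G"
proof (rule subgroupI)
  assume X: "X \<subseteq> carrier G"
  show "centralizer X \<noteq> {}"
    using X by (auto simp: centralizer_def intro!: exI[of _ \<one>])
  show "inv a \<in> centralizer X" if "a \<in> centralizer X" for a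
    using that X commutes_inv[of _ a] by (auto simp: centralizer_def subset_iff)
  show "a \<otimes> b \<in> centralizer X" if "a \<in> centralizer X" "b \<in> centralizer X" for a b
  proof -
    have "a \<otimes> b \<otimes> x = x \<otimes> (a \<otimes> b)" if "x \<in> X" for x
    proof -
      have c: "a \<in> carrier G" "b \<in> carrier G" "x \<in> carrier G" "a \<otimes> x = x \<otimes> a" "b \<otimes> x = x \<otimes> b"
        using that \<open>a \<in> centralizer X\<close> \<open>b \<in> centralizer X\<close> X by (auto simp: centralizer_def)
      show ?thesis
        using c by (metis m_assoc)
    qed
    then show ?thesis
      using that by (auto simp: centralizer_def)
  qed
qed (auto simp: centralizer_def)

lemma centralizerD:
  "g \<in> centralizer X \<Longrightarrow> g \<in> carrier G"
  "\<lbrakk>g \<in> centralizer X; x \<in> X\<rbrakk> \<Longrightarrow> g \<otimes> x = x \<otimes> g"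
  by (auto simp: centralizer_def)

lemma subgroup_conjg_closed: "\<lbrakk>subgroup H G; x \<in> H; y \<in> H\<rbrakk> \<Longrightarrow> conjg x y \<in> H"
  by (simp add: conjg_def subgroup.m_closed subgroup.m_inv_closed)

lemma subgroup_nat_pow_closed:
  assumes "subgroup H G" "x \<in> H" shows "x [^] (n::nat) \<in> H"
  by (induction n) (use subgroup.one_closed[OF assms(1)] subgroup.m_closed[OF assms(1)] assms(2) in auto)

lemma cyc_subgroup: "x \<in> carrier G \<Longrightarrow> subgroup (cyc x) G"
  by (simp add: generate_is_subgroup)

lemma cyc_self [simp]: "x \<in> cyc x"
  by (simp add: generate.incl)

lemma cyc_subset_iff: "\<lbrakk>subgroup H G; x \<in> carrier G\<rbrakk> \<Longrightarrow> cyc x \<subseteq> H \<longleftrightarrow> x \<in> H"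
  using generate_subgroup_incl[of "{x}" H] cyc_self[of x] by auto

lemma cyc_mono: "\<lbrakk>x \<in> cyc y; y \<in> carrier G\<rbrakk> \<Longrightarrow> cyc x \<subseteq> cyc y"
  using cyc_subset_iff[OF cyc_subgroup[of y]] generate_in_carrier[of "{y}" x] by auto

lemma cyc_closed: "\<lbrakk>x \<in> cyc y; y \<in> carrier G\<rbrakk> \<Longrightarrow> x \<in> carrier G"
  using generate_in_carrier[of "{y}" x] by auto

lemma subgroup_normal_conjg:
  assumes "H \<lhd> G" "x \<in> H" "g \<in> carrier G" shows "conjg g x \<in> H"
  using assms normal_inv_iff by (auto simp: conjg_def)

lemma normal_of_conjg:
  assumes "subgroup H G" "\<And>g x. \<lbrakk>g \<in> carrier G; x \<in> H\<rbrakk> \<Longrightarrow> conjg g x \<in> H" shows "H \<lhd> G"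
  using assms normal_inv_iff by (auto simp: conjg_def)

lemma conjg_image_r_coset:
  assumes N: "N \<lhd> G" and g: "g \<in> carrier G" and a: "a \<in> carrier G"
  shows "conjg g ` (N #> a) = N #> conjg g a"
proof -
  have Nc: "n \<in> carrier G" if "n \<in> N" for n
    by (rule subgroup.mem_carrier[OF normal_imp_subgroup[OF N] that])
  have "conjg g ` N = N"
  proof
    show "conjg g ` N \<subseteq> N" using subgroup_normal_conjg[OF N] g by auto
    show "N \<subseteq> conjg g ` N"
    proof
      fix n assume n: "n \<in> N"
      have "n = conjg g (conjg (inv g) n)" using g Nc[OF n] by simp
      then show "n \<in> conjg g ` N" using subgroup_normal_conjg[OF N n, of "inv g"] g by blast
    qed
  qed
  moreover have "conjg g ` (N #> a) = (\<lambda>n. n \<otimes> conjg g a) ` (conjg g ` N)"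
    using g a Nc by (auto simp: r_coset_def conjg_mult image_iff)
  ultimately show ?thesis by (auto simp: r_coset_def)
qed

lemma centralizer_normal:
  assumes "X \<subseteq> carrier G" "\<And>g x. \<lbrakk>g \<in> carrier G; x \<in> X\<rbrakk> \<Longrightarrow> conjg g x \<in> X"
  shows "centralizer X \<lhd> G"
proof (rule normal_of_conjg[OF subgroup_centralizer[OF assms(1)]])
  fix g a assume g: "g \<in> carrier G" and a: "a \<in> centralizer X"
  have "conjg (conjg g a) x = x" if "x \<in> X" for x
  proof -
    have x: "x \<in> carrier G" using that assms(1) by auto
    have ac: "a \<in> carrier G" using a by (simp add: centralizer_def)
    let ?y = "conjg (inv g) x"
    have "?y \<in> X" using assms(2) g that by simp
    then have "conjg a ?y = ?y"
      using a ac g x by (simp add: centralizer_def conjg_eq_self_iff)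
    then have "conjg g (conjg a (conjg (inv g) x)) = x"
      using g x by simp
    then show ?thesis
      using g x ac by (simp add: conjg_conjg) (simp add: conjg_def group_norm)
  qed
  then show "conjg g a \<in> centralizer X"
    using g a assms(1) by (auto simp: centralizer_def conjg_eq_self_iff subset_iff)
qed

end

locale finite_group = group +
  assumes fin [simp]: "finite (carrier G)"

context finite_group
begin

lemma finite_subgroup [simp]: "subgroup H G \<Longrightarrow> finite H"
  by (meson fin finite_subset subgroup.subset)

lemma finite_group_subgroup: "subgroup H G \<Longrightarrow> finite_group (G\<lparr>carrier := H\<rparr>)"
  by (simp add: finite_group_def finite_group_axioms_def subgroup_imp_group)

lemma ord_pos [simp]: "x \<in> carrier G \<Longrightarrow> ord x > 0"
  using ord_ge_1[OF fin] by (simp add: Suc_le_eq)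

lemma cyc_iff: "x \<in> carrier G \<Longrightarrow> y \<in> cyc x \<longleftrightarrow> (\<exists>k::nat. y = x [^] k)"
  using generate_pow_on_finite_carrier[OF fin] by auto

lemma card_cyc: "x \<in> carrier G \<Longrightarrow> card (cyc x) = ord x"
  by (simp add: generate_pow_card)

lemma finite_cyc [simp]: "x \<in> carrier G \<Longrightarrow> finite (cyc x)"
  by (simp add: cyc_subgroup)

lemma cyc_eqI: "\<lbrakk>x \<in> cyc y; y \<in> carrier G; ord x = ord y\<rbrakk> \<Longrightarrow> cyc x = cyc y"
  by (rule card_subset_eq) (simp_all add: cyc_mono cyc_closed card_cyc)

lemma ord_dvd_of_cyc: "\<lbrakk>x \<in> cyc y; y \<in> carrier G\<rbrakk> \<Longrightarrow> ord x dvd ord y"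
  by (metis cyc_iff nat_pow_closed nat_pow_one nat_pow_pow mult.commute pow_eq_id pow_ord_eq_1)

lemma ord_dvd_subgroup: "\<lbrakk>subgroup H G; x \<in> H\<rbrakk> \<Longrightarrow> ord x dvd card H"
proof -
  assume H: "subgroup H G" and x: "x \<in> H"
  have xc: "x \<in> carrier G" by (rule subgroup.mem_carrier[OF H x])
  interpret H: group "G\<lparr>carrier := H\<rparr>" using H subgroup_imp_group by blast
  have "subgroup (cyc x) (G\<lparr>carrier := H\<rparr>)"
    using H xc x by (intro subgroup_incl) (auto simp: cyc_subgroup cyc_subset_iff)
  from H.lagrange[OF this] show ?thesis
    by (metis card_cyc dvd_triv_right order_def partial_object.select_convs(1)
        partial_object.update_convs(1) partial_object.surjective xc)
qed

lemma subgroup_card_dvd: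
  assumes "subgroup H G" "subgroup K G" "H \<subseteq> K" shows "card H dvd card K"
proof -
  interpret K: group "G\<lparr>carrier := K\<rparr>" using assms subgroup_imp_group by blast
  have "subgroup H (G\<lparr>carrier := K\<rparr>)"
    using assms by (intro subgroup_incl)
  from K.lagrange[OF this] show ?thesis
    by (metis dvd_triv_right order_def partial_object.select_convs(1)
        partial_object.update_convs(1) partial_object.surjective)
qed

lemma ord_prime_pow:
  assumes "x \<in> carrier G" "prime r" "r dvd ord x"
  shows "ord (x [^] (ord x div r)) = r"
proof -
  obtain k where k: "ord x = r * k" using assms(3) by blast
  have "k > 0" "r > 0" using k ord_pos[OF assms(1)] assms(2) by (auto intro: Nat.gr0I simp: prime_gt_0_nat)
  then show ?thesis using assms(1) k by (subst ord_pow) auto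
qed

lemma ex_prime_pow:
  assumes "x \<in> carrier G" "x \<noteq> \<one>"
  obtains k::nat and r where "prime r" "r dvd ord x" "ord (x [^] k) = r"
proof -
  have "ord x \<noteq> 1" using assms ord_eq_1 by blast
  then obtain r where "prime r" "r dvd ord x" using prime_factor_nat by blast
  then show thesis using ord_prime_pow[OF assms(1)] that by blast
qed

text \<open>Cauchy's theorem, from the existence of Sylow subgroups.\<close>

lemma cauchy:
  assumes H: "subgroup H G" and r: "prime r" "r dvd card H"
  obtains x where "x \<in> H" "ord x = r"
proof -
  interpret H: group "G\<lparr>carrier := H\<rparr>" using H subgroup_imp_group by blast
  obtain m where m: "order (G\<lparr>carrier := H\<rparr>) = r ^ 1 * m"
    using r(2) by (auto simp: order_def elim!: dvdE)
  have "finite H" using H by simp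
  then obtain K where K: "subgroup K (G\<lparr>carrier := H\<rparr>)" "card K = r ^ 1"
    using sylow_thm[OF r(1) H.group_axioms m] by auto
  have KG: "subgroup K G" using K(1) H incl_subgroup by blast
  have KH: "K \<subseteq> H" using subgroup.subset[OF K(1)] by simp
  have "card K > 1" using K(2) r(1) prime_gt_1_nat by simp
  then obtain x where x: "x \<in> K" "x \<noteq> \<one>"
    by (metis KG card_1_singleton_iff is_singletonI' is_singleton_altdef less_irrefl subgroup.one_closed
        subgroup_nonempty)
  have xc: "x \<in> carrier G" by (rule subgroup.mem_carrier[OF KG x(1)])
  have "ord x dvd r" using ord_dvd_subgroup[OF KG x(1)] K(2) by simp
  moreover have "ord x \<noteq> 1" using x xc ord_eq_1 by blast
  ultimately have "ord x = r" using r(1) prime_nat_iff by blast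
  then show thesis using that x KH by blast
qed

lemma prime_order_cyc_eq:
  assumes "x \<in> carrier G" "prime (ord x)" "y \<in> cyc x" "y \<noteq> \<one>"
  shows "cyc y = cyc x"
proof -
  have y: "y \<in> carrier G" using assms cyc_closed by blast
  have "ord y dvd ord x" "ord y \<noteq> 1"
    using ord_dvd_of_cyc assms ord_eq_1 y by blast+
  then have "ord y = ord x" using assms(2) prime_nat_iff by blast
  then show ?thesis using assms cyc_eqI by blast
qed

lemma cyc_unique_prime_subgroup:
  assumes "x \<in> carrier G" "a \<in> cyc x" "b \<in> cyc x" "prime r" "ord a = r" "ord b = r"
  shows "cyc a = cyc b"
proof -
  have rd: "r dvd ord x" using assms ord_dvd_of_cyc by blast
  have "cyc c = cyc (x [^] (ord x div r))" if c: "c \<in> cyc x" "ord c = r" for c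
  proof -
    obtain i :: nat where i: "c = x [^] i" using c assms(1) cyc_iff by blast
    have "c [^] r = \<one>" using c assms(1) cyc_closed pow_ord_eq_1 by blast
    then have "ord x dvd i * r" using i assms(1) by (simp add: nat_pow_pow pow_eq_id)
    then have "ord x div r dvd i"
      using rd assms(4) by (metis div_dvd_iff_mult not_prime_0)
    then obtain j where "i = (ord x div r) * j" by (auto elim: dvdE)
    then have "c = (x [^] (ord x div r)) [^] j" using i assms(1) by (simp add: nat_pow_pow)
    then have "c \<in> cyc (x [^] (ord x div r))" using assms(1) cyc_iff by blast
    then show ?thesis
      using c(2) assms(1) ord_prime_pow[OF assms(1,4) rd] by (intro cyc_eqI) auto
  qed
  then show ?thesis using assms by metis
qed

lemma cyc_coprime_pow:
  assumes "x \<in> carrier G" "coprime k (ord x)" shows "cyc (x [^] (k::nat)) = cyc x"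
proof -
  have "ord (x [^] k) = ord x" using pow_ord_eq_ord_iff[OF fin assms(1)] assms(2) by blast
  moreover have "x [^] k \<in> cyc x" using assms(1) cyc_iff by blast
  ultimately show ?thesis using assms(1) cyc_eqI by blast
qed

lemma coprime_commuting_cyc:
  assumes "x \<in> carrier G" "y \<in> carrier G" "x \<otimes> y = y \<otimes> x" "coprime (ord x) (ord y)"
  shows "x \<in> cyc (x \<otimes> y)" "y \<in> cyc (x \<otimes> y)"
proof -
  have *: "a \<in> cyc (a \<otimes> b)" if "a \<in> carrier G" "b \<in> carrier G" "a \<otimes> b = b \<otimes> a" "coprime (ord a) (ord b)" for a b
  proof -
    have "(a \<otimes> b) [^] ord b = a [^] ord b"
      using that by (simp add: pow_mult_distrib)
    then have "a [^] ord b \<in> cyc (a \<otimes> b)" using that(1,2) cyc_iff[of "a \<otimes> b"] m_closed by metis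
    moreover have "cyc (a [^] ord b) = cyc a"
      using that by (intro cyc_coprime_pow) (auto simp: coprime_commute)
    ultimately show ?thesis
      using that(1,2) cyc_mono[of "a [^] ord b" "a \<otimes> b"] cyc_self[of a] m_closed by blast
  qed
  show "x \<in> cyc (x \<otimes> y)" using * assms by blast
  show "y \<in> cyc (x \<otimes> y)" using *[of y x] assms by (simp add: coprime_commute)
qed

lemma ord_coprime_commuting:
  assumes "x \<in> carrier G" "y \<in> carrier G" "x \<otimes> y = y \<otimes> x" "coprime (ord x) (ord y)"
  shows "ord (x \<otimes> y) = ord x * ord y"
proof (rule dvd_antisym)
  show "ord (x \<otimes> y) dvd ord x * ord y" using assms ord_mul_divides by blast
  show "ord x * ord y dvd ord (x \<otimes> y)"
    using coprime_commuting_cyc[OF assms] assms by (intro divides_mult ord_dvd_of_cyc) auto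
qed

lemma conjg_cyc_iff: 
  assumes "g \<in> carrier G" "x \<in> carrier G" "y \<in> carrier G"
  shows "conjg g y \<in> cyc (conjg g x) \<longleftrightarrow> y \<in> cyc x"
  using assms by (auto simp: cyc_iff conjg_nat_pow[symmetric])

lemma commutes_cyc: 
  assumes "g \<in> carrier G" "x \<in> carrier G" "g \<otimes> x = x \<otimes> g" "y \<in> cyc x" shows "g \<otimes> y = y \<otimes> g"
  using assms group_commutes_pow[of x g] cyc_iff[of x y] by auto

lemma prime_power_card:
  assumes "subgroup H G" "prime p" "\<And>x r. \<lbrakk>x \<in> H; prime r; ord x = r\<rbrakk> \<Longrightarrow> r = p"
  shows "\<exists>k. card H = p ^ k"
proof -
  have "card H \<noteq> 0" using finite_subgroup[OF assms(1)] subgroup.one_closed[OF assms(1)] by (auto simp: card_eq_0_iff)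
  have only: "r = p" if "prime r" "r dvd card H" for r
    using cauchy[OF assms(1) that] assms(3) that by metis
  obtain m where m: "card H = p ^ multiplicity p (card H) * m" "\<not> p dvd m"
    by (rule multiplicity_decompose'[of "card H" p])
      (use \<open>card H \<noteq> 0\<close> not_prime_unit[of p] \<open>prime p\<close> in blast)+
  have "m = 1"
  proof (rule ccontr)
    assume "m \<noteq> 1"
    then obtain r where "prime r" "r dvd m" using prime_factor_nat by blast
    then show False using only[of r] m by (metis dvd_mult)
  qed
  then show ?thesis using m(1) by auto
qed

end

section \<open>Actions, \<open>p\<close>-groups and groups of small order\<close>

locale set_action = finite_group G for G (structure) +
  fixes P :: "'a set" and X :: "'x set" and act :: "'a \<Rightarrow> 'x \<Rightarrow> 'x"
  assumes subgroup_P: "subgroup P G"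
    and finite_X: "finite X"
    and act_closed: "\<lbrakk>g \<in> P; x \<in> X\<rbrakk> \<Longrightarrow> act g x \<in> X"
    and act_one: "x \<in> X \<Longrightarrow> act \<one> x = x"
    and act_mult: "\<lbrakk>g \<in> P; h \<in> P; x \<in> X\<rbrakk> \<Longrightarrow> act (g \<otimes> h) x = act g (act h x)"
begin

lemma group_action_restrict: "group_action (G\<lparr>carrier := P\<rparr>) X (\<lambda>g. \<lambda>x\<in>X. act g x)"
proof -
  interpret P: group "G\<lparr>carrier := P\<rparr>" using subgroup_P subgroup_imp_group by blast
  have inv: "act (inv g) (act g x) = x" "act g (act (inv g) x) = x" if "g \<in> P" "x \<in> X" for g x
    using that subgroup.mem_carrier[OF subgroup_P] subgroup.m_inv_closed[OF subgroup_P]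
    by (simp_all add: act_mult[symmetric] act_one)
  have bij: "(\<lambda>x\<in>X. act g x) \<in> Bij X" if g: "g \<in> P" for g
  proof -
    have "bij_betw (\<lambda>x\<in>X. act g x) X X"
      by (rule bij_betwI[where g = "act (inv g)"])
        (use g inv act_closed subgroup.m_inv_closed[OF subgroup_P g] in auto)
    then show ?thesis by (simp add: Bij_def)
  qed
  have "(\<lambda>g. \<lambda>x\<in>X. act g x) \<in> hom (G\<lparr>carrier := P\<rparr>) (BijGroup X)"
  proof (rule homI)
    fix g h assume g: "g \<in> carrier (G\<lparr>carrier := P\<rparr>)" and h: "h \<in> carrier (G\<lparr>carrier := P\<rparr>)"
    show "(\<lambda>x\<in>X. act (g \<otimes>\<^bsub>G\<lparr>carrier := P\<rparr>\<^esub> h) x)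
        = (\<lambda>x\<in>X. act g x) \<otimes>\<^bsub>BijGroup X\<^esub> (\<lambda>x\<in>X. act h x)"
      using g h bij[of g] bij[of h]
      by (auto simp: BijGroup_def compose_def act_mult act_closed intro!: restrict_ext)
  qed (use bij in \<open>auto simp: BijGroup_def\<close>)
  then show ?thesis
    by (simp add: group_action_def group_hom_def group_hom_axioms_def group_BijGroup P.group_axioms)
qed

lemma orbit_stabilizer:
  assumes "x \<in> X"
  shows "card ((\<lambda>g. act g x) ` P) * card {g \<in> P. act g x = x} = card P"
proof -
  interpret A: group_action "G\<lparr>carrier := P\<rparr>" X "\<lambda>g. \<lambda>x\<in>X. act g x" by (rule group_action_restrict)
  have "orbit (G\<lparr>carrier := P\<rparr>) (\<lambda>g. \<lambda>x\<in>X. act g x) x = (\<lambda>g. act g x) ` P"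
    using assms by (auto simp: orbit_def)
  moreover have "stabilizer (G\<lparr>carrier := P\<rparr>) (\<lambda>g. \<lambda>x\<in>X. act g x) x = {g \<in> P. act g x = x}"
    using assms by (auto simp: stabilizer_def)
  ultimately show ?thesis
    using A.orbit_stabilizer_theorem[OF assms] by (simp add: order_def)
qed

lemma subgroup_stabilizer: "x \<in> X \<Longrightarrow> subgroup {g \<in> P. act g x = x} G"
proof -
  assume x: "x \<in> X"
  interpret A: group_action "G\<lparr>carrier := P\<rparr>" X "\<lambda>g. \<lambda>x\<in>X. act g x" by (rule group_action_restrict)
  have "stabilizer (G\<lparr>carrier := P\<rparr>) (\<lambda>g. \<lambda>x\<in>X. act g x) x = {g \<in> P. act g x = x}"
    using x by (auto simp: stabilizer_def)
  then show ?thesis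
    using A.stabilizer_subgroup[OF x] incl_subgroup[OF subgroup_P] by simp
qed

definition orbs where "orbs = (\<lambda>x. (\<lambda>g. act g x) ` P) ` X"

lemma card_eq_sum_orbs: "card X = (\<Sum>B\<in>orbs. card B)"
proof -
  interpret A: group_action "G\<lparr>carrier := P\<rparr>" X "\<lambda>g. \<lambda>x\<in>X. act g x" by (rule group_action_restrict)
  have "orbits (G\<lparr>carrier := P\<rparr>) X (\<lambda>g. \<lambda>x\<in>X. act g x) = orbs"
    by (auto simp: orbits_def orbit_def orbs_def)
  then have U: "\<Union> orbs = X" and D: "\<And>A B. A \<in> orbs \<Longrightarrow> B \<in> orbs \<Longrightarrow> A = B \<or> A \<inter> B = {}"
    using A.orbits_coverture A.disjoint_union by auto
  have "card (\<Union> orbs) = (\<Sum>B\<in>orbs. card B)"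
  proof (rule card_Union_disjoint)
    show "pairwise disjnt orbs" using D by (auto simp: pairwise_def disjnt_def)
    show "finite A" if "A \<in> orbs" for A
      using that U finite_X finite_subset[of A X] by blast
  qed
  then show ?thesis using U by simp
qed

lemma finite_orbs: "finite orbs"
  unfolding orbs_def using finite_X by simp

text \<open>Orbits of a \<open>p\<close>-group have \<open>p\<close>-power size, so the points that it moves come in multiples of \<open>p\<close>.\<close>

lemma card_fixed_points_mod:
  assumes "prime p" "card P = p ^ k"
  shows "card X mod p = card {x \<in> X. \<forall>g\<in>P. act g x = x} mod p"
proof -
  let ?F = "{x \<in> X. \<forall>g\<in>P. act g x = x}"
  have one: "\<one> \<in> P" using subgroup_P subgroup.one_closed by blast
  have self: "x \<in> (\<lambda>g. act g x) ` P" if "x \<in> X" for x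
    using that one act_one[of x] by (metis image_eqI)
  have fixed_orb: "(\<lambda>g. act g x) ` P = {x}" if "x \<in> ?F" for x
    using that one by auto
  have "{x} \<in> orbs" if "x \<in> ?F" for x
    using that fixed_orb[OF that, symmetric] unfolding orbs_def by blast
  then have sub: "(\<lambda>x. {x}) ` ?F \<subseteq> orbs" by blast
  have rest: "p dvd card B" if B: "B \<in> orbs - (\<lambda>x. {x}) ` ?F" for B
  proof -
    obtain x where x: "x \<in> X" "B = (\<lambda>g. act g x) ` P" using B unfolding orbs_def by blast
    have "card B dvd p ^ k" using orbit_stabilizer[OF x(1)] x(2) assms(2) by (metis dvd_triv_left)
    then obtain j where j: "card B = p ^ j" using divides_primepow_nat[OF assms(1)] by blast
    show ?thesis
    proof (cases j)
      case 0
      then have "card B = 1" using j by simp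
      then have "B = {x}" using self[OF x(1)] x(2) by (metis card_1_singletonE singletonD)
      then have "x \<in> ?F" using x by auto
      then show ?thesis using that \<open>B = {x}\<close> by auto
    qed (use j in auto)
  qed
  have "card X = (\<Sum>B\<in>orbs - (\<lambda>x. {x}) ` ?F. card B) + (\<Sum>B\<in>(\<lambda>x. {x}) ` ?F. card B)"
    unfolding card_eq_sum_orbs by (rule sum.subset_diff[OF sub finite_orbs])
  then have c: "card X = (\<Sum>B\<in>orbs - (\<lambda>x. {x}) ` ?F. card B) + card ?F"
    by (simp add: sum.reindex inj_on_def)
  have "p dvd (\<Sum>B\<in>orbs - (\<lambda>x. {x}) ` ?F. card B)"
    using rest by (intro dvd_sum) auto
  then obtain m where "(\<Sum>B\<in>orbs - (\<lambda>x. {x}) ` ?F. card B) = p * m" by (rule dvdE)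
  then show ?thesis unfolding c by simp
qed

end

context finite_group
begin

lemma set_action_conjg:
  assumes "subgroup P G" "X \<subseteq> carrier G" "\<And>g x. \<lbrakk>g \<in> P; x \<in> X\<rbrakk> \<Longrightarrow> conjg g x \<in> X"
  shows "set_action G P X conjg"
proof (intro set_action.intro set_action_axioms.intro finite_group_axioms)
  show "finite X" using assms(2) fin finite_subset by blast
  show "conjg (g \<otimes> h) x = conjg g (conjg h x)" if "g \<in> P" "h \<in> P" "x \<in> X" for g h x
    using that assms(2) subgroup.mem_carrier[OF assms(1)] by (auto simp: conjg_conjg)
qed (use assms in auto)

lemma set_action_conjg_image:
  assumes "subgroup P G" "\<And>C. C \<in> X \<Longrightarrow> C \<subseteq> carrier G" "\<And>g C. \<lbrakk>g \<in> P; C \<in> X\<rbrakk> \<Longrightarrow> conjg g ` C \<in> X"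
  shows "set_action G P X (\<lambda>g C. conjg g ` C)"
proof (intro set_action.intro set_action_axioms.intro finite_group_axioms)
  show "finite X" using assms(2) fin finite_subset[of X "Pow (carrier G)"] by auto
  show "conjg (g \<otimes> h) ` C = conjg g ` (conjg h ` C)" if "g \<in> P" "h \<in> P" "C \<in> X" for g h C
    using that assms(2)[of C] subgroup.mem_carrier[OF assms(1)]
    by (simp add: image_image) (intro image_cong; force simp: conjg_conjg)
  show "conjg \<one> ` C = C" if "C \<in> X" for C
    using that assms(2)[of C] by (force simp: image_iff subset_iff)
qed (use assms in auto)

text \<open>The fixed points form a set whose size is divisible by \<open>p\<close> and which contains the identity.\<close>

lemma p_group_fixes_nontrivial:
  assumes "subgroup P G" "prime p" "card P = p ^ k" "subgroup X G" "p dvd card X"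
    "\<And>g x. \<lbrakk>g \<in> P; x \<in> X\<rbrakk> \<Longrightarrow> conjg g x \<in> X"
  obtains x where "x \<in> X" "x \<noteq> \<one>" "\<And>g. g \<in> P \<Longrightarrow> conjg g x = x"
proof -
  interpret A: set_action G P X conjg
    using assms subgroup.subset[OF assms(4)] by (intro set_action_conjg) auto
  let ?F = "{x \<in> X. \<forall>g\<in>P. conjg g x = x}"
  have "p dvd card ?F"
    using A.card_fixed_points_mod[OF assms(2,3)] assms(5) by (simp add: dvd_eq_mod_eq_0)
  moreover have "\<one> \<in> ?F"
    using subgroup.mem_carrier[OF assms(1)] subgroup.one_closed[OF assms(4)] by auto
  moreover have "finite ?F" using finite_subgroup[OF assms(4)] by simp
  ultimately have "p \<le> card ?F"
    by (intro dvd_imp_le) (auto simp: card_gt_0_iff)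
  then have "\<not> card ?F \<le> 1"
    using prime_gt_1_nat[OF assms(2)] by simp
  then have "\<not> ?F \<subseteq> {\<one>}"
    using card_mono[of "{\<one>}" ?F] by auto
  then show thesis using that by blast
qed

text \<open>Solvability of a subgroup is expressed by the derived series computed in the ambient group, so
  that subgroups can be compared without passing between group structures.\<close>

lemma solvable_seq_of_solvable_subgroup:
  assumes "subgroup K G" "solvable (G\<lparr>carrier := K\<rparr>)" shows "solvable_seq G K"
proof -
  interpret K: group "G\<lparr>carrier := K\<rparr>" using assms subgroup_imp_group by blast
  interpret h: group_hom "G\<lparr>carrier := K\<rparr>" G id
    using assms by unfold_locales (auto simp: hom_def subgroup.mem_carrier)
  show ?thesis
    using h.solvable_imp_solvable_img[of K] assms(2) by (simp add: solvable_def)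
qed

lemma solvable_subgroup_iff:
  assumes "subgroup K G"
  shows "solvable (G\<lparr>carrier := K\<rparr>) \<longleftrightarrow> (\<exists>n. (derived G ^^ n) K = {\<one>})"
proof
  assume "solvable (G\<lparr>carrier := K\<rparr>)"
  then show "\<exists>n. (derived G ^^ n) K = {\<one>}"
    using solvable_seq_of_solvable_subgroup assms solvable_imp_trivial_derived_seq by blast
next
  assume "\<exists>n. (derived G ^^ n) K = {\<one>}"
  then have *: "solvable_seq G K" using trivial_derived_seq_imp_solvable[OF assms] by blast
  interpret K: group "G\<lparr>carrier := K\<rparr>" using assms subgroup_imp_group by blast
  interpret h: group_hom "G\<lparr>carrier := K\<rparr>" G id
    using assms by unfold_locales (auto simp: hom_def subgroup.mem_carrier)
  show "solvable (G\<lparr>carrier := K\<rparr>)"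
    using h.solvable_img_imp_solvable[of K] * K.subgroup_self by (simp add: solvable_def)
qed

lemma solvable_subgroup_mono:
  assumes "subgroup H G" "subgroup K G" "H \<subseteq> K" "solvable (G\<lparr>carrier := K\<rparr>)"
  shows "solvable (G\<lparr>carrier := H\<rparr>)"
proof -
  obtain n where n: "(derived G ^^ n) K = {\<one>}"
    using assms solvable_subgroup_iff by blast
  have "(derived G ^^ n) H \<subseteq> {\<one>}"
    using mono_exp_of_derived[OF assms(3), of n] n by simp
  moreover have "\<one> \<in> (derived G ^^ n) H"
    using subgroup.one_closed[OF exp_of_derived_is_subgroup[OF assms(1)]] .
  ultimately show ?thesis using solvable_subgroup_iff[OF assms(1)] by blast
qed

lemma derived_subset_of_commutators:
  assumes "subgroup K G" "\<And>x y. \<lbrakk>x \<in> H; y \<in> H\<rbrakk> \<Longrightarrow> x \<otimes> y \<otimes> inv x \<otimes> inv y \<in> K"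
  shows "derived G H \<subseteq> K"
  unfolding derived_def using assms by (intro generate_subgroup_incl) auto

lemma solvable_of_commutators:
  assumes "subgroup K G" "subgroup H G" "\<And>x y. \<lbrakk>x \<in> H; y \<in> H\<rbrakk> \<Longrightarrow> x \<otimes> y \<otimes> inv x \<otimes> inv y \<in> K"
    "solvable (G\<lparr>carrier := K\<rparr>)"
  shows "solvable (G\<lparr>carrier := H\<rparr>)"
proof -
  obtain n where n: "(derived G ^^ n) K = {\<one>}"
    using assms solvable_subgroup_iff by blast
  have "(derived G ^^ Suc n) H \<subseteq> {\<one>}"
    using mono_exp_of_derived[OF derived_subset_of_commutators[OF assms(1,3)], where n = n] n
    by (simp add: funpow_swap1)
  moreover have "\<one> \<in> (derived G ^^ Suc n) H"
    using subgroup.one_closed[OF exp_of_derived_is_subgroup[OF assms(2)]] .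
  ultimately show ?thesis using solvable_subgroup_iff[OF assms(2)] by blast
qed

lemma solvable_of_abelian:
  assumes "subgroup K G" "\<And>x y. \<lbrakk>x \<in> K; y \<in> K\<rbrakk> \<Longrightarrow> x \<otimes> y = y \<otimes> x"
  shows "solvable (G\<lparr>carrier := K\<rparr>)"
proof -
  have "derived G K \<subseteq> {\<one>}"
  proof (rule derived_subset_of_commutators[OF triv_subgroup])
    fix x y assume xy: "x \<in> K" "y \<in> K"
    then have c: "x \<in> carrier G" "y \<in> carrier G" using assms(1) subgroup.mem_carrier by metis+
    have "x \<otimes> y \<otimes> inv x \<otimes> inv y = y \<otimes> x \<otimes> inv x \<otimes> inv y"
      using assms(2) xy by simp
    then show "x \<otimes> y \<otimes> inv x \<otimes> inv y \<in> {\<one>}" using c by (simp add: group_norm)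
  qed
  moreover have "\<one> \<in> derived G K"
    using subgroup.one_closed derived_is_subgroup subgroup.subset[OF assms(1)] by blast
  ultimately have "(derived G ^^ 1) K = {\<one>}" by auto
  then show ?thesis using solvable_subgroup_iff[OF assms(1)] by blast
qed

lemma solvable_of_normal_quotient:
  assumes "K \<lhd> G" "solvable (G\<lparr>carrier := K\<rparr>)" "solvable (G Mod K)"
  shows "solvable G"
proof (rule solvable_condition)
  interpret K: normal K G by fact
  interpret KG: group "G\<lparr>carrier := K\<rparr>" using subgroup_imp_group K.subgroup_axioms by blast
  interpret Q: group "G Mod K" by (rule K.factorgroup_is_group)
  show "group_hom (G\<lparr>carrier := K\<rparr>) G id"
    by unfold_locales (auto simp: hom_def)
  show "group_hom G (G Mod K) (\<lambda>a. K #> a)"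
    using K.r_coset_hom_Mod by unfold_locales auto
  show "(\<lambda>a. K #> a) ` carrier G = carrier (G Mod K)"
    by (simp add: carrier_FactGroup)
  show "kernel G (G Mod K) (\<lambda>a. K #> a) \<subseteq> id ` carrier (G\<lparr>carrier := K\<rparr>)"
    using K.subgroup_axioms coset_join1[OF _ _ K.subgroup_axioms]
    by (auto simp: kernel_def K.subset)
qed (use assms in auto)

lemma order_quotient: "K \<lhd> G \<Longrightarrow> order (G Mod K) * card K = order G"
  using lagrange[OF normal_imp_subgroup] by (simp add: order_def FactGroup_def)

lemma finite_group_quotient: "K \<lhd> G \<Longrightarrow> finite_group (G Mod K)"
  using normal.factorgroup_is_group[of K G]
  by (auto simp: finite_group_def finite_group_axioms_def carrier_FactGroup)

text \<open>In a \<open>p\<close>-group, every proper normal subgroup is properly contained in a normal subgroup that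
  is central modulo it, because the group fixes another coset when it acts on the cosets by
  conjugation; climbing up from the trivial subgroup gives a central series.\<close>

lemma p_group_solvable:
  assumes "prime p" "order G = p ^ k"
  shows "solvable G"
proof -
  have step: "\<exists>n. (derived G ^^ n) (carrier G) \<subseteq> N" if "N \<lhd> G" for N
    using that
  proof (induction "order G - card N" arbitrary: N rule: less_induct)
    case less
    interpret N: normal N G by fact
    have Nsub: "subgroup N G" by (rule N.subgroup_axioms)
    show ?case
    proof (cases "N = carrier G")
      case True
      then have "(derived G ^^ 0) (carrier G) \<subseteq> N" by simp
      then show ?thesis by blast
    next
      case False
      \<comment> \<open>the inverse image of the centre of \<open>G/N\<close>\<close>
      define N' where "N' = {x \<in> carrier G. \<forall>g\<in>carrier G. conjg g x \<otimes> inv x \<in> N}"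
      have conjN: "conjg g x \<in> N" if "g \<in> carrier G" "x \<in> N" for g x
        using subgroup_normal_conjg[OF less.prems] that by blast
      have NN': "N \<subseteq> N'"
        using conjN by (auto simp: N'_def)
      have sub: "subgroup N' G"
      proof (rule subgroupI)
        show "N' \<noteq> {}" using NN' subgroup.one_closed[OF Nsub] by blast
        fix a assume a: "a \<in> N'"
        then have ac: "a \<in> carrier G" by (simp add: N'_def)
        have "conjg g (inv a) \<otimes> inv (inv a) \<in> N" if g: "g \<in> carrier G" for g
        proof -
          have "inv (conjg (inv a) (conjg g a \<otimes> inv a)) \<in> N"
            using a g ac conjN by (auto simp: N'_def)
          moreover have "inv (conjg (inv a) (conjg g a \<otimes> inv a)) = conjg g (inv a) \<otimes> inv (inv a)"
            using g ac by (simp add: conjg_def group_norm)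
          ultimately show ?thesis by simp
        qed
        then show "inv a \<in> N'" using ac by (simp add: N'_def)
        fix b assume b: "b \<in> N'"
        then have bc: "b \<in> carrier G" by (simp add: N'_def)
        have "conjg g (a \<otimes> b) \<otimes> inv (a \<otimes> b) \<in> N" if g: "g \<in> carrier G" for g
        proof -
          have "(conjg g a \<otimes> inv a) \<otimes> conjg a (conjg g b \<otimes> inv b) \<in> N"
            using a b g ac conjN by (auto simp: N'_def)
          moreover have "(conjg g a \<otimes> inv a) \<otimes> conjg a (conjg g b \<otimes> inv b) = conjg g (a \<otimes> b) \<otimes> inv (a \<otimes> b)"
            using g ac bc by (simp add: conjg_def group_norm)
          ultimately show ?thesis by simp
        qed
        then show "a \<otimes> b \<in> N'" using ac bc by (simp add: N'_def)
      qed (auto simp: N'_def)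
      have norm: "N' \<lhd> G"
      proof (rule normal_of_conjg[OF sub])
        fix g x assume g: "g \<in> carrier G" and x: "x \<in> N'"
        have xc: "x \<in> carrier G" using x by (simp add: N'_def)
        have "conjg g x \<otimes> inv x \<in> N'" using x g NN' by (auto simp: N'_def)
        then have "conjg g x \<otimes> inv x \<otimes> x \<in> N'" using subgroup.m_closed[OF sub] x by blast
        then show "conjg g x \<in> N'" using g xc by (simp add: group_norm)
      qed
      let ?X = "(\<lambda>x. N #> x) ` carrier G"
      have im: "conjg g ` (N #> x) = N #> conjg g x" if "g \<in> carrier G" "x \<in> carrier G" for g x
        by (rule conjg_image_r_coset[OF less.prems that])
      interpret A: set_action G "carrier G" ?X "\<lambda>g C. conjg g ` C"
        using im by (intro set_action_conjg_image subgroup_self)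
          (auto dest: subsetD[OF r_coset_subset_G[OF N.subset]])
      have "card ?X * card N = order G"
      proof -
        have "rcosets N = ?X" by (auto simp: RCOSETS_def)
        then show ?thesis using lagrange[OF Nsub] by simp
      qed
      then have "card ?X dvd p ^ k" using assms(2) by (metis dvd_triv_left)
      then obtain j where j: "card ?X = p ^ j" using divides_primepow_nat[OF assms(1)] by blast
      have "j \<noteq> 0"
      proof
        assume "j = 0"
        then have "card N = order G" using j \<open>card ?X * card N = order G\<close> by simp
        then show False using False N.subset card_subset_eq[OF fin N.subset] by (simp add: order_def)
      qed
      let ?F = "{C \<in> ?X. \<forall>g\<in>carrier G. conjg g ` C = C}"
      have "p dvd card ?F"
      proof -
        have "p dvd card ?X" using j \<open>j \<noteq> 0\<close> by simp
        moreover have "card ?X mod p = card ?F mod p"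
          using A.card_fixed_points_mod[OF assms(1), of k] assms(2) by (simp add: order_def)
        ultimately show ?thesis by (simp only: dvd_eq_mod_eq_0)
      qed
      moreover have "N \<in> ?F"
      proof -
        have "N = N #> \<one>" using N.subset by simp
        then show ?thesis using im[of _ \<one>] by force
      qed
      ultimately have "?F \<noteq> {N}"
        using assms(1) by (metis card.empty card.insert empty_iff finite.emptyI nat_dvd_1_iff_1 not_prime_1 One_nat_def)
      then obtain C where "C \<in> ?F" "C \<noteq> N" using \<open>N \<in> ?F\<close> by blast
      then obtain x where x: "x \<in> carrier G" "N #> x \<noteq> N" "\<And>g. g \<in> carrier G \<Longrightarrow> conjg g ` (N #> x) = N #> x"
        by auto
      have "x \<in> N'"
      proof -
        have "conjg g x \<otimes> inv x \<in> N" if g: "g \<in> carrier G" for g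
        proof -
          have "conjg g x \<in> N #> x"
            using x(3)[OF g] im[OF g x(1)] rcos_self[OF conjg_closed[OF g x(1)] Nsub] by simp
          then show ?thesis using N.rcos_module_imp[OF group_axioms] x g by simp
        qed
        then show ?thesis using x by (simp add: N'_def)
      qed
      moreover have "x \<notin> N" using x N.rcos_const[OF group_axioms] by blast
      ultimately have "card N < card N'"
        using NN' finite_subgroup[OF sub] by (intro psubset_card_mono) auto
      moreover have "card N' \<le> order G" using subgroup.subset[OF sub] by (simp add: order_def card_mono)
      ultimately obtain n where n: "(derived G ^^ n) (carrier G) \<subseteq> N'"
        using less.hyps[OF _ norm] by (meson diff_less_mono2 less_le_trans)
      have "derived G N' \<subseteq> N"
      proof (rule derived_subset_of_commutators[OF Nsub])
        fix x y assume "x \<in> N'" "y \<in> N'"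
        then show "x \<otimes> y \<otimes> inv x \<otimes> inv y \<in> N" by (auto simp: N'_def conjg_def)
      qed
      then have "(derived G ^^ Suc n) (carrier G) \<subseteq> N"
        using mono_derived[OF n] by auto
      then show ?thesis by blast
    qed
  qed
  obtain n where "(derived G ^^ n) (carrier G) \<subseteq> {\<one>}" using step[OF one_is_normal] by blast
  moreover have "\<one> \<in> (derived G ^^ n) (carrier G)"
    using subgroup.one_closed[OF exp_of_derived_is_subgroup[OF subgroup_self]] .
  ultimately show ?thesis using solvable_iff_trivial_derived_seq by blast
qed

end

lemma p_subgroup_solvable:
  assumes "finite_group G" "subgroup P G" "prime p" "card P = p ^ k"
  shows "solvable (G\<lparr>carrier := P\<rparr>)"
proof -
  interpret finite_group G by fact
  interpret P: finite_group "G\<lparr>carrier := P\<rparr>" using assms(2) by (rule finite_group_subgroup)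
  show ?thesis using P.p_group_solvable[OF assms(3)] assms(4) by (simp add: order_def)
qed

text \<open>If \<open>|G| < q\<^sup>2\<close>, two distinct subgroups of order \<open>q\<close> would have \<open>q\<^sup>2\<close> products; hence there is
  only one.\<close>

lemma (in finite_group) normal_prime_subgroup_if_small:
  assumes "prime q" "q dvd order G" "order G < q * q"
  obtains Y where "Y \<lhd> G" "card Y = q"
proof -
  obtain y where y: "y \<in> carrier G" "ord y = q"
    using cauchy[OF subgroup_self assms(1)] assms(2) by (auto simp: order_def)
  have "cyc y \<lhd> G"
  proof (rule normal_of_conjg[OF cyc_subgroup[OF y(1)]], rule ccontr)
    fix g x assume g: "g \<in> carrier G" and x: "x \<in> cyc y" and n: "conjg g x \<notin> cyc y"
    have xc: "x \<in> carrier G" using x y cyc_closed by blast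
    let ?z = "conjg g y"
    have z: "?z \<in> carrier G" "ord ?z = q" using g y by simp_all
    have "?z \<notin> cyc y"
    proof
      assume "?z \<in> cyc y"
      moreover have "conjg g x \<in> cyc ?z" using conjg_cyc_iff g x y xc by blast
      ultimately show False using n cyc_mono y by blast
    qed
    have triv: "t = \<one>" if "t \<in> cyc y" "t \<in> cyc ?z" for t
    proof (rule ccontr)
      assume "t \<noteq> \<one>"
      then have "cyc t = cyc y" "cyc t = cyc ?z"
        using prime_order_cyc_eq[OF y(1) _ that(1) \<open>t \<noteq> \<one>\<close>]
          prime_order_cyc_eq[OF z(1) _ that(2) \<open>t \<noteq> \<one>\<close>] y z assms(1) by simp_all
      then show False using \<open>?z \<notin> cyc y\<close> cyc_self by blast
    qed
    have inj: "inj_on (\<lambda>(a, b). a \<otimes> b) (cyc y \<times> cyc ?z)"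
    proof (rule inj_onI, clarify)
      fix a b c d assume H: "a \<in> cyc y" "b \<in> cyc ?z" "c \<in> cyc y" "d \<in> cyc ?z" "a \<otimes> b = c \<otimes> d"
      note cl = H(1,3)[THEN cyc_closed[OF _ y(1)]] H(2,4)[THEN cyc_closed[OF _ z(1)]]
      have "inv c \<otimes> a = d \<otimes> inv b"
        using cl H(5) by (metis inv_closed inv_solve_left inv_solve_right m_assoc m_closed)
      moreover have "inv c \<otimes> a \<in> cyc y" "d \<otimes> inv b \<in> cyc ?z"
        using H by (auto intro: subgroup.m_closed subgroup.m_inv_closed cyc_subgroup y(1) z(1))
      ultimately have "inv c \<otimes> a = \<one>" "d \<otimes> inv b = \<one>" using triv by metis+
      then show "a = c \<and> b = d"
        using cl by (metis inv_equality inv_inv inv_closed l_inv r_inv inv_unique')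
    qed
    have "(\<lambda>(a, b). a \<otimes> b) ` (cyc y \<times> cyc ?z) \<subseteq> carrier G"
      using cyc_closed y(1) z(1) by fastforce
    then have "card (cyc y \<times> cyc ?z) \<le> order G"
      unfolding order_def using card_inj_on_le[OF inj _ fin] by blast
    then show False
      using assms(3) y z by (simp add: card_cartesian_product card_cyc)
  qed
  then show thesis using that card_cyc y by blast
qed

lemma order_le_4_solvable:
  assumes "finite_group G" "order G \<le> 4" shows "solvable G"
proof -
  interpret finite_group G by fact
  have "order G > 0" using order_gt_0_iff_finite by simp
  then consider "order G = 2 ^ 0" | "order G = 2 ^ 1" | "order G = 3 ^ 1" | "order G = 2 ^ 2"
    using assms(2) by fastforce
  then show ?thesis
    using p_group_solvable[of 2] p_group_solvable[of 3 1] by cases (blast intro: two_is_prime_nat, blast intro: two_is_prime_nat, simp, blast intro: two_is_prime_nat)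
qed

lemma small_group_solvable:
  assumes "finite_group G" "prime q" "q dvd order G" "order G < q * q" "order G \<le> 4 * q"
  shows "solvable G"
proof -
  interpret finite_group G by fact
  obtain Y where Y: "Y \<lhd> G" "card Y = q"
    using normal_prime_subgroup_if_small assms by blast
  have "order (G Mod Y) * q = order G" using order_quotient[OF Y(1)] Y(2) by simp
  then have "order (G Mod Y) \<le> 4" using assms(2,5) by (metis mult_le_cancel2 prime_gt_0_nat)
  then have "solvable (G Mod Y)"
    using order_le_4_solvable finite_group_quotient[OF Y(1)] by blast
  moreover have "solvable (G\<lparr>carrier := Y\<rparr>)"
    using p_subgroup_solvable[OF assms(1) normal_imp_subgroup[OF Y(1)] assms(2), of 1] Y by simp
  ultimately show ?thesis using solvable_of_normal_quotient Y by blast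
qed

lemma order_le_6_solvable:
  assumes "finite_group G" "order G \<le> 6" shows "solvable G"
proof -
  interpret finite_group G by fact
  consider "order G \<le> 4" | "order G = 5 ^ 1" | "order G = 6"
    using assms(2) by fastforce
  then show ?thesis
  proof cases
    case 2
    then show ?thesis using p_group_solvable[of 5 1] by simp
  next
    case 3
    then show ?thesis using small_group_solvable[OF assms(1), of 3] by simp
  qed (use assms order_le_4_solvable in auto)
qed

section \<open>Groups with claw-free reduced power graph\<close>

lemma (in group) cyc_inv: "x \<in> carrier G \<Longrightarrow> inv x \<in> cyc x"
  using subgroup.m_inv_closed[OF cyc_subgroup cyc_self] .

definition (in group) incomparable :: "'a \<Rightarrow> 'a \<Rightarrow> bool" where
  "incomparable a b \<longleftrightarrow> a \<notin> cyc b \<and> b \<notin> cyc a"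

text \<open>An element below the centre of a claw is comparable with any element above it, so that the
  leaves are all above or all below the centre.\<close>

locale claw_free_group = finite_group +
  assumes no_claw_above:
    "\<lbrakk>v \<noteq> \<one>; a \<in> carrier G; b \<in> carrier G; c \<in> carrier G; v \<in> cyc a; v \<in> cyc b; v \<in> cyc c;
      incomparable a b; incomparable a c; incomparable b c\<rbrakk> \<Longrightarrow> False"
  and no_claw_below:
    "\<lbrakk>v \<in> carrier G; a \<in> cyc v; b \<in> cyc v; c \<in> cyc v;
      incomparable a b; incomparable a c; incomparable b c\<rbrakk> \<Longrightarrow> False"

lemma (in group) claw_free_no_star:
  assumes cf: "claw_free (reduced_power_graph G)"
    and "v \<in> carrier G" "v \<noteq> \<one>" "a \<in> carrier G" "b \<in> carrier G" "c \<in> carrier G"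
    and adj: "\<And>x. x \<in> {a, b, c} \<Longrightarrow> x \<noteq> \<one> \<and> x \<noteq> v \<and> (v \<in> cyc x \<or> x \<in> cyc v)"
    and inc: "incomparable a b" "incomparable a c" "incomparable b c"
  shows False
proof -
  have distinct: "a \<noteq> b" "a \<noteq> c" "b \<noteq> c"
    using inc cyc_self by (auto simp: incomparable_def)
  have pow: "(\<exists>k::int. x = y [^] k) \<longleftrightarrow> x \<in> cyc y" if "y \<in> carrier G" for x y
    using generate_pow[OF that] by auto
  let ?H = "with_proj \<lparr>pverts = {v, a, b, c}, parcs = {v} \<times> {a, b, c} \<union> {a, b, c} \<times> {v}\<rparr>"
  let ?\<Gamma> = "reduced_power_graph G"
  have verts: "verts ?\<Gamma> = carrier G - {\<one>}" and tail: "tail ?\<Gamma> = fst" and head: "head ?\<Gamma> = snd"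
    by (simp_all add: reduced_power_graph_def induce_subgraph_def with_proj_def)
  have arcs: "(x, y) \<in> arcs ?\<Gamma> \<longleftrightarrow> x \<in> carrier G - {\<one>} \<and> y \<in> carrier G - {\<one>} \<and> x \<noteq> y \<and> (y \<in> cyc x \<or> x \<in> cyc y)" for x y
  proof (cases "x \<in> carrier G \<and> y \<in> carrier G")
    case True
    then have "(\<exists>k::int. y = x [^] k) \<longleftrightarrow> y \<in> cyc x" "(\<exists>k::int. x = y [^] k) \<longleftrightarrow> x \<in> cyc y"
      using pow by auto
    then show ?thesis
      using True by (simp add: reduced_power_graph_def induce_subgraph_def power_graph_def) blast
  qed (auto simp: reduced_power_graph_def induce_subgraph_def power_graph_def)
  have mem: "v \<in> carrier G - {\<one>}" "a \<in> carrier G - {\<one>}" "b \<in> carrier G - {\<one>}" "c \<in> carrier G - {\<one>}"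
    using assms by auto
  have "subgraph ?H ?\<Gamma>"
    unfolding subgraph_def
  proof (intro conjI)
    show "verts ?H \<subseteq> verts ?\<Gamma>" using mem verts by simp
    show "arcs ?H \<subseteq> arcs ?\<Gamma>" using mem adj arcs by auto
    show "wf_digraph ?\<Gamma>"
      by unfold_locales (auto simp: verts tail head arcs)
    show "wf_digraph ?H"
      by unfold_locales auto
    show "compatible ?\<Gamma> ?H" by (simp add: compatible_def tail head)
  qed
  moreover have "arcs ?H = {e \<in> arcs ?\<Gamma>. tail ?\<Gamma> e \<in> verts ?H \<and> head ?\<Gamma> e \<in> verts ?H}"
  proof -
    have 1: "(v, x) \<in> arcs ?\<Gamma>" "(x, v) \<in> arcs ?\<Gamma>" if "x \<in> {a, b, c}" for x
      using mem adj[OF that] that by (auto simp: arcs)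
    have 2: "(x, y) \<notin> arcs ?\<Gamma>" if "x \<in> {a, b, c}" "y \<in> {a, b, c}" for x y
      using that inc by (auto simp: arcs incomparable_def)
    have 3: "(v, v) \<notin> arcs ?\<Gamma>" by (simp add: arcs)
    have "(x, y) \<in> arcs ?H \<longleftrightarrow> (x, y) \<in> arcs ?\<Gamma> \<and> x \<in> {v, a, b, c} \<and> y \<in> {v, a, b, c}" for x y
    proof (cases "x = v"; cases "y = v")
      assume "x \<noteq> v" "y \<noteq> v"
      then show ?thesis using 2[of x y] by auto
    qed (use 1[of x] 1[of y] 3 adj in auto)
    then show ?thesis by (simp add: set_eq_iff tail head split_paired_all)
  qed
  ultimately have "induced_subgraph ?H ?\<Gamma>" by (simp add: induced_subgraph_def)
  moreover have "complete_bipartite_digraph 1 3 ?H"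
    unfolding complete_bipartite_digraph_pair_def
  proof (intro conjI exI)
    show "pverts \<lparr>pverts = {v, a, b, c}, parcs = {v} \<times> {a, b, c} \<union> {a, b, c} \<times> {v}\<rparr> = {v} \<union> {a, b, c}"
      by auto
    show "{v} \<inter> {a, b, c} = {}" using adj[of a] adj[of b] adj[of c] by auto
    show "card {a, b, c} = 3" using distinct by simp
  qed auto
  ultimately show False using cf by (auto simp: claw_free_def)
qed

lemma (in finite_group) claw_free_group_if:
  assumes "claw_free (reduced_power_graph G)" shows "claw_free_group G"
proof (intro claw_free_group.intro claw_free_group_axioms.intro finite_group_axioms)
  have ne: "x \<noteq> \<one>" if "incomparable x y" "y \<in> carrier G" for x y
    using that subgroup.one_closed[OF cyc_subgroup] by (auto simp: incomparable_def)
  have sym: "incomparable y x" if "incomparable x y" for x y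
    using that by (simp add: incomparable_def)
  show False if "v \<noteq> \<one>" "a \<in> carrier G" "b \<in> carrier G" "c \<in> carrier G" "v \<in> cyc a" "v \<in> cyc b" "v \<in> cyc c"
      and inc: "incomparable a b" "incomparable a c" "incomparable b c" for v a b c
  proof (rule claw_free_no_star[OF assms _ _ _ _ _ _ inc, of v])
    fix x assume "x \<in> {a, b, c}"
    then show "x \<noteq> \<one> \<and> x \<noteq> v \<and> (v \<in> cyc x \<or> x \<in> cyc v)"
      using that ne[of a b] ne[of b a] ne[of c a] sym by (auto simp: incomparable_def)
  qed (use that cyc_closed in auto)
  show False if "v \<in> carrier G" "a \<in> cyc v" "b \<in> cyc v" "c \<in> cyc v"
      and inc: "incomparable a b" "incomparable a c" "incomparable b c" for v a b c
  proof (rule claw_free_no_star[OF assms _ _ _ _ _ _ inc, of v])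
    have cl: "a \<in> carrier G" "b \<in> carrier G" "c \<in> carrier G"
      using that cyc_closed by auto
    then show "a \<in> carrier G" "b \<in> carrier G" "c \<in> carrier G" by auto
    fix x assume "x \<in> {a, b, c}"
    then show "x \<noteq> \<one> \<and> x \<noteq> v \<and> (v \<in> cyc x \<or> x \<in> cyc v)"
      using that cl ne[of a b] ne[of b a] ne[of c a] sym by (auto simp: incomparable_def)
  next
    show "v \<noteq> \<one>"
      using that inc cyc_self[of a] cyc_self[of b] generate_one by (auto simp: incomparable_def)
  qed (use that in auto)
qed

context claw_free_group
begin

lemma claw_free_subgroup:
  assumes "subgroup H G" shows "claw_free_group (G\<lparr>carrier := H\<rparr>)"
proof -
  interpret H: finite_group "G\<lparr>carrier := H\<rparr>" using assms by (rule finite_group_subgroup)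
  have cyc: "generate (G\<lparr>carrier := H\<rparr>) {x} = cyc x" if "x \<in> H" for x
    using generate_consistent[of "{x}" H] that assms by simp
  have inc: "incomparable x y" if "H.incomparable x y" "x \<in> H" "y \<in> H" for x y
    using that by (simp add: incomparable_def H.incomparable_def cyc)
  have cl: "x \<in> carrier G" if "x \<in> H" for x using subgroup.mem_carrier[OF assms that] .
  show ?thesis
  proof (intro claw_free_group.intro claw_free_group_axioms.intro H.finite_group_axioms)
    show False if "v \<noteq> \<one>\<^bsub>G\<lparr>carrier := H\<rparr>\<^esub>" "a \<in> carrier (G\<lparr>carrier := H\<rparr>)" "b \<in> carrier (G\<lparr>carrier := H\<rparr>)"
      "c \<in> carrier (G\<lparr>carrier := H\<rparr>)" "v \<in> generate (G\<lparr>carrier := H\<rparr>) {a}" "v \<in> generate (G\<lparr>carrier := H\<rparr>) {b}"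
      "v \<in> generate (G\<lparr>carrier := H\<rparr>) {c}" "H.incomparable a b" "H.incomparable a c" "H.incomparable b c"
      for v a b c
      using no_claw_above[of v a b c] that inc cl by (simp add: cyc)
    show False if "v \<in> carrier (G\<lparr>carrier := H\<rparr>)" "a \<in> generate (G\<lparr>carrier := H\<rparr>) {v}"
      "b \<in> generate (G\<lparr>carrier := H\<rparr>) {v}" "c \<in> generate (G\<lparr>carrier := H\<rparr>) {v}"
      "H.incomparable a b" "H.incomparable a c" "H.incomparable b c" for v a b c
    proof -
      have v: "v \<in> H" using that(1) by simp
      then have "cyc v \<subseteq> H" using cyc_subset_iff[OF assms] cl by blast
      then have "a \<in> H" "b \<in> H" "c \<in> H" using that(2-4) v by (auto simp: cyc)
      then show False
        using no_claw_below[of v a b c] that inc cl v by (simp add: cyc)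
    qed
  qed
qed

text \<open>Two \<open>p\<close>-th roots of \<open>s\<close> are comparable only if they differ by an element of the subgroup of
  order \<open>p\<close> of \<open>\<langle>s\<rangle>\<close>. So more than \<open>2p\<close> of them would contain three that form a claw with centre
  \<open>s\<close>.\<close>

lemma card_roots_le:
  assumes s: "s \<in> carrier G" and p: "prime p" "p dvd ord s"
  shows "card {x \<in> carrier G. x [^] p = s} \<le> 2 * p"
proof (rule ccontr)
  let ?R = "{x \<in> carrier G. x [^] p = s}"
  assume big: "\<not> card ?R \<le> 2 * p"
  define t0 where "t0 = s [^] (ord s div p)"
  have t0: "t0 \<in> carrier G" "ord t0 = p" using s p ord_prime_pow by (auto simp: t0_def)
  have s1: "s \<noteq> \<one>" using p by (metis ord_id nat_dvd_1_iff_1 not_prime_1)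
  have root: "\<exists>t\<in>cyc t0. x' = x \<otimes> t" if x: "x \<in> ?R" "x' \<in> ?R" "x' \<in> cyc x" for x x'
  proof -
    have xc: "x \<in> carrier G" "x [^] p = s" "x' [^] p = s" using x by auto
    obtain k :: nat where k: "x' = x [^] k" using x(3) xc cyc_iff by blast
    have sk: "s [^] k = s"
      using k xc by (metis mult.commute nat_pow_pow)
    have "k \<noteq> 0"
    proof
      assume "k = 0"
      then have "s = \<one>" using sk by simp
      then show False using s1 by simp
    qed
    then obtain j where j: "k = Suc j" using not0_implies_Suc by blast
    have "s [^] j = \<one>" using sk s unfolding j by (simp add: l_cancel_one)
    then obtain m where m: "j = ord s * m" using s pow_eq_id by blast
    obtain n where n: "ord s = p * n" using p(2) by blast
    have "x' = x \<otimes> x [^] j" using k j xc nat_pow_Suc2 by simp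
    moreover have "x [^] j = t0 [^] m"
      using xc s n m prime_gt_0_nat[OF p(1)] by (simp add: t0_def nat_pow_pow[symmetric])
    ultimately show ?thesis using t0 cyc_iff by blast
  qed
  have coset: "finite ((\<lambda>t. x \<otimes> t) ` cyc t0) \<and> card ((\<lambda>t. x \<otimes> t) ` cyc t0) \<le> p" for x
    using card_image_le[of "cyc t0" "\<lambda>t. x \<otimes> t"] t0 card_cyc by simp
  have sym: "x' \<in> (\<lambda>t. x \<otimes> t) ` cyc t0" if "x \<in> ?R" "x = x' \<otimes> t" "t \<in> cyc t0" "x' \<in> ?R" for x x' t
  proof -
    have "x' = x \<otimes> inv t" using that t0 cyc_closed by (simp add: m_assoc)
    then show ?thesis using that subgroup.m_inv_closed[OF cyc_subgroup[OF t0(1)]] by blast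
  qed
  have inc: "incomparable x x'" if "x \<in> ?R" "x' \<in> ?R" "x' \<notin> (\<lambda>t. x \<otimes> t) ` cyc t0" for x x'
    using root[OF that(1,2)] root[OF that(2,1)] sym[OF that(1) _ _ that(2)] that(3)
    by (auto simp: incomparable_def)
  have pick: "\<exists>x\<in>?R. x \<notin> A" if "finite A" "card A \<le> 2 * p" for A
    using that big by (meson card_mono le_trans subsetI)
  obtain x1 where x1: "x1 \<in> ?R" using pick[of "{}"] by auto
  obtain x2 where x2: "x2 \<in> ?R" "x2 \<notin> (\<lambda>t. x1 \<otimes> t) ` cyc t0"
    using pick[of "(\<lambda>t. x1 \<otimes> t) ` cyc t0"] coset[of x1] by auto
  have "card ((\<lambda>t. x1 \<otimes> t) ` cyc t0 \<union> (\<lambda>t. x2 \<otimes> t) ` cyc t0) \<le> 2 * p"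
    using coset[of x1] coset[of x2] card_Un_le[of "(\<lambda>t. x1 \<otimes> t) ` cyc t0" "(\<lambda>t. x2 \<otimes> t) ` cyc t0"] by linarith
  then obtain x3 where x3: "x3 \<in> ?R" "x3 \<notin> (\<lambda>t. x1 \<otimes> t) ` cyc t0 \<union> (\<lambda>t. x2 \<otimes> t) ` cyc t0"
    using pick[of "(\<lambda>t. x1 \<otimes> t) ` cyc t0 \<union> (\<lambda>t. x2 \<otimes> t) ` cyc t0"] coset[of x1] coset[of x2] by blast
  have "s \<in> cyc x" if "x \<in> ?R" for x using that cyc_iff by blast
  then show False
    using no_claw_above[of s x1 x2 x3] s1 x1 x2 x3 inc by auto
qed

text \<open>If \<open>Y\<^sub>1\<close>, \<open>Y\<^sub>2\<close>, \<open>Y\<^sub>3\<close> are distinct subgroups of prime order \<open>\<noteq> p\<close> centralizing \<open>z\<close>, then the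
  cyclic groups \<open>\<langle>z\<rangle>Y\<^sub>i\<close> are incomparable, and their generators form a claw with centre \<open>z\<close>. Two such
  subgroups produce a third one by conjugation, unless they commute. If they commute and have the
  same order, their product contains a third one; if they have different orders, then \<open>z\<close> and their
  generators are the leaves of a claw whose centre is the product of the three.\<close>

lemma prime_order_centralizer_unique:
  assumes z: "z \<in> carrier G" "ord z = p" "prime p"
    and y1: "y1 \<in> carrier G" "z \<otimes> y1 = y1 \<otimes> z" "prime (ord y1)" "ord y1 \<noteq> p"
    and y2: "y2 \<in> carrier G" "z \<otimes> y2 = y2 \<otimes> z" "prime (ord y2)" "ord y2 \<noteq> p"
  shows "cyc y1 = cyc y2"
proof (rule ccontr)
  assume ne: "cyc y1 \<noteq> cyc y2"
  let ?S = "{y \<in> carrier G. z \<otimes> y = y \<otimes> z \<and> prime (ord y) \<and> ord y \<noteq> p}"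
  have cp: "coprime (ord z) (ord y)" if "y \<in> ?S" for y
    using that z primes_coprime[of "ord z" "ord y"] by auto
  have zin: "z \<in> cyc (z \<otimes> y)" "y \<in> cyc (z \<otimes> y)" "ord (z \<otimes> y) = p * ord y" if "y \<in> ?S" for y
    using coprime_commuting_cyc[OF z(1) _ _ cp[OF that]] ord_coprime_commuting[OF z(1) _ _ cp[OF that]] that z
    by auto
  have notin: "z \<otimes> y \<notin> cyc (z \<otimes> y')" if "y \<in> ?S" "y' \<in> ?S" "cyc y \<noteq> cyc y'" for y y'
  proof
    assume "z \<otimes> y \<in> cyc (z \<otimes> y')"
    then have yin: "y \<in> cyc (z \<otimes> y')" using zin[OF that(1)] cyc_mono[of "z \<otimes> y" "z \<otimes> y'"] z that by auto
    then have "ord y dvd p * ord y'" using ord_dvd_of_cyc[OF yin] zin[OF that(2)] z that by simp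
    then have "ord y dvd p \<or> ord y dvd ord y'"
      using that(1) prime_dvd_mult_iff[of "ord y" p "ord y'"] by simp
    then have "ord y = ord y'"
      using that z(3) by (auto simp: primes_dvd_imp_eq)
    then show False
      using cyc_unique_prime_subgroup[of "z \<otimes> y'" y y' "ord y'"] yin zin[OF that(2)] that z by auto
  qed
  have three: False if "a \<in> ?S" "b \<in> ?S" "c \<in> ?S" "cyc a \<noteq> cyc b" "cyc a \<noteq> cyc c" "cyc b \<noteq> cyc c" for a b c
  proof (rule no_claw_above[of z "z \<otimes> a" "z \<otimes> b" "z \<otimes> c"])
    show "z \<noteq> \<one>" using z by (metis ord_id not_prime_1)
    show "incomparable (z \<otimes> a) (z \<otimes> b)" "incomparable (z \<otimes> a) (z \<otimes> c)" "incomparable (z \<otimes> b) (z \<otimes> c)"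
      unfolding incomparable_def
      using notin[OF that(1,2,4)] notin[OF that(2,1) that(4)[symmetric]] notin[OF that(1,3,5)]
        notin[OF that(3,1) that(5)[symmetric]] notin[OF that(2,3,6)] notin[OF that(3,2) that(6)[symmetric]]
      by simp_all
    show "z \<in> cyc (z \<otimes> a)" "z \<in> cyc (z \<otimes> b)" "z \<in> cyc (z \<otimes> c)" using zin(1) that by blast+
    show "z \<otimes> a \<in> carrier G" "z \<otimes> b \<in> carrier G" "z \<otimes> c \<in> carrier G" using that z by simp_all
  qed
  have S: "y1 \<in> ?S" "y2 \<in> ?S" using y1 y2 by auto
  have conj: "conjg a b \<in> cyc b" if "a \<in> ?S" "b \<in> ?S" "cyc a \<noteq> cyc b" for a b
  proof -
    have ab: "a \<in> carrier G" "b \<in> carrier G" "z \<otimes> a = a \<otimes> z" "z \<otimes> b = b \<otimes> z" using that by auto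
    have "a \<in> centralizer {z}" "b \<in> centralizer {z}" using ab by (auto simp: centralizer_def)
    then have "conjg a b \<in> centralizer {z}"
      using z(1) by (intro subgroup_conjg_closed[OF subgroup_centralizer]) auto
    then have "z \<otimes> conjg a b = conjg a b \<otimes> z" by (simp add: centralizer_def)
    then have inS: "conjg a b \<in> ?S" using that by auto
    have "cyc (conjg a b) \<noteq> cyc a"
    proof
      assume "cyc (conjg a b) = cyc a"
      then have "conjg a b \<in> cyc a" using cyc_self by blast
      then have "conjg (inv a) (conjg a b) \<in> cyc a"
        using subgroup_conjg_closed[OF cyc_subgroup[OF ab(1)] cyc_inv[OF ab(1)]] by blast
      then have "b \<in> cyc a" using ab by simp
      moreover have "b \<noteq> \<one>" using that(2) by (auto simp: ord_eq_1)
      ultimately have "cyc b = cyc a" using prime_order_cyc_eq[OF ab(1)] that(1) by auto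
      then show False using that by simp
    qed
    then have "cyc (conjg a b) = cyc b" using three[OF that(1,2) inS] that(3) by metis
    then show ?thesis using cyc_self by blast
  qed
  have ne1: "y1 \<noteq> \<one>" "y2 \<noteq> \<one>" using y1 y2 by (auto simp: ord_eq_1)
  have meet: "t = \<one>" if "t \<in> cyc y1" "t \<in> cyc y2" for t
  proof (rule ccontr)
    assume t: "t \<noteq> \<one>"
    show False
      using prime_order_cyc_eq[OF y1(1,3) that(1) t] prime_order_cyc_eq[OF y2(1,3) that(2) t] ne by simp
  qed
  have "conjg y1 y2 \<otimes> inv y2 \<in> cyc y2"
    by (rule subgroup.m_closed[OF cyc_subgroup[OF y2(1)] conj[OF S ne] cyc_inv[OF y2(1)]])
  moreover have "conjg y1 y2 \<otimes> inv y2 = y1 \<otimes> inv (conjg y2 y1)"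
    using y1 y2 by (simp add: conjg_def group_norm)
  moreover have "y1 \<otimes> inv (conjg y2 y1) \<in> cyc y1"
    by (rule subgroup.m_closed[OF cyc_subgroup[OF y1(1)] cyc_self
          subgroup.m_inv_closed[OF cyc_subgroup[OF y1(1)] conj[OF S(2,1) ne[symmetric]]]])
  ultimately have "conjg y1 y2 \<otimes> inv y2 = \<one>" using meet by simp
  then have "inv (inv y2) = conjg y1 y2"
    using y1(1) y2(1) by (intro inv_equality) auto
  then have "conjg y1 y2 = y2" using y2(1) by simp
  then have comm: "y1 \<otimes> y2 = y2 \<otimes> y1" using y1 y2 conjg_eq_self_iff by blast
  define w where "w = y1 \<otimes> y2"
  have wc: "w \<in> carrier G" "z \<otimes> w = w \<otimes> z"
    using y1 y2 z(1) unfolding w_def by (simp, metis m_assoc)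
  show False
  proof (cases "ord y1 = ord y2")
    case True
    have "w [^] ord y1 = \<one>"
      using pow_mult_distrib[OF comm y1(1) y2(1), of "ord y1"] pow_ord_eq_1[OF y1(1)] y1(1) y2(1) True
      unfolding w_def by simp
    then have "ord w dvd ord y1" using wc pow_eq_id by blast
    moreover have y2w: "y2 = inv y1 \<otimes> w" and y1w: "y1 = w \<otimes> inv y2"
      using y1 y2 by (auto simp: w_def m_assoc)
    have n1: "cyc w \<noteq> cyc y1"
    proof
      assume "cyc w = cyc y1"
      then have "w \<in> cyc y1" using cyc_self[of w] by simp
      then have "y2 \<in> cyc y1"
        using subgroup.m_closed[OF cyc_subgroup[OF y1(1)] cyc_inv[OF y1(1)], of w] y2w by simp
      then show False using prime_order_cyc_eq[OF y1(1,3) _ ne1(2)] ne by auto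
    qed
    have n2: "cyc w \<noteq> cyc y2"
    proof
      assume "cyc w = cyc y2"
      then have "w \<in> cyc y2" using cyc_self[of w] by simp
      then have "y1 \<in> cyc y2"
        using subgroup.m_closed[OF cyc_subgroup[OF y2(1)] _ cyc_inv[OF y2(1)], of w] y1w by simp
      then show False using prime_order_cyc_eq[OF y2(1,3) _ ne1(1)] ne by auto
    qed
    have "w \<noteq> \<one>"
    proof
      assume "w = \<one>"
      then have "y2 \<in> cyc y1" using y2w y1 cyc_inv[OF y1(1)] by simp
      then show False using prime_order_cyc_eq[OF y1(1,3) _ ne1(2)] ne by auto
    qed
    ultimately have "ord w = ord y1" using wc y1(3) ord_eq_1 prime_nat_iff by blast
    then have wS: "w \<in> ?S" using wc y1 by auto
    show False by (rule three[OF S wS ne n1[symmetric] n2[symmetric]])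
  next
    case False
    have c12: "coprime (ord y1) (ord y2)" using False y1 y2 primes_coprime by blast
    have ow: "ord w = ord y1 * ord y2" unfolding w_def using ord_coprime_commuting y1 y2 comm c12 by blast
    have cw: "coprime (ord z) (ord w)" unfolding ow using cp S by simp
    note zw = coprime_commuting_cyc[OF z(1) wc cw]
    have "y1 \<in> cyc w" "y2 \<in> cyc w"
      unfolding w_def using coprime_commuting_cyc[OF y1(1) y2(1) comm c12] by auto
    then have "y1 \<in> cyc (z \<otimes> w)" "y2 \<in> cyc (z \<otimes> w)"
      using zw(2) cyc_mono[of w "z \<otimes> w"] z wc by auto
    moreover have "incomparable a b" if "a \<in> carrier G" "b \<in> carrier G" "prime (ord a)" "prime (ord b)" "ord a \<noteq> ord b" for a b
      using that ord_dvd_of_cyc[of a b] ord_dvd_of_cyc[of b a] primes_dvd_imp_eq[of "ord a" "ord b"]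
        primes_dvd_imp_eq[of "ord b" "ord a"] by (auto simp: incomparable_def)
    ultimately show False
      using no_claw_below[of "z \<otimes> w" z y1 y2] zw(1) z wc y1 y2 False by auto
  qed
qed

lemma ex_max_nat:
  fixes f :: "'x \<Rightarrow> nat"
  assumes "finite A" "A \<noteq> {}"
  obtains m where "m \<in> A" "\<And>x. x \<in> A \<Longrightarrow> f x \<le> f m"
proof -
  have "Max (f ` A) \<in> f ` A" using assms by simp
  then obtain m where "m \<in> A" "f m = Max (f ` A)" by auto
  then show thesis using that[of m] assms by simp
qed

text \<open>The maximal cyclic subgroups of \<open>D\<close> contain \<open>g\<close>, so there are at most two of them; but a group
  is not the union of two proper subgroups.\<close>

lemma cyclic_if_common_element:
  assumes D: "subgroup D G" and g: "g \<noteq> \<one>"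
    and ex: "\<And>x. x \<in> D \<Longrightarrow> \<exists>c\<in>D. x \<in> cyc c \<and> g \<in> cyc c"
  obtains c where "c \<in> D" "D = cyc c"
proof -
  have Dc: "x \<in> carrier G" if "x \<in> D" for x using subgroup.mem_carrier[OF D that] .
  have sub: "cyc c \<subseteq> D" if "c \<in> D" for c using cyc_subset_iff[OF D] Dc that by blast
  let ?A = "{c \<in> D. g \<in> cyc c}"
  have finA: "finite ?A" using D by simp
  have "?A \<noteq> {}" using ex[OF subgroup.one_closed[OF D]] by blast
  then obtain c1 where c1: "c1 \<in> ?A" "\<And>c. c \<in> ?A \<Longrightarrow> ord c \<le> ord c1"
    using ex_max_nat[OF finA, of ord] by blast
  have less: "ord a < ord b" if "a \<in> cyc b" "b \<notin> cyc a" "b \<in> carrier G" for a b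
  proof -
    have "cyc a \<subset> cyc b" using that cyc_mono cyc_self by blast
    then show ?thesis
      using psubset_card_mono[of "cyc b" "cyc a"] that card_cyc cyc_closed by simp
  qed
  show thesis
  proof (cases "D = cyc c1")
    case True
    then show ?thesis using that c1 by blast
  next
    case False
    let ?B = "{c \<in> ?A. c \<notin> cyc c1}"
    obtain x where x: "x \<in> D" "x \<notin> cyc c1" using False sub c1 by blast
    obtain c where "c \<in> D" "x \<in> cyc c" "g \<in> cyc c" using ex[OF x(1)] by blast
    then have "c \<in> ?B" using x cyc_mono[of c c1] Dc c1(1) by blast
    then have "?B \<noteq> {}" by blast
    moreover have finB: "finite ?B" by (rule finite_subset[OF _ finA]) auto
    ultimately obtain c2 where c2: "c2 \<in> ?B" "\<And>c. c \<in> ?B \<Longrightarrow> ord c \<le> ord c2"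
      using ex_max_nat[OF finB, of ord] by blast
    have cc: "c1 \<in> carrier G" "c2 \<in> carrier G" "c1 \<in> D" "c2 \<in> D" using c1 c2 Dc by auto
    have n12: "c1 \<notin> cyc c2" using less[of c1 c2] c1(2)[of c2] c2(1) cc by auto
    have cover: "y \<in> cyc c1 \<or> y \<in> cyc c2" if y: "y \<in> D" for y
    proof (rule ccontr)
      assume n: "\<not> (y \<in> cyc c1 \<or> y \<in> cyc c2)"
      obtain c3 where c3: "c3 \<in> D" "y \<in> cyc c3" "g \<in> cyc c3" using ex[OF y] by blast
      have c3c: "c3 \<in> carrier G" using c3 Dc by blast
      have n3: "c3 \<notin> cyc c1" "c3 \<notin> cyc c2" using n c3 cyc_mono cc by blast+
      then have "c1 \<notin> cyc c3" using less[of c1 c3] c1(2)[of c3] c3 c3c by auto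
      moreover have "c2 \<notin> cyc c3" using less[of c2 c3] c2(2)[of c3] c3 c3c n3 by auto
      ultimately show False
        using no_claw_above[of g c1 c2 c3] g c1 c2 c3 c3c cc n3 n12 by (auto simp: incomparable_def)
    qed
    have "c1 \<otimes> c2 \<in> D" using subgroup.m_closed[OF D cc(3,4)] .
    then consider "c1 \<otimes> c2 \<in> cyc c1" | "c1 \<otimes> c2 \<in> cyc c2" using cover by blast
    then show ?thesis
    proof cases
      case 1
      have "inv c1 \<otimes> (c1 \<otimes> c2) \<in> cyc c1"
        using subgroup.m_closed[OF cyc_subgroup[OF cc(1)] cyc_inv[OF cc(1)] 1] .
      then show ?thesis using cc c2 by simp
    next
      case 2
      have "(c1 \<otimes> c2) \<otimes> inv c2 \<in> cyc c2"
        using subgroup.m_closed[OF cyc_subgroup[OF cc(2)] 2 cyc_inv[OF cc(2)]] .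
      then show ?thesis using cc n12 by (simp add: m_assoc)
    qed
  qed
qed

text \<open>Any \<open>x\<close> that commutes with \<open>z\<close> and \<open>y\<close> lies in a cyclic subgroup of their centralizer containing
  \<open>z\<close>: if \<open>ord z\<close> divides \<open>ord x\<close>, then \<open>z\<close> is itself a power of \<open>x\<close>, as the centralizer of \<open>y\<close> has only
  one subgroup of order \<open>ord z\<close>; otherwise \<open>xz\<close> generates such a subgroup. The same holds for \<open>y\<close>, and
  so \<open>zy\<close> is a common element of suitable cyclic subgroups that cover the centralizer.\<close>

lemma centralizer_two_primes_cyclic:
  assumes z: "z \<in> carrier G" "prime (ord z)" and y: "y \<in> carrier G" "prime (ord y)"
    and ne: "ord z \<noteq> ord y" and comm: "z \<otimes> y = y \<otimes> z"
  obtains c where "c \<in> carrier G" "centralizer {z, y} = cyc c"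
proof -
  let ?D = "centralizer {z, y}"
  have D: "subgroup ?D G" using z y by (intro subgroup_centralizer) auto
  have step: "\<exists>c\<in>?D. x \<in> cyc c \<and> a \<in> cyc c"
    if x: "x \<in> ?D" and a: "a \<in> ?D" "prime (ord a)"
      and u: "\<And>a'. \<lbrakk>a' \<in> ?D; ord a' = ord a\<rbrakk> \<Longrightarrow> cyc a' = cyc a"
      and c: "x \<otimes> a = a \<otimes> x" for x a
  proof (cases "ord a dvd ord x")
    case True
    let ?b = "x [^] (ord x div ord a)"
    have xc: "x \<in> carrier G" using x by (simp add: centralizer_def)
    have "?b \<in> ?D" using subgroup_nat_pow_closed[OF D x] .
    then have "cyc ?b = cyc a" using u ord_prime_pow[OF xc a(2) True] by blast
    then have "a \<in> cyc ?b" using cyc_self by blast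
    moreover have "?b \<in> cyc x" using xc cyc_iff by blast
    ultimately have "a \<in> cyc x" using cyc_mono[OF _ xc] by blast
    then show ?thesis using x cyc_self by blast
  next
    case False
    have xc: "x \<in> carrier G" "a \<in> carrier G" using x a by (simp_all add: centralizer_def)
    have "coprime (ord x) (ord a)" using False a(2) prime_imp_coprime coprime_commute by metis
    then show ?thesis
      using coprime_commuting_cyc[OF xc c] subgroup.m_closed[OF D x a(1)] by blast
  qed
  have zD: "z \<in> ?D" and yD: "y \<in> ?D" using z y comm by (auto simp: centralizer_def)
  have comz: "x \<otimes> z = z \<otimes> x" "x \<otimes> y = y \<otimes> x" if "x \<in> ?D" for x using that by (auto simp: centralizer_def)
  have uz: "cyc a = cyc z" if "a \<in> ?D" "ord a = ord z" for a
  proof -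
    have "y \<otimes> a = a \<otimes> y" using comz[OF that(1)] by simp
    then show ?thesis
      using prime_order_centralizer_unique[OF y(1) refl y(2), of a z] that z ne comm
      by (auto simp: centralizer_def)
  qed
  have uy: "cyc a = cyc y" if "a \<in> ?D" "ord a = ord y" for a
  proof -
    have "z \<otimes> a = a \<otimes> z" using comz[OF that(1)] by simp
    then show ?thesis
      using prime_order_centralizer_unique[OF z(1) refl z(2), of a y] that y ne comm
      by (auto simp: centralizer_def)
  qed
  have "\<exists>c\<in>?D. x \<in> cyc c \<and> z \<otimes> y \<in> cyc c" if x: "x \<in> ?D" for x
  proof -
    obtain c where c: "c \<in> ?D" "x \<in> cyc c" "z \<in> cyc c" using step[OF x zD z(2) uz comz(1)[OF x]] by blast
    obtain d where d: "d \<in> ?D" "c \<in> cyc d" "y \<in> cyc d" using step[OF c(1) yD y(2) uy comz(2)[OF c(1)]] by blast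
    have dc: "d \<in> carrier G" using d by (simp add: centralizer_def)
    have "x \<in> cyc d" "z \<in> cyc d" using c d cyc_mono[OF d(2) dc] by auto
    then show ?thesis using d subgroup.m_closed[OF cyc_subgroup[OF dc]] by blast
  qed
  moreover have "z \<otimes> y \<noteq> \<one>"
  proof
    assume "z \<otimes> y = \<one>"
    then have "z = inv y" using z y inv_equality by metis
    then show False using ne y by simp
  qed
  ultimately obtain c where c: "c \<in> ?D" "?D = cyc c" using cyclic_if_common_element[OF D] by blast
  then show thesis using that[OF centralizerD(1)[OF c(1)]] by blast
qed

lemma cyc_commute:
  assumes "c \<in> carrier G" "x \<in> cyc c" "y \<in> cyc c" shows "x \<otimes> y = y \<otimes> x"
proof -
  obtain i j :: nat where "x = c [^] i" "y = c [^] j" using assms cyc_iff by blast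
  then show ?thesis using assms(1) by (simp add: nat_pow_mult add.commute)
qed

text \<open>The automorphism group of a cyclic group is abelian.\<close>

lemma cyc_normalizer_commutator:
  assumes "y \<in> carrier G" "a \<in> carrier G" "b \<in> carrier G" "prime (ord y)"
    "conjg a y \<in> cyc y" "conjg b y \<in> cyc y"
  shows "(a \<otimes> b \<otimes> inv a \<otimes> inv b) \<otimes> y = y \<otimes> (a \<otimes> b \<otimes> inv a \<otimes> inv b)"
proof -
  let ?k = "a \<otimes> b \<otimes> inv a \<otimes> inv b"
  have kc: "?k \<in> carrier G" using assms by simp
  obtain i j :: nat where i: "conjg a y = y [^] i" and j: "conjg b y = y [^] j" using assms cyc_iff by blast
  let ?u = "conjg (b \<otimes> a) y"
  have u: "?u = y [^] (i * j)"
    using assms(1-3) i j by (simp add: conjg_conjg[symmetric] conjg_nat_pow nat_pow_pow mult.commute)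
  have u': "conjg (a \<otimes> b) y = y [^] (i * j)"
    using assms(1-3) i j by (simp add: conjg_conjg[symmetric] conjg_nat_pow nat_pow_pow)
  have "conjg ?k ?u = conjg (a \<otimes> b) y" using assms(1-3) by (simp add: conjg_conjg group_norm)
  then have fix_u: "?k \<otimes> ?u = ?u \<otimes> ?k" using u u' conjg_eq_self_iff kc assms by auto
  have "?u \<noteq> \<one>" using assms by (auto simp: ord_eq_1)
  moreover have "?u \<in> cyc y" using u assms cyc_iff by blast
  ultimately have "y \<in> cyc ?u" using prime_order_cyc_eq[OF assms(1,4)] cyc_self by metis
  then show ?thesis using commutes_cyc[OF kc _ fix_u] assms by simp
qed

text \<open>Unless the centralizer of \<open>z\<close> has prime power order, it contains a unique subgroup \<open>\<langle>y\<rangle>\<close> of prime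
  order other than \<open>ord z\<close>. Its commutators act trivially on \<open>\<langle>y\<rangle>\<close> and so lie in the cyclic centralizer
  of \<open>z\<close> and \<open>y\<close>.\<close>

lemma centralizer_solvable:
  assumes z: "z \<in> carrier G" "prime (ord z)"
  shows "solvable (G\<lparr>carrier := centralizer {z}\<rparr>)"
proof -
  let ?H = "centralizer {z}"
  have H: "subgroup ?H G" using z by (intro subgroup_centralizer) auto
  show ?thesis
  proof (cases "\<forall>x\<in>?H. prime (ord x) \<longrightarrow> ord x = ord z")
    case True
    then obtain k where "card ?H = ord z ^ k" using prime_power_card[OF H z(2)] by metis
    then show ?thesis using p_subgroup_solvable[OF finite_group_axioms H z(2)] by blast
  next
    case False
    then obtain y where y: "y \<in> ?H" "prime (ord y)" "ord y \<noteq> ord z" by blast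
    have yc: "y \<in> carrier G" "z \<otimes> y = y \<otimes> z" using y by (auto simp: centralizer_def)
    obtain c where c: "c \<in> carrier G" "centralizer {z, y} = cyc c"
      using centralizer_two_primes_cyclic[OF z yc(1) y(2)] y(3) yc(2) by metis
    have conj: "conjg a y \<in> cyc y" if "a \<in> ?H" for a
    proof -
      have ac: "a \<in> carrier G" "a \<otimes> z = z \<otimes> a" using that by (auto simp: centralizer_def)
      have "conjg a y \<in> ?H" using subgroup_conjg_closed[OF H that y(1)] .
      then have "cyc (conjg a y) = cyc y"
        using prime_order_centralizer_unique[OF z(1) refl z(2), of "conjg a y" y] y yc ac
        by (auto simp: centralizer_def)
      then show ?thesis using cyc_self by blast
    qed
    show ?thesis
    proof (rule solvable_of_commutators[OF _ H])
      show "subgroup (cyc c) G" using c cyc_subgroup by blast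
      show "solvable (G\<lparr>carrier := cyc c\<rparr>)"
        using c by (intro solvable_of_abelian cyc_subgroup cyc_commute)
      fix a b assume ab: "a \<in> ?H" "b \<in> ?H"
      then have abc: "a \<in> carrier G" "b \<in> carrier G" by (auto simp: centralizer_def)
      have "a \<otimes> b \<otimes> inv a \<otimes> inv b \<in> ?H" by (intro subgroup.m_closed[OF H] subgroup.m_inv_closed[OF H] ab)
      moreover have "(a \<otimes> b \<otimes> inv a \<otimes> inv b) \<otimes> y = y \<otimes> (a \<otimes> b \<otimes> inv a \<otimes> inv b)"
        using cyc_normalizer_commutator[OF yc(1) abc y(2)] conj ab by blast
      ultimately have "a \<otimes> b \<otimes> inv a \<otimes> inv b \<in> centralizer {z, y}" by (auto simp: centralizer_def)
      then show "a \<otimes> b \<otimes> inv a \<otimes> inv b \<in> cyc c" using c by simp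
    qed
  qed
qed

end

section \<open>Permutations of prime order and the transfer homomorphism\<close>

lemma funpow_fixed: "(\<sigma> ^^ n) x = x \<Longrightarrow> (\<sigma> ^^ (n * m)) x = x"
proof (induction m)
  case (Suc m)
  then show ?case by (simp add: funpow_add)
qed simp

text \<open>A coincidence in the orbit would give a point fixed by \<open>\<sigma> ^^ d\<close> with \<open>d\<close> prime to \<open>q\<close>, hence by
  \<open>\<sigma>\<close>.\<close>

lemma prime_cycle_inj:
  assumes q: "prime (q::nat)" and X: "\<And>x. x \<in> X \<Longrightarrow> \<sigma> x \<in> X" "\<And>x. x \<in> X \<Longrightarrow> (\<sigma> ^^ q) x = x"
    "\<And>x. x \<in> X \<Longrightarrow> \<sigma> x \<noteq> x" and x: "x \<in> X"
  shows "inj_on (\<lambda>i. (\<sigma> ^^ i) x) {..<q}"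
proof -
  have pow: "(\<sigma> ^^ i) x \<in> X" for i using x X(1) by (induction i) auto
  have False if ij: "i < j" "j < q" "(\<sigma> ^^ i) x = (\<sigma> ^^ j) x" for i j
  proof -
    let ?y = "(\<sigma> ^^ i) x" and ?d = "j - i"
    have "(\<sigma> ^^ j) x = (\<sigma> ^^ (?d + i)) x" using ij by simp
    then have d: "(\<sigma> ^^ ?d) ?y = ?y" using ij(3) by (simp only: funpow_add comp_apply)
    have "\<not> q dvd ?d" using ij by (simp add: nat_dvd_not_less)
    then have "coprime ?d q" using q prime_imp_coprime coprime_commute by metis
    then obtain a b where ab: "?d * a = q * b + 1"
      using bezout_nat[of ?d q] ij by (auto simp: coprime_iff_gcd_eq_1)
    have "(\<sigma> ^^ (?d * a)) ?y = ?y" by (rule funpow_fixed[OF d])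
    moreover have "(\<sigma> ^^ (q * b + 1)) ?y = \<sigma> ?y"
      using funpow_fixed[OF X(2)[OF pow[of i]], of b] by simp
    ultimately have "\<sigma> ?y = ?y" using ab by simp
    then show False using X(3)[OF pow[of i]] by simp
  qed
  then show ?thesis unfolding inj_on_def by (metis lessThan_iff linorder_neqE_nat)
qed

text \<open>Both conclusions follow by removing one cycle at a time.\<close>

lemma (in comm_monoid) free_prime_cycles:
  assumes "finite X" and q: "prime (q::nat)"
    and "\<And>x. x \<in> X \<Longrightarrow> \<sigma> x \<in> X" "\<And>x. x \<in> X \<Longrightarrow> (\<sigma> ^^ q) x = x" "\<And>x. x \<in> X \<Longrightarrow> \<sigma> x \<noteq> x"
    and "f \<in> X \<rightarrow> carrier G" "\<And>x. x \<in> X \<Longrightarrow> finprod G (\<lambda>i. f ((\<sigma> ^^ i) x)) {..<q} = \<one>"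
  shows "q dvd card X \<and> finprod G f X = \<one>"
  using assms
proof (induction X rule: finite_psubset_induct)
  case (psubset X)
  show ?case
  proof (cases "X = {}")
    case False
    then obtain x where x: "x \<in> X" by blast
    let ?B = "(\<lambda>i. (\<sigma> ^^ i) x) ` {..<q}"
    have pow: "(\<sigma> ^^ i) x \<in> X" for i using x psubset.prems(2) by (induction i) auto
    have inj: "inj_on (\<lambda>i. (\<sigma> ^^ i) x) {..<q}"
      by (rule prime_cycle_inj[OF q _ _ _ x]) (use psubset.prems in auto)
    have B: "?B \<subseteq> X" "finite ?B" "card ?B = q" using pow inj by (auto simp: card_image)
    have q0: "q > 0" using q prime_gt_0_nat by blast
    have xB: "x \<in> ?B" using q0 by (force intro!: image_eqI[of _ _ 0])
    have preimage: "y \<in> ?B" if y: "y \<in> X" "\<sigma> y \<in> ?B" for y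
    proof -
      obtain i where i: "\<sigma> y = (\<sigma> ^^ i) x" "i < q" using y(2) by auto
      have "y = (\<sigma> ^^ (q - 1)) (\<sigma> y)"
        using psubset.prems(3)[OF y(1)] q0 by (metis Suc_diff_1 comp_apply funpow_Suc_right)
      also have "\<dots> = (\<sigma> ^^ (q - 1 + i)) x" using i(1) by (simp only: funpow_add comp_apply)
      also have "\<dots> = (\<sigma> ^^ ((q - 1 + i) mod q)) x"
      proof -
        have "(\<sigma> ^^ ((q - 1 + i) mod q + q * ((q - 1 + i) div q))) x = (\<sigma> ^^ ((q - 1 + i) mod q)) x"
          using funpow_fixed[OF psubset.prems(3)[OF x]] by (simp only: funpow_add comp_apply)
        then show ?thesis by simp
      qed
      finally show ?thesis using q0 by (metis imageI lessThan_iff mod_less_divisor)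
    qed
    have "X - ?B \<subset> X" using xB x by blast
    then have IH: "q dvd card (X - ?B) \<and> finprod G f (X - ?B) = \<one>"
      by (rule psubset.IH) (use psubset.prems preimage in auto)
    have XU: "X = ?B \<union> (X - ?B)" using B by blast
    have "card X = card ?B + card (X - ?B)"
      using B psubset.hyps by (subst XU, intro card_Un_disjoint) auto
    moreover have "finprod G f X = finprod G f ?B \<otimes> finprod G f (X - ?B)"
      using B psubset.hyps psubset.prems(5) by (subst XU, intro finprod_Un_disjoint) auto
    moreover have "finprod G f ?B = finprod G (\<lambda>i. f ((\<sigma> ^^ i) x)) {..<q}"
      using pow psubset.prems(5) inj by (intro finprod_reindex) auto
    ultimately show ?thesis using IH B psubset.prems(6)[OF x] by simp
  qed simp
qed

lemma comm_monoid_nat: "comm_monoid \<lparr>carrier = UNIV :: nat set, monoid.mult = (*), one = 1\<rparr>"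
  by (rule comm_monoidI) auto

lemma card_fixed_points_prime_cycle:
  assumes "finite X" and q: "prime (q::nat)"
    and "\<And>x. x \<in> X \<Longrightarrow> \<sigma> x \<in> X" "\<And>x. x \<in> X \<Longrightarrow> (\<sigma> ^^ q) x = x"
  shows "card X mod q = card {x \<in> X. \<sigma> x = x} mod q"
proof -
  let ?F = "{x \<in> X. \<sigma> x = x}"
  \<comment> \<open>any commutative monoid serves to count the points moved by \<open>\<sigma>\<close>\<close>
  interpret N: comm_monoid "\<lparr>carrier = UNIV :: nat set, monoid.mult = (*), one = 1\<rparr>" by (rule comm_monoid_nat)
  have move: "\<sigma> x \<in> X - ?F" if x: "x \<in> X - ?F" for x
  proof -
    have "\<sigma> x = x" if "\<sigma> (\<sigma> x) = \<sigma> x"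
    proof -
      have "(\<sigma> ^^ i) (\<sigma> x) = \<sigma> x" for i using that by (induction i) auto
      then have "(\<sigma> ^^ (q - 1)) (\<sigma> x) = \<sigma> x" by blast
      moreover have "(\<sigma> ^^ (q - 1)) (\<sigma> x) = (\<sigma> ^^ q) x"
        using prime_gt_0_nat[OF q] by (metis Suc_diff_1 comp_apply funpow_Suc_right)
      ultimately show ?thesis using assms(4) x by auto
    qed
    then show ?thesis using x assms(3) by auto
  qed
  have "q dvd card (X - ?F)"
    by (rule conjunct1[OF N.free_prime_cycles[of _ q \<sigma> "\<lambda>_. 1"]])
      (use assms move N.finprod_one_eqI[of "{..<q}" "\<lambda>_. 1"] in auto)
  then obtain m where "card (X - ?F) = q * m" by blast
  moreover have "card X = card ?F + card (X - ?F)"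
    using assms(1) by (subst card_Un_disjoint[symmetric]) (auto intro: arg_cong[where f = card])
  ultimately show ?thesis by simp
qed

locale abelian_transfer = finite_group +
  fixes Q
  assumes Q: "subgroup Q G" and Q_comm: "\<And>x y. \<lbrakk>x \<in> Q; y \<in> Q\<rbrakk> \<Longrightarrow> x \<otimes> y = y \<otimes> x"
begin

lemma Q_carrier: "x \<in> Q \<Longrightarrow> x \<in> carrier G" by (rule subgroup.mem_carrier[OF Q])

lemma comm_group_Q: "comm_group (G\<lparr>carrier := Q\<rparr>)"
  using group.group_comm_groupI[OF subgroup_imp_group[OF Q]] Q_comm by simp

sublocale QG: comm_group "G\<lparr>carrier := Q\<rparr>" by (rule comm_group_Q)

text \<open>\<open>T\<close> is a transversal of the left cosets of \<open>Q\<close>, and \<open>factor g t\<close> is the element of \<open>Q\<close> by which \<open>gt\<close>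
  differs from the representative of its coset; the transfer \<open>tr\<close> is the product of these elements.\<close>

definition rep :: "'a \<Rightarrow> 'a" where "rep x = (SOME r. r \<in> x <# Q)"
definition T where "T = rep ` carrier G"
definition factor where "factor g t = inv (rep (g \<otimes> t)) \<otimes> (g \<otimes> t)"
definition tr where "tr g = finprod (G\<lparr>carrier := Q\<rparr>) (factor g) T"

lemma rep_in: "x \<in> carrier G \<Longrightarrow> rep x \<in> x <# Q"
  unfolding rep_def using lcos_self[OF _ Q] by (rule someI)

lemma rep_closed: "x \<in> carrier G \<Longrightarrow> rep x \<in> carrier G"
  using rep_in[of x] l_coset_subset_G[OF subgroup.subset[OF Q], of x] by blast

lemma rep_obtain:
  assumes "x \<in> carrier G" obtains a where "a \<in> Q" "rep x = x \<otimes> a"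
  using rep_in[OF assms] by (auto simp: l_coset_def)

lemma rep_mult: "\<lbrakk>x \<in> carrier G; a \<in> Q\<rbrakk> \<Longrightarrow> rep (x \<otimes> a) = rep x"
proof -
  assume x: "x \<in> carrier G" and a: "a \<in> Q"
  have "x \<otimes> a \<in> x <# Q" using a by (auto simp: l_coset_def)
  then have "x <# Q = (x \<otimes> a) <# Q" using l_repr_independence[OF _ x Q] by blast
  then show ?thesis by (simp add: rep_def)
qed

lemma T_closed: "t \<in> T \<Longrightarrow> t \<in> carrier G" using rep_closed by (auto simp: T_def)

lemma rep_rep: "x \<in> carrier G \<Longrightarrow> rep (rep x) = rep x"
  using rep_obtain[of x] rep_mult[of x] by metis

lemma rep_T: "t \<in> T \<Longrightarrow> rep t = t" using rep_rep by (auto simp: T_def)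

lemma rep_in_T: "x \<in> carrier G \<Longrightarrow> rep x \<in> T" by (simp add: T_def)

lemma finite_T: "finite T" by (simp add: T_def)

lemma inv_rep_mult: "x \<in> carrier G \<Longrightarrow> inv (rep x) \<otimes> x \<in> Q"
proof -
  assume x: "x \<in> carrier G"
  obtain a where a: "a \<in> Q" "rep x = x \<otimes> a" using rep_obtain[OF x] .
  then have "inv (rep x) \<otimes> x = inv a" using x Q_carrier by (simp add: group_norm)
  then show ?thesis using a subgroup.m_inv_closed[OF Q] by simp
qed

lemma rep_mult_rep: "\<lbrakk>g \<in> carrier G; x \<in> carrier G\<rbrakk> \<Longrightarrow> rep (g \<otimes> rep x) = rep (g \<otimes> x)"
  using rep_obtain[of x] rep_mult[of "g \<otimes> x"] by (metis m_assoc m_closed Q_carrier)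

lemma factor_in_Q: "\<lbrakk>g \<in> carrier G; t \<in> T\<rbrakk> \<Longrightarrow> factor g t \<in> Q"
  unfolding factor_def using inv_rep_mult T_closed by simp

lemma tr_in_Q: "g \<in> carrier G \<Longrightarrow> tr g \<in> Q"
  unfolding tr_def using QG.finprod_closed[of "factor g" T] factor_in_Q by auto

lemma perm_T: "h \<in> carrier G \<Longrightarrow> inj_on (\<lambda>t. rep (h \<otimes> t)) T \<and> (\<lambda>t. rep (h \<otimes> t)) ` T = T"
proof -
  assume h: "h \<in> carrier G"
  have inj: "inj_on (\<lambda>t. rep (h \<otimes> t)) T"
  proof (rule inj_onI)
    fix s t assume st: "s \<in> T" "t \<in> T" "rep (h \<otimes> s) = rep (h \<otimes> t)"
    have "rep (inv h \<otimes> (h \<otimes> s)) = rep (inv h \<otimes> (h \<otimes> t))"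
      using rep_mult_rep[of "inv h" "h \<otimes> s"] rep_mult_rep[of "inv h" "h \<otimes> t"] st h T_closed by simp
    then show "s = t" using st h T_closed rep_T by simp
  qed
  moreover have "(\<lambda>t. rep (h \<otimes> t)) ` T \<subseteq> T" using h T_closed rep_in_T by auto
  ultimately show ?thesis using endo_inj_surj[OF finite_T] by blast
qed

lemma tr_mult:
  assumes g: "g \<in> carrier G" and h: "h \<in> carrier G" shows "tr (g \<otimes> h) = tr g \<otimes> tr h"
proof -
  let ?\<sigma> = "\<lambda>t. rep (h \<otimes> t)"
  have "factor (g \<otimes> h) t = factor g (?\<sigma> t) \<otimes> factor h t" if t: "t \<in> T" for t
    using g h T_closed[OF t] rep_closed[of "h \<otimes> t"] rep_closed[of "g \<otimes> (h \<otimes> t)"]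
    by (simp add: factor_def rep_mult_rep m_assoc)
  moreover have "?\<sigma> t \<in> T" if "t \<in> T" for t using that h T_closed rep_in_T by simp
  ultimately have "tr (g \<otimes> h) = finprod (G\<lparr>carrier := Q\<rparr>) (\<lambda>t. factor g (?\<sigma> t) \<otimes> factor h t) T"
    unfolding tr_def using factor_in_Q g h perm_T[OF h]
    by (intro QG.finprod_cong') (auto intro!: subgroup.m_closed[OF Q])
  also have "\<dots> = finprod (G\<lparr>carrier := Q\<rparr>) (\<lambda>t. factor g (?\<sigma> t)) T \<otimes> tr h"
    unfolding tr_def using QG.finprod_multf[of "\<lambda>t. factor g (?\<sigma> t)" T "factor h"] factor_in_Q g h perm_T[OF h]
    by auto
  also have "finprod (G\<lparr>carrier := Q\<rparr>) (\<lambda>t. factor g (?\<sigma> t)) T = tr g"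
    unfolding tr_def using QG.finprod_reindex[of "factor g" ?\<sigma> T] factor_in_Q g perm_T[OF h] by auto
  finally show ?thesis .
qed

lemma group_hom_tr: "group_hom G (G\<lparr>carrier := Q\<rparr>) tr"
  by unfold_locales (auto simp: hom_def tr_in_Q tr_mult)

lemma card_T: "card T * card Q = order G"
proof -
  have "bij_betw (\<lambda>t. t <# Q) T (lcosets Q)"
  proof (rule bij_betwI')
    fix s t assume "s \<in> T" "t \<in> T"
    then show "s <# Q = t <# Q \<longleftrightarrow> s = t" using rep_T by (metis rep_def)
  next
    fix C assume "C \<in> lcosets Q"
    then obtain x where x: "x \<in> carrier G" "C = x <# Q" by (auto simp: LCOSETS_def)
    then have "C = rep x <# Q" using l_repr_independence[OF rep_in x(1) Q] by simp
    then show "\<exists>t\<in>T. C = t <# Q" using rep_in_T x by blast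
  qed (auto simp: LCOSETS_def T_closed)
  then show ?thesis using l_lagrange[OF fin Q] bij_betw_same_card by metis
qed

text \<open>The coset \<open>tQ\<close> is fixed by \<open>y\<close> iff \<open>y\<close> is conjugate into \<open>Q\<close> by \<open>t\<close>, and then it contributes
  \<open>y\<close> to the transfer; the cosets in a cycle of length \<open>q\<close> contribute a conjugate of
  \<open>y ^ q = 1\<close>.\<close>

lemma tr_fused:
  assumes y: "y \<in> Q" "ord y = q" "prime q"
    and fus: "\<And>g. \<lbrakk>g \<in> carrier G; conjg g y \<in> Q\<rbrakk> \<Longrightarrow> conjg g y = y"
    and idx: "\<not> q dvd order G div card Q"
  shows "tr y \<noteq> \<one>"
proof -
  have yc: "y \<in> carrier G" using y Q_carrier by blast
  let ?\<sigma> = "\<lambda>t. rep (y \<otimes> t)"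
  let ?F = "{t \<in> T. ?\<sigma> t = t}"
  have \<sigma>T: "?\<sigma> t \<in> T" if "t \<in> T" for t using that yc T_closed rep_in_T by simp
  have pow: "(?\<sigma> ^^ i) t = rep (y [^] i \<otimes> t)" if t: "t \<in> T" for i t
  proof (induction i)
    case (Suc i)
    then show ?case
      using yc T_closed[OF t] by (simp add: rep_mult_rep m_assoc[symmetric] nat_pow_Suc2[symmetric] del: nat_pow_Suc)
  qed (use t T_closed rep_T in simp)
  have \<sigma>q: "(?\<sigma> ^^ q) t = t" if "t \<in> T" for t
    using pow[OF that, of q] y yc pow_ord_eq_1[OF yc] that T_closed rep_T by simp
  have cycle: "finprod (G\<lparr>carrier := Q\<rparr>) (\<lambda>i. factor y ((?\<sigma> ^^ i) t)) {..<n}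
      = inv ((?\<sigma> ^^ n) t) \<otimes> (y [^] n \<otimes> t)" if t: "t \<in> T" for t n
  proof (induction n)
    case 0
    then show ?case using t T_closed by simp
  next
    case (Suc n)
    let ?r = "(?\<sigma> ^^ n) t"
    have r: "(?\<sigma> ^^ i) t \<in> T" for i using t \<sigma>T by (induction i) auto
    have rc: "?r \<in> carrier G" "rep (y \<otimes> ?r) \<in> carrier G" using r T_closed yc rep_closed by auto
    have "finprod (G\<lparr>carrier := Q\<rparr>) (\<lambda>i. factor y ((?\<sigma> ^^ i) t)) {..<Suc n}
        = factor y ?r \<otimes> finprod (G\<lparr>carrier := Q\<rparr>) (\<lambda>i. factor y ((?\<sigma> ^^ i) t)) {..<n}"
      using r factor_in_Q[OF yc] by (simp add: lessThan_Suc QG.finprod_insert)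
    also have "\<dots> = inv (rep (y \<otimes> ?r)) \<otimes> (y \<otimes> ?r) \<otimes> (inv ?r \<otimes> (y [^] n \<otimes> t))"
      unfolding Suc by (simp add: factor_def)
    also have "\<dots> = inv (rep (y \<otimes> ?r)) \<otimes> (y [^] Suc n \<otimes> t)"
      using rc yc T_closed[OF t] nat_pow_Suc2[OF yc, of n] by (simp add: m_assoc del: nat_pow_Suc)
    finally show ?case by simp
  qed
  have moved: "q dvd card (T - ?F) \<and> finprod (G\<lparr>carrier := Q\<rparr>) (factor y) (T - ?F) = \<one>\<^bsub>G\<lparr>carrier := Q\<rparr>\<^esub>"
  proof (rule QG.free_prime_cycles[where \<sigma> = ?\<sigma>])
    show "finite (T - ?F)" using finite_T by simp
    show "?\<sigma> t \<in> T - ?F" if t: "t \<in> T - ?F" for t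
    proof -
      have "t = ?\<sigma> t" if "?\<sigma> (?\<sigma> t) = ?\<sigma> t"
        using inj_onD[OF conjunct1[OF perm_T[OF yc]], of "?\<sigma> t" t] that t \<sigma>T by auto
      then show ?thesis using t \<sigma>T by auto
    qed
    show "finprod (G\<lparr>carrier := Q\<rparr>) (\<lambda>i. factor y ((?\<sigma> ^^ i) t)) {..<q} = \<one>\<^bsub>G\<lparr>carrier := Q\<rparr>\<^esub>"
      if t: "t \<in> T - ?F" for t
      using cycle[of t q] \<sigma>q[of t] t y yc pow_ord_eq_1[OF yc] T_closed[of t] by simp
  qed (use y \<sigma>q factor_in_Q[OF yc] in auto)
  have fixed: "factor y t = y" if "t \<in> ?F" for t
  proof -
    have tc: "t \<in> carrier G" using that T_closed by auto
    have "factor y t = conjg (inv t) y" using that tc yc by (simp add: factor_def conjg_def m_assoc)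
    then show ?thesis using fus[of "inv t"] factor_in_Q[OF yc, of t] that tc by auto
  qed
  have "T = ?F \<union> (T - ?F)" by blast
  then have "tr y = finprod (G\<lparr>carrier := Q\<rparr>) (factor y) (?F \<union> (T - ?F))"
    unfolding tr_def by simp
  also have "\<dots> = finprod (G\<lparr>carrier := Q\<rparr>) (factor y) ?F
      \<otimes>\<^bsub>G\<lparr>carrier := Q\<rparr>\<^esub> finprod (G\<lparr>carrier := Q\<rparr>) (factor y) (T - ?F)"
    using finite_T factor_in_Q[OF yc] by (intro QG.finprod_Un_disjoint) auto
  also have "\<dots> = finprod (G\<lparr>carrier := Q\<rparr>) (factor y) ?F"
    using moved QG.finprod_closed[of "factor y" ?F] factor_in_Q[OF yc] Q_carrier by auto
  also have "\<dots> = finprod (G\<lparr>carrier := Q\<rparr>) (\<lambda>_. y) ?F"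
    using fixed y by (intro QG.finprod_cong') auto
  also have "\<dots> = y [^] card ?F"
    using QG.finprod_const[of y ?F] y nat_pow_consistent[of y _ Q] by simp
  finally have "tr y = y [^] card ?F" .
  moreover have "\<not> q dvd card ?F"
  proof
    assume "q dvd card ?F"
    moreover have "card T mod q = card ?F mod q"
      using card_fixed_points_prime_cycle[OF finite_T y(3), of ?\<sigma>] \<sigma>T \<sigma>q by blast
    ultimately have "q dvd card T" by (simp add: dvd_eq_mod_eq_0)
    moreover have "card Q > 0"
      using finite_subgroup[OF Q] y(1) by (auto simp: card_gt_0_iff)
    ultimately show False using idx card_T by (metis nonzero_mult_div_cancel_right less_irrefl)
  qed
  ultimately show ?thesis using pow_eq_id[OF yc] y by simp
qed

end

context finite_group
begin

text \<open>A form of Burnside's transfer theorem: \<open>K\<close> is the kernel of the transfer into \<open>Q\<close>.\<close>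

lemma abelian_quotient_by_transfer:
  assumes Q: "subgroup Q G" "\<And>x y. \<lbrakk>x \<in> Q; y \<in> Q\<rbrakk> \<Longrightarrow> x \<otimes> y = y \<otimes> x"
    and y: "y \<in> Q" "prime (ord y)" "\<not> ord y dvd order G div card Q"
    and fus: "\<And>g. \<lbrakk>g \<in> carrier G; conjg g y \<in> Q\<rbrakk> \<Longrightarrow> conjg g y = y"
  obtains K where "K \<lhd> G" "y \<notin> K"
    "\<forall>a\<in>carrier G. \<forall>b\<in>carrier G. a \<otimes> b \<otimes> inv a \<otimes> inv b \<in> K"
    "\<forall>x\<in>carrier G. coprime (ord x) (card Q) \<longrightarrow> x \<in> K"
proof -
  interpret abelian_transfer G Q
    using Q by (intro abelian_transfer.intro abelian_transfer_axioms.intro finite_group_axioms)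
  interpret h: group_hom G "G\<lparr>carrier := Q\<rparr>" tr by (rule group_hom_tr)
  let ?K = "kernel G (G\<lparr>carrier := Q\<rparr>) tr"
  show thesis
  proof (rule that[of ?K])
    show "?K \<lhd> G" by (rule h.normal_kernel)
    show "y \<notin> ?K" using tr_fused[OF y(1) refl y(2) fus y(3)] by (simp add: kernel_def)
    have "a \<otimes> b \<otimes> inv a \<otimes> inv b \<in> ?K" if ab: "a \<in> carrier G" "b \<in> carrier G" for a b
    proof -
      let ?c = "a \<otimes> b \<otimes> inv a \<otimes> inv b"
      have c: "?c \<in> carrier G" "b \<otimes> a \<in> carrier G" using ab by simp_all
      have "?c \<otimes> (b \<otimes> a) = a \<otimes> b" using ab by (simp add: group_norm)
      then have "tr ?c \<otimes> tr (b \<otimes> a) = tr (a \<otimes> b)" using tr_mult[OF c] by simp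
      also have "\<dots> = tr (b \<otimes> a)"
        using tr_mult[of a b] tr_mult[of b a] Q_comm[OF tr_in_Q tr_in_Q] ab by simp
      finally have "tr ?c = \<one>"
        using Q_carrier[OF tr_in_Q[OF c(1)]] Q_carrier[OF tr_in_Q[OF c(2)]] by (simp add: r_cancel_one)
      then show "?c \<in> ?K" using c by (simp add: kernel_def)
    qed
    then show "\<forall>a\<in>carrier G. \<forall>b\<in>carrier G. a \<otimes> b \<otimes> inv a \<otimes> inv b \<in> ?K" by blast
    have "x \<in> ?K" if x: "x \<in> carrier G" "coprime (ord x) (card Q)" for x
    proof -
      have tx: "tr x \<in> carrier G" using tr_in_Q Q_carrier x by blast
      have pw: "tr (x [^] n) = tr x [^] n" for n :: nat
        using h.hom_one by (induction n) (use x in \<open>auto simp: tr_mult\<close>)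
      then have "tr x [^] ord x = \<one>" using pw[of "ord x"] pow_ord_eq_1[OF x(1)] h.hom_one by simp
      then have "ord (tr x) dvd ord x" using pow_eq_id tx by blast
      moreover have "ord (tr x) dvd card Q" using ord_dvd_subgroup[OF Q(1) tr_in_Q[OF x(1)]] .
      ultimately have "ord (tr x) = 1" using x(2) by (metis coprime_common_divisor_nat)
      then show "x \<in> ?K" using x tx ord_eq_1 by (simp add: kernel_def)
    qed
    then show "\<forall>x\<in>carrier G. coprime (ord x) (card Q) \<longrightarrow> x \<in> ?K" by blast
  qed
qed

end

section \<open>Norms\<close>

lemma (in finite_group) normalizing_pow_coset:
  assumes y: "y \<in> carrier G" and u: "u \<in> carrier G" "conjg u y \<in> cyc y"
  shows "\<exists>e. (y [^] (k::nat) \<otimes> u) [^] (j::nat) = y [^] (e::nat) \<otimes> u [^] j"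
proof -
  have uy: "\<exists>e. conjg (u [^] j) (y [^] k) = y [^] (e::nat)" for j k :: nat
  proof (induction j)
    case 0
    have "conjg (u [^] (0::nat)) (y [^] k) = y [^] k" using y by simp
    then show ?case by blast
  next
    case (Suc j)
    then obtain e :: nat where e: "conjg (u [^] j) (y [^] k) = y [^] e" by blast
    obtain r :: nat where r: "conjg u y = y [^] r" using u(2) y cyc_iff by blast
    have "conjg (u [^] Suc j) (y [^] k) = conjg u (y [^] e)"
      using y u e nat_pow_Suc2[OF u(1), of j] by (simp add: conjg_conjg[symmetric] del: nat_pow_Suc)
    also have "\<dots> = y [^] (r * e)" using y u r by (simp add: conjg_nat_pow nat_pow_pow)
    finally show ?case by blast
  qed
  have coset: "\<exists>e. (y [^] k \<otimes> u) [^] j = y [^] (e::nat) \<otimes> u [^] j" for k j :: nat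
  proof (induction j)
    case 0
    have "(y [^] k \<otimes> u) [^] (0::nat) = y [^] (0::nat) \<otimes> u [^] (0::nat)" by simp
    then show ?case by blast
  next
    case (Suc j)
    then obtain e :: nat where e: "(y [^] k \<otimes> u) [^] j = y [^] e \<otimes> u [^] j" by blast
    obtain f :: nat where f: "conjg (u [^] j) (y [^] k) = y [^] f" using uy by blast
    have "(y [^] k \<otimes> u) [^] Suc j = y [^] e \<otimes> (u [^] j \<otimes> y [^] k) \<otimes> u"
      using y u e by (simp add: m_assoc)
    also have "u [^] j \<otimes> y [^] k = y [^] f \<otimes> u [^] j"
      using y u f conjg_mult_eq[of "u [^] j" "y [^] k"] by simp
    finally have "(y [^] k \<otimes> u) [^] Suc j = y [^] (e + f) \<otimes> u [^] Suc j"
      using y u by (simp add: m_assoc nat_pow_mult[symmetric])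
    then show ?case by blast
  qed
  then show ?thesis by blast
qed

locale abelian_normal = finite_group +
  fixes V
  assumes V: "V \<lhd> G" and V_comm: "\<And>x y. \<lbrakk>x \<in> V; y \<in> V\<rbrakk> \<Longrightarrow> x \<otimes> y = y \<otimes> x"
begin

lemma V_subgroup: "subgroup V G" by (rule normal_imp_subgroup[OF V])
lemma V_carrier: "x \<in> V \<Longrightarrow> x \<in> carrier G" by (rule subgroup.mem_carrier[OF V_subgroup])
lemma V_conjg: "\<lbrakk>g \<in> carrier G; x \<in> V\<rbrakk> \<Longrightarrow> conjg g x \<in> V" by (rule subgroup_normal_conjg[OF V])

sublocale VG: comm_group "G\<lparr>carrier := V\<rparr>"
  using group.group_comm_groupI[OF subgroup_imp_group[OF V_subgroup]] V_comm by simp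

text \<open>If \<open>h\<^sup>n = 1\<close>, this is the norm map of the cyclic group \<open>\<langle>h\<rangle>\<close> acting on \<open>V\<close>, or a power of it.\<close>

definition norm :: "'a \<Rightarrow> nat \<Rightarrow> 'a \<Rightarrow> 'a" where
  "norm h n v = finprod (G\<lparr>carrier := V\<rparr>) (\<lambda>j. conjg (h [^] j) v) {..<n}"

lemma norm_closed: "\<lbrakk>h \<in> carrier G; v \<in> V\<rbrakk> \<Longrightarrow> norm h n v \<in> V"
  unfolding norm_def using VG.finprod_closed[of "\<lambda>j. conjg (h [^] j) v" "{..<n}"] V_conjg by auto

lemma norm_0: "norm h 0 v = \<one>" by (simp add: norm_def)

lemma norm_Suc: "\<lbrakk>h \<in> carrier G; v \<in> V\<rbrakk> \<Longrightarrow> norm h (Suc n) v = norm h n v \<otimes> conjg (h [^] n) v"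
proof -
  assume h: "h \<in> carrier G" and v: "v \<in> V"
  have "norm h (Suc n) v = conjg (h [^] n) v \<otimes> norm h n v"
    unfolding norm_def using h v V_conjg by (simp add: lessThan_Suc VG.finprod_insert)
  then show ?thesis using V_comm[OF norm_closed[OF h v] V_conjg, of "h [^] n" v] h v by simp
qed

lemma norm_mult: "\<lbrakk>h \<in> carrier G; v \<in> V; w \<in> V\<rbrakk> \<Longrightarrow> norm h n (v \<otimes> w) = norm h n v \<otimes> norm h n w"
proof (induction n)
  case (Suc n)
  note cl = norm_closed[OF Suc.prems(1,2), of n] norm_closed[OF Suc.prems(1,3), of n]
    V_conjg[of "h [^] n" v] V_conjg[of "h [^] n" w]
  have "v \<otimes> w \<in> V" using Suc.prems subgroup.m_closed[OF V_subgroup] by blast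
  then have "norm h (Suc n) (v \<otimes> w) = norm h n v \<otimes> (norm h n w \<otimes> conjg (h [^] n) v) \<otimes> conjg (h [^] n) w"
    using Suc cl V_carrier by (simp add: norm_Suc conjg_mult m_assoc)
  also have "norm h n w \<otimes> conjg (h [^] n) v = conjg (h [^] n) v \<otimes> norm h n w"
    using V_comm cl Suc.prems by simp
  finally show ?case using Suc.prems cl V_carrier by (simp add: norm_Suc m_assoc)
qed (simp add: norm_0)

text \<open>Norms are the source of roots: if \<open>h\<^sup>n = 1\<close>, then \<open>vh\<close> is a root of the norm of \<open>v\<close>.\<close>

lemma mult_pow_eq_norm:
  "\<lbrakk>h \<in> carrier G; v \<in> V\<rbrakk> \<Longrightarrow> (v \<otimes> h) [^] n = norm h n v \<otimes> h [^] n"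
proof (induction n)
  case (Suc n)
  note cl = V_carrier[OF norm_closed[OF Suc.prems, of n]] V_carrier[OF Suc.prems(2)]
  have "(v \<otimes> h) [^] Suc n = norm h n v \<otimes> (h [^] n \<otimes> v) \<otimes> h"
    using Suc cl by (simp add: m_assoc)
  also have "h [^] n \<otimes> v = conjg (h [^] n) v \<otimes> h [^] n" using cl Suc.prems by (simp add: conjg_mult_eq)
  finally show ?case using Suc.prems cl V_carrier V_conjg by (simp add: norm_Suc m_assoc)
qed (simp add: norm_0)

lemma norm_fixed:
  assumes "h \<in> carrier G" "v \<in> V" "h [^] n = \<one>" shows "h \<otimes> norm h n v = norm h n v \<otimes> h"
proof -
  let ?N = "norm h n v"
  have c: "v \<in> carrier G" "?N \<in> carrier G" "?N \<in> V" using assms V_carrier norm_closed by auto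
  have "?N = (v \<otimes> h) [^] n" using mult_pow_eq_norm[OF assms(1,2), of n] assms c by simp
  then have "?N \<otimes> (v \<otimes> h) = (v \<otimes> h) \<otimes> ?N" using nat_pow_comm[of "v \<otimes> h" n 1] c assms by simp
  then have "v \<otimes> (?N \<otimes> h) = v \<otimes> (h \<otimes> ?N)"
    using V_comm[OF c(3) assms(2)] c assms by (metis m_assoc)
  then show ?thesis using c assms by simp
qed

lemma norm_conjg:
  assumes "h \<in> carrier G" "v \<in> V" "h [^] n = \<one>" shows "norm h n (conjg h v) = norm h n v"
proof -
  have c: "v \<in> carrier G" "norm h n v \<in> carrier G" "conjg h v \<in> V" "norm h n (conjg h v) \<in> carrier G"
    using assms V_carrier norm_closed V_conjg by auto
  have "norm h n (conjg h v) = (conjg h v \<otimes> h) [^] n"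
    using mult_pow_eq_norm[OF assms(1) c(3), of n] assms c by simp
  also have "conjg h v \<otimes> h = conjg h (v \<otimes> h)" using c assms by (simp add: conjg_def group_norm)
  also have "conjg h (v \<otimes> h) [^] n = conjg h (norm h n v)"
    using mult_pow_eq_norm[OF assms(1,2), of n] assms c by (simp add: conjg_nat_pow[symmetric])
  also have "\<dots> = norm h n v" using norm_fixed[OF assms] c assms by (simp add: conjg_eq_self_iff)
  finally show ?thesis .
qed

lemma norm_centralized: "\<lbrakk>h \<in> carrier G; v \<in> V; h \<otimes> v = v \<otimes> h\<rbrakk> \<Longrightarrow> norm h n v = v [^] n"
proof (induction n)
  case (Suc n)
  have "conjg (h [^] n) v = v"
    using Suc.prems V_carrier group_commutes_pow[of h v n] by (simp add: conjg_eq_self_iff)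
  then show ?case using Suc by (simp add: norm_Suc)
qed (simp add: norm_0)

text \<open>Since \<open>g\<close> enumerates the coset \<open>\<langle>y\<rangle>a\<close>, the product is the norm under \<open>y\<close> of a conjugate of \<open>v\<close>. It
  is fixed by \<open>y\<close>, hence trivial.\<close>

lemma finprod_conjg_coset:
  assumes y: "y \<in> carrier G" "ord y = q" and free: "\<And>v. \<lbrakk>v \<in> V; y \<otimes> v = v \<otimes> y\<rbrakk> \<Longrightarrow> v = \<one>"
    and a: "a \<in> carrier G" and g: "\<And>k. k < q \<Longrightarrow> \<exists>e. g k = y [^] (e::nat) \<otimes> a"
    and inj: "inj_on g {..<q}" and v: "v \<in> V"
  shows "finprod (G\<lparr>carrier := V\<rparr>) (\<lambda>k. conjg (g k) v) {..<q} = \<one>"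
proof -
  have q0: "q > 0" using y ord_pos by blast
  let ?A = "(\<lambda>i. y [^] i \<otimes> a) ` {..<q}"
  have red: "y [^] (e::nat) = y [^] (e mod q)" for e
  proof -
    have "y [^] (q * (e div q)) = \<one>"
      using y pow_ord_eq_1[OF y(1)] by (simp add: nat_pow_pow[symmetric])
    then show ?thesis using nat_pow_mult[OF y(1), of "q * (e div q)" "e mod q"] y(1) by simp
  qed
  have gA: "g ` {..<q} \<subseteq> ?A"
  proof clarify
    fix k assume "k < q"
    then obtain e where "g k = y [^] (e::nat) \<otimes> a" using g by blast
    then have "g k = y [^] (e mod q) \<otimes> a" using red by simp
    then show "g k \<in> ?A" using q0 by auto
  qed
  have cA: "card ?A \<le> q" using card_image_le[of "{..<q}"] by (metis card_lessThan finite_lessThan)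
  have "card (g ` {..<q}) = q" using inj by (simp add: card_image)
  then have eqA: "g ` {..<q} = ?A" using gA cA by (intro card_seteq) auto
  have injA: "inj_on (\<lambda>i. y [^] i \<otimes> a) {..<q}"
    using eqA \<open>card (g ` {..<q}) = q\<close> by (intro eq_card_imp_inj_on) auto
  have gc: "g k \<in> carrier G" if "k < q" for k using g[OF that] y a by auto
  let ?w = "conjg a v"
  have w: "?w \<in> V" using a v V_conjg by blast
  have "finprod (G\<lparr>carrier := V\<rparr>) (\<lambda>k. conjg (g k) v) {..<q} = finprod (G\<lparr>carrier := V\<rparr>) (\<lambda>b. conjg b v) (g ` {..<q})"
    using inj gc v V_conjg by (intro VG.finprod_reindex[symmetric]) auto
  also have "\<dots> = finprod (G\<lparr>carrier := V\<rparr>) (\<lambda>i. conjg (y [^] i \<otimes> a) v) {..<q}"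
    unfolding eqA using injA y a v V_conjg by (intro VG.finprod_reindex) auto
  also have "\<dots> = norm y q ?w"
    unfolding norm_def using y a v V_carrier V_conjg w by (intro VG.finprod_cong') (auto simp: conjg_conjg)
  also have "\<dots> = \<one>"
    using norm_fixed[OF y(1) w, of q] norm_closed[OF y(1) w, of q] free pow_ord_eq_1[OF y(1)] y(2) by simp
  finally show ?thesis .
qed

text \<open>For each \<open>0 < j < n\<close>, the elements \<open>(y\<^sup>k u)\<^sup>j\<close> with \<open>k < q\<close> run through the coset \<open>\<langle>y\<rangle>u\<^sup>j\<close>, so that
  the corresponding factors of the product of the norms of \<open>v\<close> under all \<open>y\<^sup>k u\<close> cancel. The factors
  with \<open>j = 0\<close> remain, so that the product equals \<open>v\<^sup>q \<noteq> 1\<close>.\<close>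

lemma ex_norm_nontrivial:
  assumes y: "y \<in> carrier G" "ord y = q" and free: "\<And>v. \<lbrakk>v \<in> V; y \<otimes> v = v \<otimes> y\<rbrakk> \<Longrightarrow> v = \<one>"
    and u: "u \<in> carrier G" "conjg u y \<in> cyc y" and n: "n > 0"
    and inj: "\<And>j. \<lbrakk>0 < j; j < n\<rbrakk> \<Longrightarrow> inj_on (\<lambda>k. (y [^] k \<otimes> u) [^] j) {..<q}"
    and v: "v \<in> V" "v [^] q \<noteq> \<one>"
  shows "\<exists>k<q. norm (y [^] k \<otimes> u) n v \<noteq> \<one>"
proof -
  have hc: "y [^] k \<otimes> u \<in> carrier G" for k :: nat using y u by simp
  have coset: "\<exists>e. (y [^] k \<otimes> u) [^] j = y [^] (e::nat) \<otimes> u [^] j" for k j :: nat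
    using normalizing_pow_coset[OF y(1) u] .
  have prod: "finprod (G\<lparr>carrier := V\<rparr>) (\<lambda>k. norm (y [^] k \<otimes> u) (Suc m) v) {..<q} = v [^] q" if "Suc m \<le> n" for m
    using that
  proof (induction m)
    case 0
    have "finprod (G\<lparr>carrier := V\<rparr>) (\<lambda>k. norm (y [^] k \<otimes> u) (Suc 0) v) {..<q}
        = finprod (G\<lparr>carrier := V\<rparr>) (\<lambda>_. v) {..<q}"
      using v hc V_carrier by (intro VG.finprod_cong') (auto simp: norm_Suc norm_0)
    also have "\<dots> = v [^] q"
      using VG.finprod_const[of v "{..<q}"] v nat_pow_consistent[of v q V] by simp
    finally show ?case .
  next
    case (Suc m)
    let ?g = "\<lambda>k::nat. (y [^] k \<otimes> u) [^] Suc m"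
    have gc: "?g k \<in> carrier G" for k by (rule nat_pow_closed[OF hc])
    have "finprod (G\<lparr>carrier := V\<rparr>) (\<lambda>k. norm (y [^] k \<otimes> u) (Suc (Suc m)) v) {..<q}
        = finprod (G\<lparr>carrier := V\<rparr>) (\<lambda>k. norm (y [^] k \<otimes> u) (Suc m) v \<otimes> conjg (?g k) v) {..<q}"
      using v hc gc V_carrier V_conjg norm_closed subgroup.m_closed[OF V_subgroup]
      by (intro VG.finprod_cong') (auto simp: norm_Suc[of _ v "Suc m"] simp del: nat_pow_Suc)
    also have "\<dots> = v [^] q \<otimes> finprod (G\<lparr>carrier := V\<rparr>) (\<lambda>k. conjg (?g k) v) {..<q}"
      using VG.finprod_multf[of "\<lambda>k. norm (y [^] k \<otimes> u) (Suc m) v" "{..<q}" "\<lambda>k. conjg (?g k) v"]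
        Suc v hc gc V_conjg norm_closed by (auto simp del: nat_pow_Suc)
    also have "finprod (G\<lparr>carrier := V\<rparr>) (\<lambda>k. conjg (?g k) v) {..<q} = \<one>"
    proof (rule finprod_conjg_coset[OF y free, where a = "u [^] Suc m"])
      show "inj_on ?g {..<q}" using inj[of "Suc m"] Suc.prems by (simp del: nat_pow_Suc)
      show "\<exists>e. ?g k = y [^] (e::nat) \<otimes> u [^] Suc m" for k by (rule coset)
    qed (use u v in auto)
    finally show ?case using v V_carrier by simp
  qed
  show ?thesis
  proof (rule ccontr)
    assume "\<not> ?thesis"
    then have "finprod (G\<lparr>carrier := V\<rparr>) (\<lambda>k. norm (y [^] k \<otimes> u) n v) {..<q} = \<one>\<^bsub>G\<lparr>carrier := V\<rparr>\<^esub>"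
      by (intro VG.finprod_one_eqI) auto
    moreover have "n = Suc (n - 1)" using n by simp
    ultimately show False using prod[of "n - 1"] v(2) n by simp
  qed
qed

end

section \<open>Normal elementary abelian subgroups of rank at least two\<close>

context finite_group
begin

lemma commutes_of_coprime_pows:
  assumes "x \<in> carrier G" "y \<in> carrier G" "coprime a (b::nat)" "a > 0"
    "x [^] a \<otimes> y = y \<otimes> x [^] a" "x [^] b \<otimes> y = y \<otimes> x [^] b"
  shows "x \<otimes> y = y \<otimes> x"
proof -
  have C: "subgroup (centralizer {y}) G" using assms(2) by (intro subgroup_centralizer) simp
  have ab: "x [^] a \<in> centralizer {y}" "x [^] b \<in> centralizer {y}" using assms by (auto simp: centralizer_def)
  obtain m n where mn: "a * m = b * n + 1"
    using bezout_nat[of a b] assms(3,4) by (auto simp: coprime_iff_gcd_eq_1)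
  have "x [^] (b * n) \<otimes> x = x [^] (a * m)" using assms(1) mn by simp
  then have "x = inv ((x [^] b) [^] n) \<otimes> (x [^] a) [^] m"
    using assms(1) by (simp add: nat_pow_pow inv_solve_left)
  also have "\<dots> \<in> centralizer {y}"
    using subgroup_nat_pow_closed[OF C ab(1)] subgroup_nat_pow_closed[OF C ab(2)]
      subgroup.m_closed[OF C] subgroup.m_inv_closed[OF C] by blast
  finally show ?thesis by (simp add: centralizer_def)
qed

lemma funpow_conjg: "\<lbrakk>g \<in> carrier G; x \<in> carrier G\<rbrakk> \<Longrightarrow> (conjg g ^^ n) x = conjg (g [^] n) x"
proof (induction n)
  case (Suc n)
  then show ?case using nat_pow_Suc2[of g n] by (simp add: conjg_conjg del: nat_pow_Suc)
qed simp

lemma prime_order_mod_subgroup: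
  assumes H: "subgroup H G" and g: "g \<in> carrier G" "g \<notin> H"
  obtains r n :: nat where "prime r" "r dvd ord g" "g [^] n \<notin> H" "(g [^] n) [^] r \<in> H"
proof -
  define m where "m = (LEAST m::nat. m > 0 \<and> g [^] m \<in> H)"
  have ex: "ord g > 0 \<and> g [^] ord g \<in> H" using g pow_ord_eq_1[OF g(1)] subgroup.one_closed[OF H] by simp
  have m: "m > 0" "g [^] m \<in> H" using LeastI[of "\<lambda>m. m > 0 \<and> g [^] m \<in> H", OF ex] by (auto simp: m_def)
  have min: "m \<le> n" if "n > 0" "g [^] n \<in> H" for n
    unfolding m_def using that by (intro Least_le) simp
  have "m \<noteq> 1" using m g by auto
  then obtain r where r: "prime r" "r dvd m" using prime_factor_nat by blast
  have "m dvd ord g"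
  proof -
    let ?i = "ord g mod m"
    have "g [^] ?i \<otimes> (g [^] m) [^] (ord g div m) = g [^] ord g"
      using g nat_pow_mult[OF g(1), of ?i "m * (ord g div m)"] by (simp add: nat_pow_pow)
    then have "g [^] ?i \<otimes> (g [^] m) [^] (ord g div m) = \<one>" using g pow_ord_eq_1[OF g(1)] by simp
    then have "inv ((g [^] m) [^] (ord g div m)) = g [^] ?i"
      using g by (intro inv_equality) auto
    moreover have "inv ((g [^] m) [^] (ord g div m)) \<in> H"
      by (rule subgroup.m_inv_closed[OF H subgroup_nat_pow_closed[OF H m(2)]])
    ultimately have "g [^] ?i \<in> H" by simp
    then have "?i = 0" using min[of ?i] mod_less_divisor[OF m(1), of "ord g"] by auto
    then show ?thesis by auto
  qed
  then have "r dvd ord g" using r(2) dvd_trans by blast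
  moreover have "0 < m div r" "m div r < m"
    using r m(1) prime_gt_1_nat[OF r(1)] by (auto simp: div_greater_zero_iff dvd_imp_le)
  then have "g [^] (m div r) \<notin> H" using min[of "m div r"] by auto
  moreover have "(g [^] (m div r)) [^] r \<in> H" using g r m by (simp add: nat_pow_pow)
  ultimately show thesis using that r(1) by blast
qed

text \<open>If some \<open>g\<close> acts nontrivially on a subgroup \<open>\<langle>y\<rangle>\<close> of prime order \<open>q\<close>, then a power of it does
  so with prime order; that order is less than \<open>q\<close>, so it is \<open>p\<close> when \<open>p\<close> is the only prime
  divisor of the group order below \<open>q\<close>. The \<open>p'\<close>-part of that power can be removed.\<close>

lemma p_element_acting_on_prime_cyclic:
  assumes y: "y \<in> carrier G" "ord y = q" "prime q"
    and g: "g \<in> carrier G" "conjg g y \<in> cyc y" "conjg g y \<noteq> y"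
    and least: "\<And>r. \<lbrakk>prime r; r dvd order G; r < q\<rbrakk> \<Longrightarrow> r = p"
  obtains u k where "u \<in> carrier G" "conjg u y \<in> cyc y" "conjg u y \<noteq> y" "u [^] p \<otimes> y = y \<otimes> u [^] p"
    "ord u = p ^ k" "prime p"
proof -
  have pow_in: "conjg (g [^] n) y \<in> cyc y" for n :: nat
  proof (induction n)
    case (Suc n)
    have "conjg g (conjg (g [^] n) y) \<in> cyc (conjg g y)"
      using Suc g y conjg_cyc_iff cyc_closed by blast
    then show ?case
      using g y cyc_mono[OF g(2) y(1)] nat_pow_Suc2[OF g(1), of n] by (auto simp: conjg_conjg simp del: nat_pow_Suc)
  qed (use y in simp)
  have C: "subgroup (centralizer {y}) G" using y by (intro subgroup_centralizer) auto
  have cent: "x \<in> centralizer {y} \<longleftrightarrow> conjg x y = y" if "x \<in> carrier G" for x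
    using that y conjg_eq_self_iff by (auto simp: centralizer_def)
  have "g \<notin> centralizer {y}" using cent g by blast
  then obtain r n :: nat where r: "prime r" "r dvd ord g" "g [^] n \<notin> centralizer {y}"
      "(g [^] n) [^] r \<in> centralizer {y}"
    using prime_order_mod_subgroup[OF C g(1)] by blast
  define g' where "g' = g [^] n"
  have g': "g' \<in> carrier G" "g' \<notin> centralizer {y}" "g' [^] r \<in> centralizer {y}"
    using r g by (auto simp: g'_def)
  have g'_in: "conjg (g' [^] i) y \<in> cyc y" for i :: nat
    using pow_in[of "n * i"] g by (simp add: g'_def nat_pow_pow)
  have coprime: "g' [^] i \<notin> centralizer {y}" if "coprime i r" "i > 0" for i
    using commutes_of_coprime_pows[OF g'(1) y(1) that] g' by (auto simp: centralizer_def)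
  have inj: "inj_on (\<lambda>i. conjg (g' [^] i) y) {..<r}"
  proof (rule linorder_inj_onI')
    fix i j assume ij: "i \<in> {..<r}" "j \<in> {..<r}" "i < j"
    show "conjg (g' [^] i) y \<noteq> conjg (g' [^] j) y"
    proof
      assume eq: "conjg (g' [^] i) y = conjg (g' [^] j) y"
      have "conjg (g' [^] j) y = conjg (g' [^] i) (conjg (g' [^] (j - i)) y)"
        using g' y ij by (simp add: conjg_conjg nat_pow_mult)
      then have "g' [^] (j - i) \<in> centralizer {y}" using eq g' y cent by simp
      moreover have "\<not> r dvd j - i" using ij by (simp add: nat_dvd_not_less)
      then have "coprime (j - i) r" using r(1) prime_imp_coprime coprime_commute by metis
      ultimately show False using coprime[of "j - i"] ij by simp
    qed
  qed
  have "(\<lambda>i. conjg (g' [^] i) y) ` {..<r} \<subseteq> cyc y - {\<one>}"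
    using g'_in g' y by (auto simp: ord_eq_1[symmetric] prime_nat_iff)
  then have "r \<le> card (cyc y - {\<one>})"
    using card_inj_on_le[OF inj] y by simp
  also have "card (cyc y - {\<one>}) < q"
    using y card_cyc[OF y(1)] subgroup.one_closed[OF cyc_subgroup[OF y(1)]] prime_gt_0_nat[OF y(3)]
    by (simp add: card_Diff_singleton)
  finally have rp: "r = p"
    by (intro least[OF r(1) dvd_trans[OF r(2) ord_dvd_group_order[OF g(1)]]])
  obtain s where s: "ord g' = p ^ multiplicity p (ord g') * s" "\<not> p dvd s"
    by (rule multiplicity_decompose'[of "ord g'" p])
      (use ord_pos[OF g'(1)] not_prime_unit[of p] r rp in auto)
  define u where "u = g' [^] s"
  have u: "u \<in> carrier G" using g' by (simp add: u_def)
  have "u [^] (p ^ multiplicity p (ord g')) = \<one>"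
    using g' s pow_ord_eq_1[OF g'(1)] by (simp add: u_def nat_pow_pow mult.commute)
  then have "ord u dvd p ^ multiplicity p (ord g')" using u pow_eq_id by blast
  then obtain k where k: "ord u = p ^ k" using divides_primepow_nat r rp by blast
  have "u [^] p = (g' [^] r) [^] s" using g' rp by (simp add: u_def nat_pow_pow mult.commute)
  then have "u [^] p \<in> centralizer {y}" using subgroup_nat_pow_closed[OF C g'(3)] by simp
  then have up: "u [^] p \<otimes> y = y \<otimes> u [^] p" by (simp add: centralizer_def)
  have "coprime s r" using s(2) r(1) rp prime_imp_coprime coprime_commute by metis
  moreover have "s > 0" using s(2) by (auto intro: Nat.gr0I)
  ultimately have un: "conjg u y \<noteq> y" using coprime[of s] cent[OF u] by (simp add: u_def)
  have "conjg u y \<in> cyc y" using g'_in by (simp add: u_def)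
  then show thesis using that u un up k r rp by blast
qed

end

text \<open>\<open>V\<close> is elementary abelian, and by the last assumption it is not cyclic.\<close>

locale claw_free_with_normal = claw_free_group G + abelian_normal G V for G (structure) and V +
  fixes p :: nat
  assumes p: "prime p" and exponent: "v \<in> V \<Longrightarrow> v [^] p = \<one>" and card_gt: "p < card V"
begin

lemma ord_V: "\<lbrakk>v \<in> V; v \<noteq> \<one>\<rbrakk> \<Longrightarrow> ord v = p"
  using exponent[of v] V_carrier[of v] pow_eq_id[of v p] ord_eq_1[of v] p prime_nat_iff by blast

lemma V_p_group: "\<exists>k. card V = p ^ k"
proof (rule prime_power_card[OF V_subgroup p])
  fix x r assume x: "x \<in> V" "prime r" "ord x = r"
  then have "x \<noteq> \<one>" by auto
  then show "r = p" using ord_V x by blast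
qed

lemma p_dvd_card_V: "p dvd card V"
proof -
  obtain k where "card V = p ^ k" using V_p_group by blast
  moreover have "k \<noteq> 0" using card_gt prime_gt_0_nat[OF p] calculation by (cases k) auto
  ultimately show ?thesis by simp
qed

lemma V_nontrivial: obtains v where "v \<in> V" "v \<noteq> \<one>"
proof -
  have "\<not> V \<subseteq> {\<one>}" using card_gt card_mono[of "{\<one>}" V] prime_gt_0_nat[OF p] by auto
  then show thesis using that by blast
qed

text \<open>If \<open>y\<close> of prime order other than \<open>p\<close> centralizes some \<open>z \<noteq> 1\<close> in \<open>V\<close>, then \<open>\<langle>y\<rangle>\<close> is the unique
  subgroup of its kind in the centralizer of \<open>z\<close>; hence \<open>V\<close> normalizes, and so centralizes it. But
  the centralizer of \<open>y\<close> contains only one subgroup of order \<open>p\<close>.\<close>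

lemma acts_freely:
  assumes z: "z \<in> V" and y: "y \<in> carrier G" "prime (ord y)" "ord y \<noteq> p" and comm: "y \<otimes> z = z \<otimes> y"
  shows "z = \<one>"
proof (rule ccontr)
  assume z1: "z \<noteq> \<one>"
  have zc: "z \<in> carrier G" "ord z = p" using z z1 V_carrier ord_V by auto
  have all: "v \<otimes> y = y \<otimes> v" if v: "v \<in> V" for v
  proof -
    have vc: "v \<in> carrier G" using v V_carrier by blast
    have cv: "conjg v y \<in> carrier G" using vc y by simp
    have "conjg v z = z" using V_comm[OF v z] vc zc conjg_eq_self_iff by blast
    then have "conjg z (conjg v y) = conjg v (conjg z y)"
      using vc zc y V_comm[OF v z] by (simp add: conjg_conjg)
    also have "conjg z y = y" using comm zc y conjg_eq_self_iff by simp
    finally have "z \<otimes> conjg v y = conjg v y \<otimes> z" using zc cv conjg_eq_self_iff by blast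
    then have "cyc (conjg v y) = cyc y"
      using prime_order_centralizer_unique[OF zc p, of "conjg v y" y] y cv vc comm by simp
    then have "conjg v y \<in> cyc y" using cyc_self by blast
    then have "conjg v y \<otimes> inv y \<in> cyc y"
      by (rule subgroup.m_closed[OF cyc_subgroup[OF y(1)] _ cyc_inv[OF y(1)]])
    moreover have "conjg v y \<otimes> inv y \<in> V"
    proof -
      have "conjg v y \<otimes> inv y = v \<otimes> conjg y (inv v)" using vc y by (simp add: conjg_def group_norm)
      then show ?thesis
        using subgroup.m_closed[OF V_subgroup v V_conjg[OF y(1) subgroup.m_inv_closed[OF V_subgroup v]]] by simp
    qed
    ultimately have "conjg v y \<otimes> inv y = \<one>"
      using prime_order_cyc_eq[OF y(1,2), of "conjg v y \<otimes> inv y"] ord_V[of "conjg v y \<otimes> inv y"] y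
        card_cyc[of "conjg v y \<otimes> inv y"] card_cyc[OF y(1)] V_carrier by metis
    then have "inv (inv y) = conjg v y" using cv y by (intro inv_equality) auto
    then have "conjg v y = y" using y(1) by simp
    then show ?thesis using conjg_eq_self_iff[OF vc y(1)] by simp
  qed
  have "v \<in> cyc z" if v: "v \<in> V" for v
  proof (cases "v = \<one>")
    case True
    then show ?thesis using subgroup.one_closed[OF cyc_subgroup[OF zc(1)]] by simp
  next
    case False
    have "cyc v = cyc z"
      using prime_order_centralizer_unique[OF y(1) refl y(2), of v z] all[OF v] all[OF z] V_carrier[OF v] zc
        ord_V[OF v False] p y by simp
    then show ?thesis using cyc_self by blast
  qed
  then have "card V \<le> card (cyc z)" using zc by (intro card_mono) auto
  then show False using card_gt card_cyc zc by simp
qed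

lemma centralizer_p_group:
  assumes "z \<in> V" "z \<noteq> \<one>" shows "\<exists>k. card (centralizer {z}) = p ^ k"
proof (rule prime_power_card[OF subgroup_centralizer p])
  fix x r assume "x \<in> centralizer {z}" "prime r" "ord x = r"
  then show "r = p" using acts_freely[OF assms(1), of x] assms(2) by (auto simp: centralizer_def)
qed (use assms V_carrier in auto)

lemma centralizer_V_p_group: "\<exists>k. card (centralizer V) = p ^ k"
proof (rule prime_power_card[OF subgroup_centralizer p])
  obtain z where z: "z \<in> V" "z \<noteq> \<one>" using V_nontrivial .
  fix x r assume "x \<in> centralizer V" "prime r" "ord x = r"
  then show "r = p" using acts_freely[OF z(1), of x] z by (auto simp: centralizer_def)
qed (use V_carrier in auto)

lemma pow_prime_neq_one: "\<lbrakk>v \<in> V; v \<noteq> \<one>; prime q; q \<noteq> p\<rbrakk> \<Longrightarrow> v [^] q \<noteq> \<one>"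
  using pow_eq_id[OF V_carrier, of v q] ord_V[of v] p primes_dvd_imp_eq[of p q] by auto

lemma norm_prime_order_trivial:
  assumes "h \<in> carrier G" "prime (ord h)" "ord h \<noteq> p" "v \<in> V" shows "norm h (ord h) v = \<one>"
  using acts_freely[OF norm_closed[OF assms(1,4)] assms(1-3) norm_fixed[OF assms(1,4)]]
    pow_ord_eq_1[OF assms(1)] by simp

text \<open>Otherwise \<open>y\<close> and \<open>y'\<close> generate a group of order \<open>q\<^sup>2\<close>, all of whose \<open>q + 1\<close> subgroups of order \<open>q\<close>
  act freely on \<open>V\<close> and so have trivial norms, contrary to \<open>ex_norm_nontrivial\<close>.\<close>

lemma prime_subgroup_unique_if_commuting:
  assumes y: "y \<in> carrier G" "ord y = q" and y': "y' \<in> carrier G" "ord y' = q"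
    and comm: "y \<otimes> y' = y' \<otimes> y" and q: "prime q" "q \<noteq> p"
  shows "y' \<in> cyc y"
proof (rule ccontr)
  assume n: "y' \<notin> cyc y"
  obtain v where v: "v \<in> V" "v \<noteq> \<one>" using V_nontrivial .
  have pw: "(y [^] k \<otimes> y') [^] j = y [^] (k * j) \<otimes> y' [^] j" for k j :: nat
    using pow_mult_distrib[of "y [^] k" y' j] group_commutes_pow[OF comm y(1) y'(1), of k] y y'
    by (simp add: nat_pow_pow)
  have "\<exists>k<q. norm (y [^] k \<otimes> y') q v \<noteq> \<one>"
  proof (rule ex_norm_nontrivial[OF y _ y'(1)])
    show "w = \<one>" if "w \<in> V" "y \<otimes> w = w \<otimes> y" for w
      using acts_freely[OF that(1) y(1) _ _ that(2)] y q by simp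
    have "conjg y' y = y" using comm y y' conjg_eq_self_iff by simp
    then show "conjg y' y \<in> cyc y" using cyc_self[of y] by simp
    show "inj_on (\<lambda>k. (y [^] k \<otimes> y') [^] j) {..<q}" if j: "0 < j" "j < q" for j
    proof (rule linorder_inj_onI')
      fix k l assume kl: "k \<in> {..<q}" "l \<in> {..<q}" "k < l"
      show "(y [^] k \<otimes> y') [^] j \<noteq> (y [^] l \<otimes> y') [^] j"
      proof
        assume "(y [^] k \<otimes> y') [^] j = (y [^] l \<otimes> y') [^] j"
        then have "y [^] (k * j) = y [^] (l * j)" using y y' unfolding pw by simp
        then have "y [^] (l * j - k * j) = \<one>" using y kl pow_eq_div2 by simp
        then have "q dvd (l - k) * j" using y pow_eq_id[OF y(1)] by (simp add: diff_mult_distrib)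
        then show False using q kl j prime_dvd_mult_iff[of q "l - k" j] by (auto dest: dvd_imp_le)
      qed
    qed
    show "v [^] q \<noteq> \<one>" using pow_prime_neq_one v q by blast
  qed (use v q prime_gt_0_nat in auto)
  then obtain k :: nat where k: "norm (y [^] k \<otimes> y') q v \<noteq> \<one>" by blast
  let ?h = "y [^] k \<otimes> y'"
  have h: "?h \<in> carrier G" using y y' by simp
  have "?h [^] q = \<one>"
    unfolding pw using y y' pow_ord_eq_1[OF y(1)] pow_ord_eq_1[OF y'(1)] pow_eq_id[OF y(1), of "k * q"] by simp
  moreover have "?h \<noteq> \<one>"
  proof
    assume "?h = \<one>"
    then have "y' = inv (y [^] k)" using y y' h by (metis inv_equality inv_comm nat_pow_closed)
    moreover have "inv (y [^] k) \<in> cyc y"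
      by (rule subgroup.m_inv_closed[OF cyc_subgroup[OF y(1)]]) (use y cyc_iff in blast)
    ultimately show False using n by simp
  qed
  ultimately have "ord ?h = q" using h q pow_eq_id[OF h] ord_eq_1[OF h] prime_nat_iff by blast
  then show False using norm_prime_order_trivial[OF h _ _ v(1)] q k by simp
qed

text \<open>A Sylow \<open>q\<close>-subgroup has a central element \<open>y\<close> of order \<open>q\<close>, of which every element of order \<open>q\<close> is a
  power. So \<open>y\<close> lies in all its nontrivial cyclic subgroups, and the subgroup is cyclic.\<close>

lemma sylow_cyclic:
  assumes q: "prime q" "q \<noteq> p" "q dvd order G"
  obtains Q y a where "subgroup Q G" "card Q = q ^ a" "\<not> q dvd order G div card Q"
    "\<And>x x'. \<lbrakk>x \<in> Q; x' \<in> Q\<rbrakk> \<Longrightarrow> x \<otimes> x' = x' \<otimes> x" "y \<in> Q" "ord y = q"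
    "\<And>x. \<lbrakk>x \<in> Q; ord x = q\<rbrakk> \<Longrightarrow> x \<in> cyc y"
proof -
  have "order G > 0" using order_gt_0_iff_finite by simp
  then obtain m where m: "order G = q ^ multiplicity q (order G) * m" "\<not> q dvd m"
    by (rule_tac multiplicity_decompose'[of "order G" q]) (use not_prime_unit[of q] q in auto)
  let ?a = "multiplicity q (order G)"
  obtain Q where Q: "subgroup Q G" "card Q = q ^ ?a"
    using sylow_thm[OF q(1) group_axioms m(1) fin] by blast
  have a0: "?a \<noteq> 0" using m q by (metis mult_1 power_0)
  have idx: "\<not> q dvd order G div card Q"
    using m Q(2) prime_gt_0_nat[OF q(1)] by (metis nonzero_mult_div_cancel_left power_not_zero less_irrefl)
  have Qc: "x \<in> carrier G" if "x \<in> Q" for x using subgroup.mem_carrier[OF Q(1) that] .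
  have prim: "\<exists>k::nat. ord (x [^] k) = q" if x: "x \<in> Q" "x \<noteq> \<one>" for x
  proof -
    obtain k :: nat and r where r: "prime r" "r dvd ord x" "ord (x [^] k) = r"
      using ex_prime_pow[OF Qc[OF x(1)] x(2)] by blast
    have "r dvd q ^ ?a" using r ord_dvd_subgroup[OF Q(1) x(1)] Q(2) dvd_trans by metis
    then have "r = q" using r q prime_dvd_power primes_dvd_imp_eq by blast
    then show ?thesis using r by blast
  qed
  obtain x where x: "x \<in> Q" "x \<noteq> \<one>" "\<And>g. g \<in> Q \<Longrightarrow> conjg g x = x"
  proof (rule p_group_fixes_nontrivial[OF Q(1) q(1) Q(2) Q(1)])
    show "q dvd card Q" using Q(2) a0 by simp
  qed (use subgroup_conjg_closed[OF Q(1)] in auto)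
  obtain k :: nat where k: "ord (x [^] k) = q" using prim x by blast
  define y where "y = x [^] k"
  have y: "y \<in> Q" "ord y = q" using k x subgroup_nat_pow_closed[OF Q(1)] by (auto simp: y_def)
  have central: "g \<otimes> y = y \<otimes> g" if g: "g \<in> Q" for g
  proof -
    have "conjg g y = y" using x g Qc by (simp add: y_def conjg_nat_pow)
    then show ?thesis using g y Qc conjg_eq_self_iff by blast
  qed
  have uniq: "x \<in> cyc y" if "x \<in> Q" "ord x = q" for x
    using prime_subgroup_unique_if_commuting[OF Qc[OF y(1)] y(2) Qc[OF that(1)] that(2)] central that q by simp
  have yc: "y \<in> carrier G" "y \<noteq> \<one>" using y Qc q by auto
  obtain c where c: "c \<in> Q" "Q = cyc c"
  proof (rule cyclic_if_common_element[OF Q(1) yc(2)])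
    fix x assume x: "x \<in> Q"
    show "\<exists>c\<in>Q. x \<in> cyc c \<and> y \<in> cyc c"
    proof (cases "x = \<one>")
      case True
      then show ?thesis using y(1) subgroup.one_closed[OF cyc_subgroup[OF yc(1)]] cyc_self by blast
    next
      case False
      obtain k :: nat where k: "ord (x [^] k) = q" using prim x False by blast
      have xk: "x [^] k \<in> Q" using x subgroup_nat_pow_closed[OF Q(1)] by blast
      have "x [^] k \<noteq> \<one>" using k q by auto
      then have "cyc (x [^] k) = cyc y"
        using prime_order_cyc_eq[OF yc(1), of "x [^] k"] y q uniq[OF xk k] by simp
      then have "y \<in> cyc (x [^] k)" using cyc_self by blast
      moreover have "x [^] k \<in> cyc x" using cyc_iff[OF Qc[OF x]] by blast
      ultimately have "y \<in> cyc x" using cyc_mono[OF _ Qc[OF x]] by blast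
      then show ?thesis using x cyc_self by blast
    qed
  qed blast
  have abel: "x \<otimes> x' = x' \<otimes> x" if "x \<in> Q" "x' \<in> Q" for x x'
    using cyc_commute[OF Qc[OF c(1)]] that c(2) by blast
  show thesis by (rule that[OF Q idx abel y uniq])
qed

lemma abelian_quotient_if_no_fusion:
  assumes q: "prime q" "q \<noteq> p" "q dvd order G"
    and NC: "\<And>g y. \<lbrakk>g \<in> carrier G; y \<in> carrier G; ord y = q; conjg g y \<in> cyc y\<rbrakk> \<Longrightarrow> conjg g y = y"
  obtains K where "K \<lhd> G" "V \<subseteq> K" "K \<noteq> carrier G"
    "\<forall>a\<in>carrier G. \<forall>b\<in>carrier G. a \<otimes> b \<otimes> inv a \<otimes> inv b \<in> K"
proof -
  obtain Q y a where Q: "subgroup Q G" "card Q = q ^ a" "\<not> q dvd order G div card Q"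
    and abel: "\<And>x x'. \<lbrakk>x \<in> Q; x' \<in> Q\<rbrakk> \<Longrightarrow> x \<otimes> x' = x' \<otimes> x" and y: "y \<in> Q" "ord y = q"
    and uniq: "\<And>x. \<lbrakk>x \<in> Q; ord x = q\<rbrakk> \<Longrightarrow> x \<in> cyc y"
    using sylow_cyclic[OF q] by metis
  have yc: "y \<in> carrier G" using subgroup.mem_carrier[OF Q(1) y(1)] .
  have oy: "prime (ord y)" "\<not> ord y dvd order G div card Q" using y q Q by simp_all
  have fus: "conjg g y = y" if "g \<in> carrier G" "conjg g y \<in> Q" for g
    using NC[OF that(1) yc y(2)] uniq[OF that(2)] that yc y by simp
  obtain K where K: "K \<lhd> G" "y \<notin> K"
    "\<forall>a\<in>carrier G. \<forall>b\<in>carrier G. a \<otimes> b \<otimes> inv a \<otimes> inv b \<in> K"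
    "\<forall>x\<in>carrier G. coprime (ord x) (card Q) \<longrightarrow> x \<in> K"
    by (rule abelian_quotient_by_transfer[OF Q(1) abel y(1) oy fus])
  have "v \<in> K" if v: "v \<in> V" for v
  proof (rule K(4)[rule_format, OF V_carrier[OF v]])
    have "coprime p q" using p q primes_coprime by blast
    then show "coprime (ord v) (card Q)" using ord_V[OF v] Q(2) by (cases "v = \<one>") auto
  qed
  then show thesis using that[OF K(1) _ _ K(3)] K(2) yc by blast
qed

text \<open>Suppose that the norm of \<open>v\<close> is nontrivial. The elements of the kernel of the norm turn the
  \<open>p\<close>-th root \<open>vh\<close> of it into others; so the kernel has at most \<open>2p\<close> elements, and being
  a \<open>p\<close>-group with \<open>p > 2\<close>, it has at most \<open>p\<close>. It then coincides with the group of fixed points of \<open>h\<close>, and \<open>h\<close> maps \<open>v\<close> to \<open>dv\<close>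
  with \<open>d\<close> fixed by \<open>h\<close>. But then the norm of \<open>v\<close> is \<open>d\<close> to the power \<open>p(p - 1)/2\<close>, which is trivial.\<close>

lemma norm_trivial_if_odd:
  assumes odd: "p > 2" and h: "h \<in> carrier G" "h [^] p = \<one>" and v: "v \<in> V"
  shows "norm h p v = \<one>"
proof (rule ccontr)
  assume s1: "norm h p v \<noteq> \<one>"
  define s where "s = norm h p v"
  have s: "s \<in> V" "s \<noteq> \<one>" "s \<in> carrier G" "ord s = p" using norm_closed[OF h(1) v] s1 V_carrier ord_V by (auto simp: s_def)
  have vc: "v \<in> carrier G" using v V_carrier by blast
  define K where "K = {c \<in> V. norm h p c = \<one>}"
  have K: "subgroup K G"
  proof (rule subgroupI)
    have "norm h p \<one> = \<one>"
      using norm_centralized[OF h(1) subgroup.one_closed[OF V_subgroup]] h by simp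
    then show "K \<noteq> {}" using subgroup.one_closed[OF V_subgroup] by (auto simp: K_def)
    show "a \<otimes> b \<in> K" if "a \<in> K" "b \<in> K" for a b
      using that norm_mult[OF h(1), of a b p] subgroup.m_closed[OF V_subgroup] by (simp add: K_def)
    show "inv a \<in> K" if a: "a \<in> K" for a
    proof -
      have aV: "a \<in> V" "inv a \<in> V" "norm h p a = \<one>" using a subgroup.m_inv_closed[OF V_subgroup] by (auto simp: K_def)
      have "norm h p (a \<otimes> inv a) = norm h p (inv a)"
        using norm_mult[OF h(1) aV(1,2)] aV V_carrier[OF norm_closed[OF h(1) aV(2)]] by simp
      then show ?thesis using aV \<open>norm h p \<one> = \<one>\<close> V_carrier by (simp add: K_def)
    qed
  qed (use V_carrier in \<open>auto simp: K_def\<close>)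
  have "card K \<le> card {x \<in> carrier G. x [^] p = s}"
  proof (rule card_inj_on_le[where f = "\<lambda>c. (c \<otimes> v) \<otimes> h"])
    show "inj_on (\<lambda>c. c \<otimes> v \<otimes> h) K" using V_carrier vc h by (auto simp: inj_on_def K_def)
    have "((c \<otimes> v) \<otimes> h) [^] p = s" if "c \<in> V" "norm h p c = \<one>" for c
      using mult_pow_eq_norm[OF h(1), of "c \<otimes> v" p] norm_mult[OF h(1) that(1) v] that h s
        subgroup.m_closed[OF V_subgroup that(1) v] by (simp add: s_def)
    then show "(\<lambda>c. c \<otimes> v \<otimes> h) ` K \<subseteq> {x \<in> carrier G. x [^] p = s}"
      using V_carrier vc h by (auto simp: K_def)
  qed simp
  also have "\<dots> \<le> 2 * p" using card_roots_le[OF s(3) p] s by simp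
  finally have K2: "card K \<le> 2 * p" .
  have "card K dvd card V" using subgroup_card_dvd[OF K V_subgroup] by (auto simp: K_def)
  then obtain k where k: "card K = p ^ k" using V_p_group divides_primepow_nat[OF p] by metis
  have "k \<le> 1"
  proof (rule ccontr)
    assume "\<not> k \<le> 1"
    then have "p ^ 2 \<le> p ^ k" by (intro power_increasing) (use prime_gt_1_nat[OF p] \<open>\<not> k \<le> 1\<close> in auto)
    then have "p * p \<le> 2 * p" using K2 unfolding k power2_eq_square by linarith
    moreover have "p * p > 2 * p" using odd by simp
    ultimately show False by linarith
  qed
  then have Kp: "card K \<le> p" using k power_increasing[of k 1 p] p prime_gt_0_nat[OF p] by simp
  have fixK: "c \<in> K" if "c \<in> V" "h \<otimes> c = c \<otimes> h" for c
    using norm_centralized[OF h(1) that(1,2), of p] exponent that by (simp add: K_def)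
  have hs: "h \<otimes> s = s \<otimes> h" unfolding s_def by (rule norm_fixed[OF h(1) v h(2)])
  have "cyc s \<subseteq> K" using cyc_subset_iff[OF K s(3)] fixK[OF s(1) hs] by blast
  then have "cyc s = K" using Kp card_cyc[OF s(3)] s finite_subgroup[OF K] by (intro card_seteq) auto
  define d where "d = conjg h v \<otimes> inv v"
  have iv: "inv v \<in> V" using v subgroup.m_inv_closed[OF V_subgroup] by blast
  have d: "d \<in> V" unfolding d_def using subgroup.m_closed[OF V_subgroup V_conjg[OF h(1) v] iv] .
  have "norm h p (d \<otimes> v) = norm h p v"
    using norm_conjg[OF h(1) v h(2)] vc h by (simp add: d_def m_assoc)
  then have "norm h p d \<otimes> norm h p v = norm h p v" using norm_mult[OF h(1) d v] by simp
  then have "d \<in> K" using d V_carrier[OF norm_closed[OF h(1) v]] V_carrier[OF norm_closed[OF h(1) d]] by (simp add: K_def)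
  then have hd: "h \<otimes> d = d \<otimes> h" using \<open>cyc s = K\<close> commutes_cyc[OF h(1) s(3) hs] by blast
  have dc: "d \<in> carrier G" using d V_carrier by blast
  have hv: "conjg (h [^] j) v = d [^] j \<otimes> v" for j :: nat
  proof (induction j)
    case (Suc j)
    have "conjg (h [^] Suc j) v = conjg h (d [^] j \<otimes> v)"
      using Suc vc h nat_pow_Suc2[OF h(1), of j] by (simp add: conjg_conjg[symmetric] del: nat_pow_Suc)
    also have "\<dots> = d [^] j \<otimes> conjg h v"
      using hd dc vc h conjg_eq_self_iff[OF h(1) dc] by (simp add: conjg_mult conjg_nat_pow)
    also have "conjg h v = d \<otimes> v" using vc h by (simp add: d_def m_assoc)
    finally show ?case using dc vc by (simp add: m_assoc)
  qed (use vc in simp)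
  have dv: "d \<otimes> v = v \<otimes> d" using V_comm d v by blast
  have nrm: "norm h n v = d [^] (\<Sum>{..<n}) \<otimes> v [^] n" for n
  proof (induction n)
    case (Suc n)
    have "norm h (Suc n) v = d [^] (\<Sum>{..<n}) \<otimes> (v [^] n \<otimes> d [^] n) \<otimes> v"
      using Suc norm_Suc[OF h(1) v] hv dc vc by (simp add: m_assoc)
    also have "v [^] n \<otimes> d [^] n = d [^] n \<otimes> v [^] n" using commutes_pow_pow[OF dc vc dv] by simp
    finally show ?case using dc vc by (simp add: m_assoc sum.lessThan_Suc nat_pow_mult[symmetric])
  qed (simp add: norm_0)
  have "p dvd \<Sum>{..<p}"
  proof -
    have "\<Sum>{..<p} = p * (p - 1) div 2"
      using gauss_sum_nat[of "p - 1"] prime_gt_0_nat[OF p]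
      by (simp add: lessThan_atLeast0 atLeast0AtMost[symmetric] atLeastLessThanSuc_atLeastAtMost[symmetric] mult.commute)
    moreover have "even (p - 1)" using p odd prime_odd_nat by fastforce
    then obtain m where "p - 1 = 2 * m" by (rule evenE)
    ultimately have "\<Sum>{..<p} = p * m" by simp
    then show ?thesis by simp
  qed
  then have "d [^] (\<Sum>{..<p}) = \<one>" using exponent[OF d] pow_eq_id[OF dc] dvd_trans by blast
  then have "norm h p v = \<one>" using nrm[of p] exponent[OF v] by simp
  then show False using s1 by simp
qed

text \<open>First, \<open>u\<^sup>p = 1\<close>: otherwise \<open>w = u\<^sup>p\<close> has the roots \<open>uct\<close>, where \<open>c\<close> runs through the fixed points of
  \<open>u\<close> in \<open>V\<close> and \<open>t\<close> through the subgroup of order \<open>p\<close> of \<open>\<langle>w\<rangle>\<close>; these are at least \<open>p\<^sup>2 > 2p\<close>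
  elements. Now \<open>\<langle>y\<rangle>\<close> and \<open>u\<close> generate a Frobenius group of order \<open>pq\<close>, in which the elements \<open>y\<^sup>k u\<close> have
  order \<open>p\<close> and trivial norms, contrary to \<open>ex_norm_nontrivial\<close>.\<close>

lemma no_p_element_acting_if_odd:
  assumes odd: "p > 2" and y: "y \<in> carrier G" "ord y = q" "prime q" "q \<noteq> p"
    and u: "u \<in> carrier G" "conjg u y \<in> cyc y" "conjg u y \<noteq> y" "u [^] p \<otimes> y = y \<otimes> u [^] p" "ord u = p ^ k"
  shows False
proof -
  have nc: "u \<otimes> y \<noteq> y \<otimes> u" using u y conjg_eq_self_iff by blast
  have free: "w = \<one>" if "w \<in> V" "y \<otimes> w = w \<otimes> y" for w
    using acts_freely[OF that(1) y(1) _ _ that(2)] y by simp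
  have "u [^] p = \<one>"
  proof (rule ccontr)
    define w where "w = u [^] p"
    assume "u [^] p \<noteq> \<one>"
    then have w: "w \<in> carrier G" "w \<noteq> \<one>" "w \<in> cyc u" using u cyc_iff by (auto simp: w_def)
    obtain j where j: "ord w = p ^ j" using ord_dvd_of_cyc[OF w(3) u(1)] u(5) divides_primepow_nat[OF p] by metis
    have "j \<noteq> 0" using j w ord_eq_1 by (metis power_0)
    then have pw: "p dvd ord w" using j by simp
    define t0 where "t0 = w [^] (ord w div p)"
    have t0: "t0 \<in> carrier G" "ord t0 = p" using w ord_prime_pow[OF w(1) p pw] by (auto simp: t0_def)
    have t0w: "t0 \<in> cyc w" using w cyc_iff by (auto simp: t0_def)
    define C where "C = {c \<in> V. u \<otimes> c = c \<otimes> u}"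
    have tw: "t \<in> cyc w \<and> t \<in> cyc u \<and> t \<in> carrier G" if "t \<in> cyc t0" for t
      using that cyc_mono[OF t0w w(1)] cyc_mono[OF w(3) u(1)] cyc_closed[OF _ t0(1)] by blast
    have inj: "inj_on (\<lambda>(c, t). u \<otimes> c \<otimes> t) (C \<times> cyc t0)"
    proof (rule inj_onI, clarify)
      fix c t c' t' assume H: "c \<in> C" "t \<in> cyc t0" "c' \<in> C" "t' \<in> cyc t0" "u \<otimes> c \<otimes> t = u \<otimes> c' \<otimes> t'"
      have cl: "c \<in> carrier G" "c' \<in> carrier G" "t \<in> carrier G" "t' \<in> carrier G" "c \<in> V" "c' \<in> V"
        using H tw V_carrier by (auto simp: C_def)
      have "c \<otimes> t = c' \<otimes> t'" using H(5) cl u by (simp add: m_assoc)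
      then have eq: "inv c' \<otimes> c = t' \<otimes> inv t"
        using cl by (metis inv_closed inv_solve_left inv_solve_right m_assoc m_closed)
      have "inv c' \<otimes> c \<in> V"
        using subgroup.m_closed[OF V_subgroup subgroup.m_inv_closed[OF V_subgroup cl(6)] cl(5)] .
      moreover have "t' \<otimes> inv t \<in> cyc w"
        using subgroup.m_closed[OF cyc_subgroup[OF w(1)] _ subgroup.m_inv_closed[OF cyc_subgroup[OF w(1)]]] tw H by blast
      then have "y \<otimes> (t' \<otimes> inv t) = (t' \<otimes> inv t) \<otimes> y"
        using commutes_cyc[OF y(1) w(1)] u(4) by (simp add: w_def)
      ultimately have "inv c' \<otimes> c = \<one>" using free eq by simp
      then have "c = c'" using cl by (metis inv_closed inv_equality inv_inv)
      then show "c = c' \<and> t = t'" using \<open>c \<otimes> t = c' \<otimes> t'\<close> cl by simp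
    qed
    have "(\<lambda>(c, t). u \<otimes> c \<otimes> t) ` (C \<times> cyc t0) \<subseteq> {x \<in> carrier G. x [^] p = w}"
    proof clarify
      fix c t assume H: "c \<in> C" "t \<in> cyc t0"
      have cl: "c \<in> carrier G" "t \<in> carrier G" "c \<in> V" "u \<otimes> c = c \<otimes> u" using H tw V_carrier by (auto simp: C_def)
      have ut: "u \<otimes> t = t \<otimes> u" using commutes_cyc[OF u(1) u(1) refl, of t] tw[OF H(2)] by simp
      have ct: "c \<otimes> t = t \<otimes> c" using commutes_cyc[OF cl(1) u(1), of t] cl tw[OF H(2)] by simp
      have "(u \<otimes> c) \<otimes> t = t \<otimes> (u \<otimes> c)" using ut ct cl u by (metis m_assoc)
      then have "((u \<otimes> c) \<otimes> t) [^] p = (u \<otimes> c) [^] p \<otimes> t [^] p"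
        using pow_mult_distrib[of "u \<otimes> c" t p] cl u by simp
      also have "(u \<otimes> c) [^] p = w \<otimes> c [^] p" using pow_mult_distrib[OF cl(4) u(1) cl(1), of p] by (simp add: w_def)
      also have "t [^] p = \<one>" using ord_dvd_of_cyc[OF H(2) t0(1)] t0 pow_eq_id cl by simp
      finally show "u \<otimes> c \<otimes> t \<in> carrier G \<and> (u \<otimes> c \<otimes> t) [^] p = w" using exponent[OF cl(3)] w cl u by simp
    qed
    then have "card (C \<times> cyc t0) \<le> card {x \<in> carrier G. x [^] p = w}"
      using card_inj_on_le[OF inj] by simp
    also have "\<dots> \<le> 2 * p" by (rule card_roots_le[OF w(1) p pw])
    finally have C2: "card C \<le> 2" using prime_gt_0_nat[OF p] t0 by (simp add: card_cartesian_product card_cyc)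
    obtain c where c: "c \<in> V" "c \<noteq> \<one>" "\<And>g. g \<in> cyc u \<Longrightarrow> conjg g c = c"
    proof (rule p_group_fixes_nontrivial[OF cyc_subgroup[OF u(1)] p _ V_subgroup p_dvd_card_V])
      show "card (cyc u) = p ^ k" using u card_cyc by simp
    qed (use V_conjg cyc_closed[OF _ u(1)] in auto)
    have cc: "c \<in> carrier G" "ord c = p" using c V_carrier ord_V by auto
    have "u \<otimes> c = c \<otimes> u" using c(3)[OF cyc_self] cc u conjg_eq_self_iff by blast
    then have "cyc c \<subseteq> C"
      using commutes_cyc[OF u(1) cc(1)] cyc_subset_iff[OF V_subgroup cc(1)] c(1) by (auto simp: C_def)
    then have "card (cyc c) \<le> card C" using finite_subgroup[OF V_subgroup] by (intro card_mono) (auto simp: C_def)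
    then show False using C2 odd cc card_cyc by simp
  qed
  note up = this
  have pc: "p > 0" using p prime_gt_0_nat by blast
  obtain v where v: "v \<in> V" "v \<noteq> \<one>" using V_nontrivial .
  have commy: "g \<otimes> y = y \<otimes> g" if g: "g \<in> carrier G" and t: "t \<in> cyc y" "t \<noteq> \<one>" "g \<otimes> t = t \<otimes> g" for g t
  proof -
    have tc: "t \<in> carrier G" using t y cyc_closed by blast
    have "y \<in> cyc t" using prime_order_cyc_eq[OF y(1) _ t(1,2)] y cyc_self by simp
    then show ?thesis using commutes_cyc[OF g tc t(3)] by blast
  qed
  have "\<exists>k<q. norm (y [^] k \<otimes> u) p v \<noteq> \<one>"
  proof (rule ex_norm_nontrivial[OF y(1,2) free u(1,2) pc])
    show "inj_on (\<lambda>k. (y [^] k \<otimes> u) [^] j) {..<q}" if j: "0 < j" "j < p" for j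
    proof (rule linorder_inj_onI')
      fix k l assume kl: "k \<in> {..<q}" "l \<in> {..<q}" "k < l"
      show "(y [^] k \<otimes> u) [^] j \<noteq> (y [^] l \<otimes> u) [^] j"
      proof
        assume eq: "(y [^] k \<otimes> u) [^] j = (y [^] l \<otimes> u) [^] j"
        let ?a = "y [^] k \<otimes> u" and ?b = "y [^] l \<otimes> u"
        have ab: "?a \<in> carrier G" "?b \<in> carrier G" using y u by simp_all
        let ?g = "?a [^] j"
        have gc: "?g \<in> carrier G" using ab by simp
        have ga: "?g \<otimes> ?a = ?a \<otimes> ?g" using group_commutes_pow[of ?a ?a j] ab by simp
        have gb: "?g \<otimes> ?b = ?b \<otimes> ?g" using group_commutes_pow[of ?b ?b j] ab eq by simp
        have C: "subgroup (centralizer {?g}) G" using gc by (intro subgroup_centralizer) auto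
        have "?b \<otimes> inv ?a \<in> centralizer {?g}"
          by (rule subgroup.m_closed[OF C _ subgroup.m_inv_closed[OF C]])
            (use ab ga gb in \<open>auto simp: centralizer_def\<close>)
        moreover have "?b \<otimes> inv ?a = y [^] (l - k)"
        proof -
          have "?b = y [^] (l - k) \<otimes> ?a"
            using y u kl nat_pow_mult[OF y(1), of "l - k" k] by (simp add: m_assoc[symmetric])
          then show ?thesis using ab y by (simp add: m_assoc)
        qed
        ultimately have "?g \<otimes> y [^] (l - k) = y [^] (l - k) \<otimes> ?g" by (simp add: centralizer_def)
        moreover have "y [^] (l - k) \<noteq> \<one>" using pow_eq_id[OF y(1), of "l - k"] y kl by (auto dest: dvd_imp_le)
        ultimately have gy: "?g \<otimes> y = y \<otimes> ?g" using commy[OF gc, of "y [^] (l - k)"] cyc_iff[OF y(1)] by blast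
        obtain e where e: "?g = y [^] (e::nat) \<otimes> u [^] j" using normalizing_pow_coset[OF y(1) u(1,2)] by blast
        have Cy: "subgroup (centralizer {y}) G" using y by (intro subgroup_centralizer) auto
        have "u [^] j = inv (y [^] e) \<otimes> ?g" using e y u by simp
        moreover have "y [^] e \<in> centralizer {y}" "?g \<in> centralizer {y}"
          using y gy gc group_commutes_pow[of y y e] by (auto simp: centralizer_def)
        ultimately have "u [^] j \<in> centralizer {y}"
          using subgroup.m_closed[OF Cy subgroup.m_inv_closed[OF Cy]] by simp
        then have uj: "u [^] j \<otimes> y = y \<otimes> u [^] j" by (simp add: centralizer_def)
        have "coprime j p" using j p by (metis coprime_commute dvd_imp_le not_le prime_imp_coprime)
        then show False using commutes_of_coprime_pows[OF u(1) y(1) _ j(1) uj u(4)] nc by blast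
      qed
    qed
    show "v [^] q \<noteq> \<one>" using pow_prime_neq_one v y by blast
  qed (use v in auto)
  then obtain k :: nat where k: "norm (y [^] k \<otimes> u) p v \<noteq> \<one>" by blast
  let ?h = "y [^] k \<otimes> u"
  have hc: "?h \<in> carrier G" using y u by simp
  have "?h [^] p = \<one>"
  proof (rule ccontr)
    assume n: "?h [^] p \<noteq> \<one>"
    obtain e where e: "?h [^] p = y [^] (e::nat) \<otimes> u [^] p" using normalizing_pow_coset[OF y(1) u(1,2)] by blast
    then have he: "?h [^] p = y [^] e" using up y by simp
    have "?h \<otimes> ?h [^] p = ?h [^] p \<otimes> ?h" using group_commutes_pow[of ?h ?h p] hc by simp
    moreover have "?h [^] p \<in> cyc y" unfolding he using cyc_iff[OF y(1)] by blast
    ultimately have "?h \<otimes> y = y \<otimes> ?h" using commy[OF hc _ n] by blast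
    then have "y [^] k \<otimes> (u \<otimes> y) = y [^] k \<otimes> (y \<otimes> u)"
      using y u group_commutes_pow[of y y k] by (simp add: m_assoc[symmetric])
    then show False using nc y u by simp
  qed
  then show False using norm_trivial_if_odd[OF odd hc _ v(1)] k by simp
qed

end

section \<open>Normal elementary abelian 2-subgroups\<close>

lemma card_le_fibres:
  assumes "finite A" "\<And>b. b \<in> f ` A \<Longrightarrow> card {x \<in> A. f x = b} \<le> m"
  shows "card A \<le> card (f ` A) * m"
proof -
  have "A = (\<Union>b\<in>f ` A. {x \<in> A. f x = b})" by auto
  then have "card A = card (\<Union>b\<in>f ` A. {x \<in> A. f x = b})" by simp
  also have "\<dots> \<le> (\<Sum>b\<in>f ` A. card {x \<in> A. f x = b})"
    using assms(1) by (intro card_UN_le) simp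
  also have "\<dots> \<le> card (f ` A) * m"
    using sum_bounded_above[of "f ` A" "\<lambda>b. card {x \<in> A. f x = b}" m] assms(2) by simp
  finally show ?thesis .
qed

context finite_group
begin

lemma card_orbit_le:
  assumes "set_action G P X act" "x \<in> X"
  shows "card P \<le> card X * card {g \<in> P. act g x = x}"
proof -
  interpret set_action G P X act by fact
  have "(\<lambda>g. act g x) ` P \<subseteq> X" using act_closed assms(2) by auto
  then have "card ((\<lambda>g. act g x) ` P) \<le> card X" using finite_X card_mono by blast
  then show ?thesis using orbit_stabilizer[OF assms(2)] by (metis mult_le_mono1)
qed

text \<open>The quotient by the pointwise stabilizer embeds into the symmetric group on three points.\<close>

lemma solvable_if_conjg_invariant_triple:
  assumes B: "B \<subseteq> carrier G" "card B = 3" "\<And>g x. \<lbrakk>g \<in> carrier G; x \<in> B\<rbrakk> \<Longrightarrow> conjg g x \<in> B"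
    and sol: "solvable (G\<lparr>carrier := centralizer B\<rparr>)"
  shows "solvable G"
proof -
  obtain a b c where abc: "B = {a, b, c}" "a \<noteq> b" "a \<noteq> c" "b \<noteq> c" using B(2) by (metis card_3_iff)
  have cl: "a \<in> carrier G" "b \<in> carrier G" "c \<in> carrier G" using B(1) abc by auto
  let ?C = "centralizer B"
  let ?S = "{g \<in> carrier G. conjg g a = a}"
  have "set_action G (carrier G) B conjg"
    using B subgroup_self by (intro set_action_conjg) auto
  then have 1: "card (carrier G) \<le> 3 * card ?S"
    using card_orbit_le[of "carrier G" B conjg a] B(2) abc(1) by simp
  have S: "subgroup ?S G"
    using set_action.subgroup_stabilizer[OF \<open>set_action G (carrier G) B conjg\<close>, of a] abc(1) by simp
  have mv: "conjg g x \<in> {b, c}" if "g \<in> carrier G" "conjg g a = a" "x \<in> {b, c}" for g x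
  proof -
    have "conjg g x \<in> {a, b, c}" using B(3)[of g x] that abc by auto
    moreover have "conjg g x \<noteq> a" using conjg_inject[of g x a] that cl abc by auto
    ultimately show ?thesis by blast
  qed
  have "set_action G ?S {b, c} conjg"
    using S mv cl by (intro set_action_conjg) auto
  then have 2: "card ?S \<le> 2 * card {g \<in> ?S. conjg g b = b}"
    using card_orbit_le[of ?S "{b, c}" conjg b] abc(4) by simp
  have "{g \<in> ?S. conjg g b = b} \<subseteq> ?C"
  proof clarify
    fix g assume g: "g \<in> carrier G" "conjg g a = a" "conjg g b = b"
    have "conjg g c \<noteq> b" using conjg_inject[of g c b] g cl abc by auto
    then have "conjg g c = c" using mv[of g c] g by auto
    then show "g \<in> ?C" using g cl abc(1) conjg_eq_self_iff by (auto simp: centralizer_def)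
  qed
  then have "card {g \<in> ?S. conjg g b = b} \<le> card ?C"
    using subgroup_centralizer[OF B(1)] by (intro card_mono) auto
  then have le: "order G \<le> 6 * card ?C" using 1 2 by (simp add: order_def)
  have N: "?C \<lhd> G" by (rule centralizer_normal[OF B(1,3)])
  have "card ?C > 0"
    using subgroup.one_closed[OF subgroup_centralizer[OF B(1)]] subgroup_centralizer[OF B(1)]
    by (auto simp: card_gt_0_iff)
  then have "order (G Mod ?C) \<le> 6" using le order_quotient[OF N] by (metis mult_le_cancel2)
  then show ?thesis
    using solvable_of_normal_quotient[OF N sol] order_le_6_solvable finite_group_quotient[OF N] by blast
qed

end

context claw_free_with_normal
begin

text \<open>Subgroups of order prime to \<open>p\<close> act with regular orbits.\<close>

lemma card_dvd_if_p'_subgroup: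
  assumes P: "subgroup P G" "\<not> p dvd card P" shows "card P dvd card V - 1"
proof -
  let ?X = "V - {\<one>}"
  have Pc: "g \<in> carrier G" if "g \<in> P" for g using subgroup.mem_carrier[OF P(1) that] .
  interpret A: set_action G P ?X conjg
    using P V_carrier V_conjg Pc by (intro set_action_conjg) auto
  have triv: "{g \<in> P. conjg g x = x} = {\<one>}" if x: "x \<in> ?X" for x
  proof -
    have "g = \<one>" if g: "g \<in> P" "conjg g x = x" for g
    proof (rule ccontr)
      assume "g \<noteq> \<one>"
      then obtain k :: nat and r where r: "prime r" "r dvd ord g" "ord (g [^] k) = r"
        using ex_prime_pow[OF Pc[OF g(1)]] by blast
      have "r dvd card P" using r ord_dvd_subgroup[OF P(1) g(1)] dvd_trans by blast
      then have "r \<noteq> p" using P by blast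
      moreover have "g [^] k \<otimes> x = x \<otimes> g [^] k"
        using group_commutes_pow[of g x k] g x Pc V_carrier conjg_eq_self_iff by auto
      ultimately show False using acts_freely[of x "g [^] k"] x r Pc[OF g(1)] by auto
    qed
    then have "{g \<in> P. conjg g x = x} \<subseteq> {\<one>}" by blast
    moreover have "\<one> \<in> {g \<in> P. conjg g x = x}" using A.act_one[OF x] subgroup.one_closed[OF P(1)] by simp
    ultimately show ?thesis by blast
  qed
  have "card B = card P" if B: "B \<in> A.orbs" for B
  proof -
    obtain x where x: "x \<in> ?X" "B = (\<lambda>g. conjg g x) ` P" using B unfolding A.orbs_def by blast
    then show ?thesis using A.orbit_stabilizer[OF x(1)] triv[OF x(1)] by simp
  qed
  then have "card ?X = card A.orbs * card P" using A.card_eq_sum_orbs by simp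
  moreover have "card ?X = card V - 1"
    using subgroup.one_closed[OF V_subgroup] by (simp add: card_Diff_singleton)
  ultimately show ?thesis by simp
qed

lemma card_invariant_subgroup_mod:
  assumes W: "subgroup W G" "W \<subseteq> V" and y: "y \<in> carrier G" "prime (ord y)" "ord y \<noteq> p"
    and inv: "\<And>c. c \<in> W \<Longrightarrow> conjg y c \<in> W"
  shows "card W mod ord y = 1 mod ord y"
proof -
  have Wc: "c \<in> carrier G" if "c \<in> W" for c using that W(2) V_carrier by blast
  have "{c \<in> W. conjg y c = c} = {\<one>}"
  proof
    show "{c \<in> W. conjg y c = c} \<subseteq> {\<one>}"
      using acts_freely[OF _ y] W(2) conjg_eq_self_iff[OF y(1) Wc] by blast
    show "{\<one>} \<subseteq> {c \<in> W. conjg y c = c}" using subgroup.one_closed[OF W(1)] y by simp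
  qed
  moreover have "card W mod ord y = card {c \<in> W. conjg y c = c} mod ord y"
  proof (rule card_fixed_points_prime_cycle[OF finite_subgroup[OF W(1)] y(2)])
    show "(conjg y ^^ ord y) x = x" if "x \<in> W" for x
      using funpow_conjg[OF y(1) Wc[OF that]] pow_ord_eq_1[OF y(1)] Wc[OF that] by simp
  qed (use inv in auto)
  ultimately show ?thesis by simp
qed

text \<open>The commutator of \<open>u\<close> and \<open>y\<close> would lie in \<open>V\<close> and in \<open>\<langle>y\<rangle>\<close>.\<close>

lemma not_in_V_if_acting:
  assumes y: "y \<in> carrier G" "prime (ord y)" "ord y \<noteq> p"
    and u: "u \<in> carrier G" "conjg u y \<in> cyc y" "conjg u y \<noteq> y"
  shows "u \<notin> V"
proof
  assume uV: "u \<in> V"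
  have "conjg u y \<otimes> inv y = u \<otimes> conjg y (inv u)" using y u by (simp add: conjg_def group_norm)
  then have inV: "conjg u y \<otimes> inv y \<in> V"
    using subgroup.m_closed[OF V_subgroup uV V_conjg[OF y(1) subgroup.m_inv_closed[OF V_subgroup uV]]] by simp
  have "conjg u y \<otimes> inv y \<in> cyc y"
    by (rule subgroup.m_closed[OF cyc_subgroup[OF y(1)] u(2) cyc_inv[OF y(1)]])
  then have "y \<otimes> (conjg u y \<otimes> inv y) = (conjg u y \<otimes> inv y) \<otimes> y"
    using commutes_cyc[OF y(1) y(1) refl] by blast
  then have "conjg u y \<otimes> inv y = \<one>" using acts_freely[OF inV y] by simp
  then have "inv (inv y) = conjg u y" using u y by (intro inv_equality) auto
  then show False using u y by simp
qed

lemma prime_dvd_card_V: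
  assumes "prime r" "r dvd order G" "r \<noteq> p" shows "r dvd card V - 1"
proof -
  obtain y where y: "y \<in> carrier G" "ord y = r"
    using cauchy[OF subgroup_self assms(1)] assms(2) by (auto simp: order_def)
  have "\<not> p dvd card (cyc y)" using y card_cyc primes_dvd_imp_eq[OF p assms(1)] assms(3) by auto
  then show ?thesis using card_dvd_if_p'_subgroup[OF cyc_subgroup[OF y(1)]] y card_cyc by simp
qed

text \<open>\<open>G\<close> permutes the three involutions of \<open>V\<close>.\<close>

lemma solvable_if_card_4:
  assumes "p = 2" "card V = 4" shows "solvable G"
proof (rule solvable_if_conjg_invariant_triple)
  show "card (V - {\<one>}) = 3"
    using assms subgroup.one_closed[OF V_subgroup] by (simp add: card_Diff_singleton)
  show "solvable (G\<lparr>carrier := centralizer (V - {\<one>})\<rparr>)"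
  proof -
    have "centralizer (V - {\<one>}) = centralizer V" by (auto simp: centralizer_def)
    moreover obtain k where "card (centralizer V) = p ^ k" using centralizer_V_p_group by blast
    ultimately show ?thesis
      using p_subgroup_solvable[OF finite_group_axioms subgroup_centralizer p] V_carrier by (metis subsetI)
  qed
qed (use V_carrier V_conjg in auto)

end


locale self_centralizing_two = claw_free_with_normal G V 2 for G (structure) and V +
  assumes self: "centralizer V \<subseteq> V" and card_ge: "card V \<ge> 8"
begin

text \<open>The inverse image of the set of involutions of \<open>G/V\<close>.\<close>

definition J where "J = {a \<in> carrier G. a \<notin> V \<and> a \<otimes> a \<in> V}"
definition C where "C a = {c \<in> V. a \<otimes> c = c \<otimes> a}"

lemma sq: "v \<in> V \<Longrightarrow> v \<otimes> v = \<one>"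
  using exponent[of v] V_carrier[of v] by (simp add: numeral_2_eq_2)

lemma inv_V: "v \<in> V \<Longrightarrow> inv v = v"
  using sq V_carrier inv_equality by blast

lemma V_mult: "\<lbrakk>v \<in> V; w \<in> V\<rbrakk> \<Longrightarrow> v \<otimes> w \<in> V"
  by (rule subgroup.m_closed[OF V_subgroup])

lemma J_carrier: "a \<in> J \<Longrightarrow> a \<in> carrier G" by (simp add: J_def)

lemma C_subset: "C a \<subseteq> V" by (auto simp: C_def)

lemma finite_V: "finite V" using V_subgroup by simp

lemma finite_C: "finite (C a)" using finite_V C_subset finite_subset by blast

lemma C_subgroup: "a \<in> carrier G \<Longrightarrow> subgroup (C a) G"
proof -
  assume a: "a \<in> carrier G"
  have "C a = V \<inter> centralizer {a}"
    using V_carrier by (auto simp: C_def centralizer_def)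
  then show ?thesis
    using subgroups_Inter_pair[OF V_subgroup subgroup_centralizer] a by simp
qed

lemma nrm_eq: "\<lbrakk>a \<in> carrier G; v \<in> V\<rbrakk> \<Longrightarrow> norm a 2 v = v \<otimes> conjg a v"
  using norm_Suc[of a v 1] norm_Suc[of a v 0] V_carrier V_conjg by (simp add: numeral_2_eq_2 norm_0)

lemma square_eq: "\<lbrakk>a \<in> carrier G; v \<in> V\<rbrakk> \<Longrightarrow> (v \<otimes> a) \<otimes> (v \<otimes> a) = norm a 2 v \<otimes> (a \<otimes> a)"
  using mult_pow_eq_norm[of a v 2] V_carrier[of v] by (simp add: numeral_2_eq_2)

lemma norm_eq_one_iff: "\<lbrakk>a \<in> carrier G; v \<in> V\<rbrakk> \<Longrightarrow> norm a 2 v = \<one> \<longleftrightarrow> v \<in> C a"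
proof -
  assume a: "a \<in> carrier G" and v: "v \<in> V"
  have c: "v \<in> carrier G" "conjg a v \<in> carrier G" using v a V_carrier by auto
  have "v \<otimes> conjg a v = \<one> \<longleftrightarrow> conjg a v = v"
    using c sq[OF v] inv_V[OF v] inv_equality[of v "conjg a v"] sq[OF V_conjg[OF a v]]
    by (metis inv_comm inv_unique')
  then show ?thesis using nrm_eq[OF a v] conjg_eq_self_iff[OF a c(1)] v by (simp add: C_def)
qed

text \<open>The map \<open>norm a 2\<close> is a homomorphism on \<open>V\<close> with kernel \<open>C a\<close>, so that its nonempty fibres are
  cosets of \<open>C a\<close>.\<close>

lemma norm_fibre_le:
  assumes a: "a \<in> carrier G" shows "card {v \<in> V. norm a 2 v = b} \<le> card (C a)"
proof (cases "\<exists>w\<in>V. norm a 2 w = b")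
  case True
  then obtain w where w: "w \<in> V" "norm a 2 w = b" by blast
  show ?thesis
  proof (rule card_inj_on_le[where f = "\<lambda>v. v \<otimes> w"])
    show "inj_on (\<lambda>v. v \<otimes> w) {v \<in> V. norm a 2 v = b}" using V_carrier w by (auto simp: inj_on_def)
    have "v \<otimes> w \<in> C a" if "v \<in> V" "norm a 2 v = b" for v
    proof -
      have "norm a 2 (v \<otimes> w) = b \<otimes> b" using norm_mult[OF a that(1) w(1)] that w by simp
      also have "\<dots> = \<one>" using sq[of b] norm_closed[OF a w(1), of 2] w by simp
      finally show ?thesis using norm_eq_one_iff[OF a V_mult[OF that(1) w(1)]] by simp
    qed
    then show "(\<lambda>v. v \<otimes> w) ` {v \<in> V. norm a 2 v = b} \<subseteq> C a" by auto
  qed (rule finite_C)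
next
  case False
  then have empty: "{v \<in> V. norm a 2 v = b} = {}" by blast
  show ?thesis unfolding empty by simp
qed

lemma norm_in_C: "\<lbrakk>a \<in> J; v \<in> V\<rbrakk> \<Longrightarrow> norm a 2 v \<in> C a"
proof -
  assume a: "a \<in> J" and v: "v \<in> V"
  have ac: "a \<in> carrier G" "a \<otimes> a \<in> V" using a by (auto simp: J_def)
  have c: "v \<in> carrier G" "conjg a v \<in> V" "conjg a v \<in> carrier G" using v ac V_carrier V_conjg by auto
  have "conjg (a \<otimes> a) v = v" using V_comm[OF ac(2) v] conjg_eq_self_iff ac c by simp
  then have "conjg a (v \<otimes> conjg a v) = conjg a v \<otimes> v" using ac c by (simp add: conjg_mult conjg_conjg)
  then have "conjg a (norm a 2 v) = norm a 2 v" using nrm_eq[OF ac(1) v] V_comm[OF v c(2)] by simp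
  then show ?thesis
    using norm_closed[OF ac(1) v] V_carrier conjg_eq_self_iff ac by (simp add: C_def)
qed

lemma card_roots_two: "\<lbrakk>s \<in> V; s \<noteq> \<one>\<rbrakk> \<Longrightarrow> card {x \<in> carrier G. x \<otimes> x = s} \<le> 4"
proof -
  assume s: "s \<in> V" "s \<noteq> \<one>"
  have "{x \<in> carrier G. x \<otimes> x = s} = {x \<in> carrier G. x [^] (2::nat) = s}" by (auto simp: numeral_2_eq_2)
  then show ?thesis using card_roots_le[OF V_carrier[OF s(1)] p] ord_V[OF s] by simp
qed

text \<open>As \<open>a\<close> does not centralize \<open>V\<close>, some \<open>s = (va)\<^sup>2\<close> with \<open>v \<in> V\<close> is nontrivial. The elements \<open>cva\<close> with
  \<open>c\<close> in \<open>C a\<close> are square roots of \<open>s\<close>, and there are at most four of those.\<close>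

lemma card_C_le: assumes a: "a \<in> J" shows "card (C a) \<le> 4"
proof -
  have ac: "a \<in> carrier G" "a \<notin> V" "a \<otimes> a \<in> V" using a by (auto simp: J_def)
  have "a \<notin> centralizer V" using ac self by blast
  then obtain v0 where v0: "v0 \<in> V" "a \<otimes> v0 \<noteq> v0 \<otimes> a" using ac by (auto simp: centralizer_def)
  then have n0: "norm a 2 v0 \<noteq> \<one>" using norm_eq_one_iff[OF ac(1)] by (simp add: C_def)
  have N1: "norm a 2 \<one> = \<one>"
    using norm_eq_one_iff[OF ac(1) subgroup.one_closed[OF V_subgroup]] ac subgroup.one_closed[OF V_subgroup]
    by (simp add: C_def)
  have "\<exists>v\<in>V. norm a 2 v \<otimes> (a \<otimes> a) \<noteq> \<one>"
  proof (cases "a \<otimes> a = \<one>")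
    case True
    then show ?thesis using v0 n0 V_carrier[OF norm_closed[OF ac(1) v0(1)]] by (intro bexI[of _ v0]) auto
  next
    case False
    then show ?thesis using N1 ac subgroup.one_closed[OF V_subgroup] by (intro bexI[of _ \<one>]) auto
  qed
  then obtain v where v: "v \<in> V" "norm a 2 v \<otimes> (a \<otimes> a) \<noteq> \<one>" by blast
  let ?s = "norm a 2 v \<otimes> (a \<otimes> a)"
  have s: "?s \<in> V" using V_mult norm_closed ac v by blast
  have "card (C a) \<le> card {x \<in> carrier G. x \<otimes> x = ?s}"
  proof (rule card_inj_on_le[where f = "\<lambda>c. (c \<otimes> v) \<otimes> a"])
    show "inj_on (\<lambda>c. (c \<otimes> v) \<otimes> a) (C a)" using V_carrier v ac by (auto simp: inj_on_def C_def)
    have "(c \<otimes> v \<otimes> a) \<otimes> (c \<otimes> v \<otimes> a) = ?s" if "c \<in> C a" for c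
    proof -
      have c: "c \<in> V" "norm a 2 c = \<one>" using that norm_eq_one_iff ac C_subset by blast+
      then show ?thesis
        using square_eq[OF ac(1) V_mult[OF c(1) v(1)]] norm_mult[OF ac(1) c(1) v(1)] V_carrier[OF norm_closed[OF ac(1) v(1)]] by simp
    qed
    moreover have "c \<otimes> v \<otimes> a \<in> carrier G" if "c \<in> C a" for c
      using V_carrier[OF subsetD[OF C_subset that]] V_carrier[OF v(1)] ac by simp
    ultimately show "(\<lambda>c. c \<otimes> v \<otimes> a) ` C a \<subseteq> {x \<in> carrier G. x \<otimes> x = ?s}" by blast
  qed simp
  then show ?thesis using card_roots_two[OF s v(2)] by simp
qed

lemma card_V_le_C: assumes a: "a \<in> J" shows "card V \<le> card (norm a 2 ` V) * card (C a)" "card (norm a 2 ` V) \<le> card (C a)"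
proof -
  show "card V \<le> card (norm a 2 ` V) * card (C a)"
    by (rule card_le_fibres[OF finite_V norm_fibre_le[OF J_carrier[OF a]]])
  show "card (norm a 2 ` V) \<le> card (C a)"
    using norm_in_C[OF a] by (intro card_mono finite_C) auto
qed

lemma card_C: assumes a: "a \<in> J" shows "card (C a) = 4"
proof -
  have le: "card (C a) \<le> 4" by (rule card_C_le[OF a])
  have "card V \<le> card (C a) * card (C a)"
    using card_V_le_C[OF a] by (meson le_trans mult_le_mono1)
  then have "\<not> card (C a) \<le> 2" using card_ge mult_le_mono[of "card (C a)" 2 "card (C a)" 2] by linarith
  moreover have "card (C a) \<noteq> 3"
  proof
    assume 3: "card (C a) = 3"
    obtain k where "card V = 2 ^ k" using V_p_group by blast
    then have "card (C a) dvd 2 ^ k"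
      using subgroup_card_dvd[OF C_subgroup[OF J_carrier[OF a]] V_subgroup C_subset] by simp
    then have "(3::nat) dvd 2" using 3 prime_dvd_power[of "3::nat" 2 k] by simp
    then show False by simp
  qed
  ultimately show ?thesis using le by linarith
qed

lemma card_V_cases: assumes "a \<in> J" shows "card V = 8 \<or> card V = 16"
proof -
  have le: "card V \<le> 16"
    using card_V_le_C[OF assms] unfolding card_C[OF assms] by linarith
  obtain k where k: "card V = 2 ^ k" using V_p_group by blast
  have "k \<le> 4" using le power_le_imp_le_exp[of "2::nat" k 4] k by simp
  moreover have "3 \<le> k" using card_ge power_le_imp_le_exp[of "2::nat" 3 k] k by simp
  ultimately have "k = 3 \<or> k = 4" by linarith
  then show ?thesis using k by auto
qed

lemma J_mult: "\<lbrakk>a \<in> J; v \<in> V\<rbrakk> \<Longrightarrow> v \<otimes> a \<in> J"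
proof -
  assume a: "a \<in> J" and v: "v \<in> V"
  have ac: "a \<in> carrier G" "a \<notin> V" "a \<otimes> a \<in> V" using a by (auto simp: J_def)
  have "v \<otimes> a \<notin> V"
  proof
    assume "v \<otimes> a \<in> V"
    then have "v \<otimes> (v \<otimes> a) \<in> V" using V_mult v by blast
    then show False using ac sq[OF v] V_carrier[OF v] by (simp add: m_assoc[symmetric])
  qed
  moreover have "(v \<otimes> a) \<otimes> (v \<otimes> a) \<in> V"
    using square_eq[OF ac(1) v] V_mult norm_closed ac v by simp
  ultimately show ?thesis using ac V_carrier[OF v] by (simp add: J_def)
qed

lemma C_mult: "\<lbrakk>a \<in> carrier G; v \<in> V\<rbrakk> \<Longrightarrow> C (v \<otimes> a) = C a"
proof -
  have sub: "C a \<subseteq> C (v \<otimes> a)" if "a \<in> carrier G" "v \<in> V" for a v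
  proof
    fix c assume "c \<in> C a"
    then have c: "c \<in> V" "a \<otimes> c = c \<otimes> a" "c \<in> carrier G" "v \<in> carrier G" using V_carrier that by (auto simp: C_def)
    have "(v \<otimes> a) \<otimes> c = (v \<otimes> c) \<otimes> a" using c that by (simp add: m_assoc)
    also have "v \<otimes> c = c \<otimes> v" using V_comm c that by simp
    finally show "c \<in> C (v \<otimes> a)" using c that by (simp add: C_def m_assoc)
  qed
  assume a: "a \<in> carrier G" and v: "v \<in> V"
  have "v \<otimes> (v \<otimes> a) = a" using a v sq[OF v] V_carrier[OF v] by (simp add: m_assoc[symmetric])
  then show ?thesis using sub[OF a v] sub[of "v \<otimes> a" v] a v V_carrier[OF v] by auto
qed

lemma C_conjg: "\<lbrakk>g \<in> carrier G; a \<in> carrier G; c \<in> C a\<rbrakk> \<Longrightarrow> conjg g c \<in> C (conjg g a)"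
proof -
  assume g: "g \<in> carrier G" and a: "a \<in> carrier G" and "c \<in> C a"
  then have c: "c \<in> V" "a \<otimes> c = c \<otimes> a" "c \<in> carrier G" using V_carrier by (auto simp: C_def)
  have "conjg g (a \<otimes> c) = conjg g (c \<otimes> a)" using c by simp
  then have "conjg g a \<otimes> conjg g c = conjg g c \<otimes> conjg g a"
    using conjg_mult[OF g a c(3)] conjg_mult[OF g c(3) a] by simp
  then show ?thesis using V_conjg[OF g c(1)] by (simp add: C_def)
qed

lemma coset_fixed_action:
  assumes a: "a \<in> J" and g: "g \<in> carrier G" and fixes_coset: "conjg g a \<in> V #> a" and c: "c \<in> C a"
  shows "conjg g c \<in> C a"
proof -
  obtain v where v: "v \<in> V" "conjg g a = v \<otimes> a" using fixes_coset by (auto simp: r_coset_def)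
  have "conjg g c \<in> C (v \<otimes> a)" using C_conjg[OF g J_carrier[OF a] c] v by simp
  then show ?thesis using C_mult[OF J_carrier[OF a] v(1)] by simp
qed

text \<open>All elements of \<open>V #> a\<close> have the same fixed points in \<open>V\<close>, so that \<open>y\<close> acts on \<open>C a\<close>; it acts freely
  on the three involutions of this group.\<close>

lemma odd_normalizer_of_coset:
  assumes a: "a \<in> J" and y: "y \<in> carrier G" "prime (ord y)" "ord y \<noteq> 2" and "conjg y a \<in> V #> a"
  shows "ord y = 3"
proof -
  have "card (C a) mod ord y = 1 mod ord y"
    using card_invariant_subgroup_mod[OF C_subgroup[OF J_carrier[OF a]] C_subset y]
      coset_fixed_action[OF a y(1) assms(5)] by blast
  then have "4 mod ord y = 1 mod ord y" unfolding card_C[OF a] .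
  then have "ord y dvd 4 - 1" by (metis mod_eq_dvd_iff_nat one_le_numeral)
  then have "ord y dvd 3" by simp
  then show ?thesis using y(2) primes_dvd_imp_eq[of "ord y" 3] by simp
qed

text \<open>Here \<open>\<langle>y\<rangle>\<close> has order 7 and permutes the involutions of \<open>V\<close> transitively. Since \<open>u\<^sup>2\<close> commutes with
  \<open>y\<close> and fixes one involution of \<open>V\<close>, it centralizes \<open>V\<close> and is trivial. Then \<open>u\<close> and its conjugate by
  \<open>y\<close> fix four elements of \<open>V\<close> each, and so they have a common nontrivial fixed point. It is
  fixed by their quotient, which generates \<open>\<langle>y\<rangle>\<close>.\<close>

lemma no_inversion_if_card_8:
  assumes V8: "card V = 8" and y: "y \<in> carrier G" "ord y = q" "prime q" "q \<noteq> 2"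
    and u: "u \<in> carrier G" "conjg u y \<in> cyc y" "conjg u y \<noteq> y" "u [^] (2::nat) \<otimes> y = y \<otimes> u [^] (2::nat)" "ord u = 2 ^ k"
  shows False
proof -
  have q7: "q = 7"
  proof -
    have "q dvd 7" using prime_dvd_card_V[OF y(3) _ y(4)] ord_dvd_group_order[OF y(1)] y(2) V8 by simp
    then show ?thesis using y(3) primes_dvd_imp_eq[of q 7] by simp
  qed
  define w where "w = u [^] (2::nat)"
  have w: "w \<in> carrier G" "w \<otimes> y = y \<otimes> w" using u by (auto simp: w_def)
  have Cw: "subgroup (C w) G" by (rule C_subgroup[OF w(1)])
  have "conjg y c \<in> C w" if "c \<in> C w" for c
    using C_conjg[OF y(1) w(1) that] conjg_eq_self_iff[OF y(1) w(1)] w by simp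
  then have "card (C w) mod ord y = 1 mod ord y"
    by (intro card_invariant_subgroup_mod[OF Cw C_subset y(1)]) (use y in simp_all)
  then have c7: "card (C w) mod 7 = 1" using y(2) q7 by simp
  have cdvd: "card (C w) dvd 8" using subgroup_card_dvd[OF Cw V_subgroup C_subset] V8 by simp
  obtain c where c: "c \<in> V" "c \<noteq> \<one>" "\<And>g. g \<in> cyc u \<Longrightarrow> conjg g c = c"
  proof (rule p_group_fixes_nontrivial[OF cyc_subgroup[OF u(1)] p _ V_subgroup p_dvd_card_V])
    show "card (cyc u) = 2 ^ k" using u card_cyc by simp
  qed (use V_conjg cyc_closed[OF _ u(1)] in auto)
  have "w \<in> cyc u" using cyc_iff[OF u(1)] by (auto simp: w_def)
  then have "c \<in> C w" using c V_carrier w conjg_eq_self_iff by (auto simp: C_def)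
  then have "{\<one>, c} \<subseteq> C w" using subgroup.one_closed[OF Cw] by blast
  then have "2 \<le> card (C w)" using card_mono[OF finite_C, of "{\<one>, c}" w] c(2) by simp
  then have "card (C w) = 8"
  proof -
    have "card (C w) \<le> 8" using cdvd by (simp add: dvd_imp_le)
    then have "card (C w) \<in> {2, 3, 4, 5, 6, 7, 8}" using \<open>2 \<le> card (C w)\<close> by auto
    then show ?thesis using c7 by auto
  qed
  then have "C w = V" using V8 finite_V C_subset by (intro card_subset_eq) auto
  then have "w \<in> centralizer V" using w by (auto simp: C_def centralizer_def)
  then have "w \<in> V" using self by blast
  then have w1: "w = \<one>" using acts_freely[OF _ y(1)] w y by simp
  have "u \<notin> V" by (rule not_in_V_if_acting[OF y(1) _ _ u(1-3)]) (use y in simp_all)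
  then have uJ: "u \<in> J"
    using u w1 subgroup.one_closed[OF V_subgroup] by (simp add: J_def w_def numeral_2_eq_2)
  let ?u' = "conjg y u"
  have C4: "card (C u) = 4" by (rule card_C[OF uJ])
  have img: "conjg y ` C u \<subseteq> C ?u'" using C_conjg[OF y(1) u(1)] by blast
  have inj: "inj_on (conjg y) (C u)" using y C_subset V_carrier by (auto simp: inj_on_def subset_iff)
  have "C u \<inter> conjg y ` C u \<noteq> {\<one>}"
  proof
    assume triv: "C u \<inter> conjg y ` C u = {\<one>}"
    have sub2: "conjg y ` C u \<subseteq> V" using C_subset V_conjg[OF y(1)] by blast
    have "inj_on (\<lambda>(c, d). c \<otimes> d) (C u \<times> conjg y ` C u)"
    proof (rule inj_onI, clarify)
      fix c d c' d' assume H: "c \<in> C u" "d \<in> C u" "c' \<in> C u" "d' \<in> C u" "c \<otimes> conjg y d = c' \<otimes> conjg y d'"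
      have cV: "c \<in> V" "d \<in> V" "c' \<in> V" "d' \<in> V" "conjg y d \<in> V" "conjg y d' \<in> V"
        using H C_subset V_conjg[OF y(1)] by blast+
      note cc = cV[THEN V_carrier]
      have "c' \<otimes> (c \<otimes> conjg y d) \<otimes> conjg y d = c' \<otimes> (c' \<otimes> conjg y d') \<otimes> conjg y d" using H(5) by simp
      moreover have "c' \<otimes> (c \<otimes> conjg y d) \<otimes> conjg y d = c' \<otimes> c" using cc sq[OF cV(5)] by (simp add: m_assoc)
      moreover have "c' \<otimes> (c' \<otimes> conjg y d') \<otimes> conjg y d = conjg y (d' \<otimes> d)"
        using cc sq[OF cV(3)] y by (simp add: m_assoc[symmetric] conjg_mult)
      ultimately have eq: "c' \<otimes> c = conjg y (d' \<otimes> d)" by simp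
      have "c' \<otimes> c \<in> C u" "d' \<otimes> d \<in> C u" using H subgroup.m_closed[OF C_subgroup[OF u(1)]] by auto
      then have "c' \<otimes> c \<in> C u \<inter> conjg y ` C u" using eq by auto
      then have one: "c' \<otimes> c = \<one>" using triv by blast
      then have "inv c = c'" using cc by (intro inv_equality) auto
      then have "c = c'" using inv_V cV by simp
      then show "c = c' \<and> conjg y d = conjg y d'" using H(5) cc by simp
    qed
    moreover have "(\<lambda>(c, d). c \<otimes> d) ` (C u \<times> conjg y ` C u) \<subseteq> V" using C_subset sub2 V_mult by fast
    ultimately have "card (C u \<times> conjg y ` C u) \<le> card V" using card_inj_on_le finite_V by blast
    then show False using C4 inj V8 by (simp add: card_cartesian_product card_image)
  qed
  moreover have "\<one> \<in> C u \<inter> conjg y ` C u"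
    using subgroup.one_closed[OF C_subgroup[OF u(1)]] imageI[of \<one> "C u" "conjg y"] y by simp
  ultimately obtain x where x: "x \<in> C u" "x \<in> C ?u'" "x \<noteq> \<one>"
    using img by blast
  have xc: "x \<in> V" "x \<in> carrier G" "u \<otimes> x = x \<otimes> u" "?u' \<otimes> x = x \<otimes> ?u'" using x V_carrier by (auto simp: C_def)
  let ?t = "y \<otimes> inv (conjg u y)"
  have Cx: "subgroup (centralizer {x}) G" using xc by (intro subgroup_centralizer) auto
  have "?u' \<otimes> inv u \<in> centralizer {x}"
    by (rule subgroup.m_closed[OF Cx _ subgroup.m_inv_closed[OF Cx]])
      (use xc u y in \<open>auto simp: centralizer_def\<close>)
  moreover have "?u' \<otimes> inv u = ?t" using u y by (simp add: conjg_def group_norm)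
  ultimately have tx: "x \<otimes> ?t = ?t \<otimes> x" by (simp add: centralizer_def)
  have tY: "?t \<in> cyc y"
    by (rule subgroup.m_closed[OF cyc_subgroup[OF y(1)] cyc_self subgroup.m_inv_closed[OF cyc_subgroup[OF y(1)] u(2)]])
  have "?t \<noteq> \<one>"
  proof
    assume "?t = \<one>"
    then have "inv (inv (conjg u y)) = y" using u y by (intro inv_equality) auto
    then show False using u y by simp
  qed
  then have "y \<in> cyc ?t" using prime_order_cyc_eq[OF y(1) _ tY] y cyc_self by simp
  then have "x \<otimes> y = y \<otimes> x" using commutes_cyc[OF xc(2) _ tx] cyc_closed[OF tY y(1)] by blast
  then show False using acts_freely[OF xc(1) y(1)] y x by simp
qed

lemma coset_sub_J: "\<lbrakk>a \<in> J; x \<in> V #> a\<rbrakk> \<Longrightarrow> x \<in> J"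
  using J_mult by (auto simp: r_coset_def)

lemma coset_eq: "\<lbrakk>a \<in> J; x \<in> V #> a\<rbrakk> \<Longrightarrow> V #> x = V #> a"
  using repr_independence[of x V a] V_subgroup J_carrier by simp

lemma card_coset: "a \<in> carrier G \<Longrightarrow> card (V #> a) = card V"
proof -
  assume a: "a \<in> carrier G"
  have "V #> a = (\<lambda>v. v \<otimes> a) ` V" by (auto simp: r_coset_def)
  moreover have "inj_on (\<lambda>v. v \<otimes> a) V" using V_carrier a by (auto simp: inj_on_def)
  ultimately show ?thesis by (simp add: card_image)
qed

lemma J_conjg: "\<lbrakk>g \<in> carrier G; a \<in> J\<rbrakk> \<Longrightarrow> conjg g a \<in> J"
proof -
  assume g: "g \<in> carrier G" and a: "a \<in> J"
  then have ac: "a \<in> carrier G" "a \<notin> V" "a \<otimes> a \<in> V" by (auto simp: J_def)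
  have "conjg g a \<otimes> conjg g a \<in> V" using V_conjg[OF g ac(3)] g ac by (simp add: conjg_mult)
  moreover have "conjg g a \<notin> V" using V_conjg[of "inv g" "conjg g a"] g ac by auto
  ultimately show ?thesis using g ac by (simp add: J_def)
qed

lemma no_square_le:
  assumes "a \<in> J" shows "card {x \<in> V #> a. x \<otimes> x = \<one>} \<le> 4"
proof -
  have ac: "a \<in> carrier G" "a \<otimes> a \<in> V" using assms by (auto simp: J_def)
  let ?b = "inv (a \<otimes> a)"
  have "{x \<in> V #> a. x \<otimes> x = \<one>} \<subseteq> (\<lambda>v. v \<otimes> a) ` {v \<in> V. norm a 2 v = ?b}"
  proof clarify
    fix x assume x: "x \<in> V #> a" "x \<otimes> x = \<one>"
    then obtain v where v: "v \<in> V" "x = v \<otimes> a" by (auto simp: r_coset_def)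
    have "norm a 2 v \<otimes> (a \<otimes> a) = \<one>" using x v square_eq[OF ac(1) v(1)] by simp
    then have "norm a 2 v = ?b" using ac V_carrier[OF norm_closed[OF ac(1) v(1)]] inv_equality by simp
    then show "x \<in> (\<lambda>v. v \<otimes> a) ` {v \<in> V. norm a 2 v = ?b}" using v by blast
  qed
  then have "card {x \<in> V #> a. x \<otimes> x = \<one>} \<le> card ((\<lambda>v. v \<otimes> a) ` {v \<in> V. norm a 2 v = ?b})"
    using finite_V by (intro card_mono) auto
  also have "\<dots> \<le> card {v \<in> V. norm a 2 v = ?b}" using finite_V by (intro card_image_le) auto
  also have "\<dots> \<le> 4" using norm_fibre_le[OF ac(1), of ?b] card_C[OF assms] by simp
  finally show ?thesis .
qed

text \<open>An element of order 5 fixes no coset of \<open>V\<close> in \<open>J\<close>, so that their number is a multiple of 5. Each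
  of them contains at least 12 square roots of the 15 involutions of \<open>V\<close>, which have at most
  \<open>4 * 15 = 60\<close> square roots; so there are exactly five cosets, each containing exactly 12 of these
  roots and 4 involutions. If \<open>a\<close> is chosen as one of the involutions, then every nontrivial element of
  \<open>C a\<close> has four square roots in \<open>V #> a\<close>; so a common element of two of the groups \<open>C a\<close> would have
  eight.\<close>

lemma card_16_order_5:
  assumes V16: "card V = 16" and five: "5 dvd order G" and J0: "J \<noteq> {}"
  defines "I \<equiv> (\<lambda>a. V #> a) ` J"
  shows "card I = 5" "\<And>i. i \<in> I \<Longrightarrow> \<exists>a\<in>i. a \<otimes> a = \<one>"
    "\<And>a b. \<lbrakk>a \<in> J; b \<in> J; V #> a \<noteq> V #> b\<rbrakk> \<Longrightarrow> C a \<inter> C b = {\<one>}"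
proof -
  have finJ: "finite J" by (rule finite_subset[OF _ fin]) (auto simp: J_def)
  then have finI: "finite I" by (simp add: I_def)
  have iJ: "i \<subseteq> J" if "i \<in> I" for i using that coset_sub_J by (auto simp: I_def)
  have ieq: "i = V #> x" if "i \<in> I" "x \<in> i" for i x using that coset_eq by (auto simp: I_def)
  have disj: "i \<inter> j = {}" if "i \<in> I" "j \<in> I" "i \<noteq> j" for i j
    using ieq[OF that(1)] ieq[OF that(2)] that(3) by blast
  obtain y where y: "y \<in> carrier G" "ord y = 5"
    using cauchy[OF subgroup_self, of 5] five by (auto simp: order_def)
  have conjI: "conjg g ` i \<in> I" if "i \<in> I" "g \<in> carrier G" for g i
    using that J_conjg J_carrier by (auto simp: I_def conjg_image_r_coset[OF V])
  have "card I mod 5 = card {i \<in> I. conjg y ` i = i} mod 5"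
  proof (rule card_fixed_points_prime_cycle[OF finI])
    show "((`) (conjg y) ^^ 5) i = i" if i: "i \<in> I" for i
    proof -
      have ic: "i \<subseteq> carrier G" using iJ[OF i] J_carrier by blast
      have "((`) (conjg y) ^^ n) i = (conjg y ^^ n) ` i" for n
        by (induction n) (auto simp: image_image)
      then have "((`) (conjg y) ^^ 5) i = (\<lambda>x. conjg (y [^] (5::nat)) x) ` i"
        using funpow_conjg[OF y(1)] ic by (auto intro!: image_cong)
      also have "\<dots> = (\<lambda>x. x) ` i" using pow_ord_eq_1[OF y(1)] y(2) ic by (intro image_cong) auto
      finally show ?thesis by simp
    qed
  qed (use conjI y in auto)
  moreover have "{i \<in> I. conjg y ` i = i} = {}"
  proof -
    have False if i: "i \<in> I" "conjg y ` i = i" for i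
    proof -
      obtain a where a: "a \<in> J" "i = V #> a" using i by (auto simp: I_def)
      have "conjg y a \<in> V #> a" using i(2) a rcos_self[OF J_carrier[OF a(1)] V_subgroup] by blast
      then show False using odd_normalizer_of_coset[OF a(1) y(1)] y(2) by simp
    qed
    then show ?thesis by blast
  qed
  ultimately have "5 dvd card I" by (simp add: mod_0_imp_dvd)
  moreover have "I \<noteq> {}" using J0 by (simp add: I_def)
  ultimately have ge: "5 \<le> card I" using finI by (intro dvd_imp_le) (auto simp: card_gt_0_iff)
  let ?R = "\<lambda>i. {x \<in> i. x \<otimes> x \<noteq> \<one>}"
  have ci: "card i = 16" "finite i" if "i \<in> I" for i
    using that card_coset J_carrier V16 card_ge_0_finite[of i] by (auto simp: I_def)
  have R12: "card (?R i) = 16 - card {x \<in> i. x \<otimes> x = \<one>}" "card {x \<in> i. x \<otimes> x = \<one>} \<le> 4" if "i \<in> I" for i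
  proof -
    have "?R i = i - {x \<in> i. x \<otimes> x = \<one>}" by auto
    then show "card (?R i) = 16 - card {x \<in> i. x \<otimes> x = \<one>}"
      using ci[OF that] card_Diff_subset[of "{x \<in> i. x \<otimes> x = \<one>}" i] by simp
    show "card {x \<in> i. x \<otimes> x = \<one>} \<le> 4" using that no_square_le by (auto simp: I_def)
  qed
  have sum_le: "(\<Sum>i\<in>I. card (?R i)) \<le> 60"
  proof -
    have "(\<Sum>i\<in>I. card (?R i)) = card (\<Union>i\<in>I. ?R i)"
    proof (intro card_UN_disjoint[symmetric])
      show "\<forall>i\<in>I. \<forall>j\<in>I. i \<noteq> j \<longrightarrow> ?R i \<inter> ?R j = {}" using disj by blast
    qed (use finI ci in auto)
    also have "\<dots> \<le> card (\<Union>z\<in>V - {\<one>}. {x \<in> carrier G. x \<otimes> x = z})"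
    proof (rule card_mono)
      show "finite (\<Union>z\<in>V - {\<one>}. {x \<in> carrier G. x \<otimes> x = z})" using finite_V by simp
      show "(\<Union>i\<in>I. ?R i) \<subseteq> (\<Union>z\<in>V - {\<one>}. {x \<in> carrier G. x \<otimes> x = z})"
        using iJ by (auto simp: J_def)
    qed
    also have "\<dots> \<le> (\<Sum>z\<in>V - {\<one>}. card {x \<in> carrier G. x \<otimes> x = z})"
      using finite_V by (intro card_UN_le) simp
    also have "\<dots> \<le> (\<Sum>z\<in>V - {\<one>}. 4)" using card_roots_two by (intro sum_mono) auto
    also have "\<dots> = 60"
      using V16 subgroup.one_closed[OF V_subgroup] by (simp add: card_Diff_singleton)
    finally show ?thesis .
  qed
  have "(\<Sum>i\<in>I. 12) \<le> (\<Sum>i\<in>I. card (?R i))"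
  proof (rule sum_mono)
    fix i assume "i \<in> I" then show "12 \<le> card (?R i)" using R12[of i] by linarith
  qed
  then have "12 * card I \<le> 60" using sum_le by (simp add: mult.commute)
  then show I5: "card I = 5" using ge by simp
  have R_eq: "card (?R i) = 12" if i: "i \<in> I" for i
  proof -
    have "(\<Sum>j\<in>I. card (?R j)) = card (?R i) + (\<Sum>j\<in>I - {i}. card (?R j))"
      using finI i by (rule sum.remove)
    moreover have "(\<Sum>j\<in>I - {i}. 12) \<le> (\<Sum>j\<in>I - {i}. card (?R j))"
    proof (rule sum_mono)
      fix j assume "j \<in> I - {i}" then show "12 \<le> card (?R j)" using R12[of j] by auto
    qed
    then have "48 \<le> (\<Sum>j\<in>I - {i}. card (?R j))" using I5 i finI by (simp add: card_Diff_singleton)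
    ultimately show ?thesis using sum_le R12[OF i] by linarith
  qed
  show inv_ex: "\<exists>a\<in>i. a \<otimes> a = \<one>" if i: "i \<in> I" for i
  proof (rule ccontr)
    assume "\<not> ?thesis"
    then have empty: "{x \<in> i. x \<otimes> x = \<one>} = {}" by blast
    have "card {x \<in> i. x \<otimes> x = \<one>} = 0" unfolding empty by simp
    then show False using R12(1)[OF i] R_eq[OF i] by linarith
  qed
  fix a b assume ab: "a \<in> J" "b \<in> J" "V #> a \<noteq> V #> b"
  have roots4: "4 \<le> card {x \<in> V #> a. x \<otimes> x = z}" if a: "a \<in> J" and z: "z \<in> C a" for a z
  proof -
    have "V #> a \<in> I" using a by (simp add: I_def)
    then obtain t where t: "t \<in> V #> a" "t \<otimes> t = \<one>" using inv_ex by blast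
    have tJ: "t \<in> J" "V #> t = V #> a" using coset_sub_J[OF a t(1)] coset_eq[OF a t(1)] by simp_all
    then have tc: "t \<in> carrier G" using J_carrier by blast
    obtain v where "v \<in> V" "t = v \<otimes> a" using t by (auto simp: r_coset_def)
    then have Ct: "C t = C a" using C_mult[OF J_carrier[OF a]] by simp
    have "card (norm t 2 ` V) \<ge> 4"
      using card_V_le_C(1)[OF tJ(1)] card_C[OF tJ(1)] V16 by simp
    then have "norm t 2 ` V = C t"
      using norm_in_C[OF tJ(1)] card_C[OF tJ(1)] by (intro card_seteq[OF finite_C]) auto
    then have "z \<in> norm t 2 ` V" using z Ct by simp
    then obtain v where v: "v \<in> V" "norm t 2 v = z" by blast
    have "card (C t) \<le> card {x \<in> V #> a. x \<otimes> x = z}"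
    proof (rule card_inj_on_le[where f = "\<lambda>c. (c \<otimes> v) \<otimes> t"])
      show "inj_on (\<lambda>c. (c \<otimes> v) \<otimes> t) (C t)" using V_carrier v tc by (auto simp: inj_on_def C_def)
      have "(c \<otimes> v \<otimes> t) \<otimes> (c \<otimes> v \<otimes> t) = z \<and> c \<otimes> v \<otimes> t \<in> V #> a" if "c \<in> C t" for c
      proof -
        have c: "c \<in> V" "norm t 2 c = \<one>" using that norm_eq_one_iff tc C_subset by blast+
        have "c \<otimes> v \<in> V" using V_mult c v by blast
        then have "c \<otimes> v \<otimes> t \<in> V #> t" by (auto simp: r_coset_def)
        then show ?thesis
          using square_eq[OF tc V_mult[OF c(1) v(1)]] norm_mult[OF tc c(1) v(1), of 2] c(2) v t(2) tJ(2)
            V_carrier[OF norm_closed[OF tc v(1), of 2]] by simp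
      qed
      then show "(\<lambda>c. c \<otimes> v \<otimes> t) ` C t \<subseteq> {x \<in> V #> a. x \<otimes> x = z}" by blast
      show "finite {x \<in> V #> a. x \<otimes> x = z}" using ci[OF \<open>V #> a \<in> I\<close>] by simp
    qed
    then show ?thesis using card_C[OF tJ(1)] by simp
  qed
  have "z = \<one>" if z: "z \<in> C a" "z \<in> C b" for z
  proof (rule ccontr)
    assume z1: "z \<noteq> \<one>"
    have IJ: "V #> a \<in> I" "V #> b \<in> I" using ab by (auto simp: I_def)
    have "card ({x \<in> V #> a. x \<otimes> x = z} \<union> {x \<in> V #> b. x \<otimes> x = z})
        = card {x \<in> V #> a. x \<otimes> x = z} + card {x \<in> V #> b. x \<otimes> x = z}"
      using ci IJ disj[OF IJ ab(3)] by (intro card_Un_disjoint) auto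
    moreover have "card ({x \<in> V #> a. x \<otimes> x = z} \<union> {x \<in> V #> b. x \<otimes> x = z}) \<le> card {x \<in> carrier G. x \<otimes> x = z}"
      using iJ IJ J_carrier by (intro card_mono) auto
    moreover have "card {x \<in> carrier G. x \<otimes> x = z} \<le> 4" using card_roots_two[of z] z z1 C_subset by blast
    ultimately show False using roots4[OF ab(1) z(1)] roots4[OF ab(2) z(2)] by linarith
  qed
  then show "C a \<inter> C b = {\<one>}"
    using subgroup.one_closed[OF C_subgroup[OF J_carrier[OF ab(1)]]] subgroup.one_closed[OF C_subgroup[OF J_carrier[OF ab(2)]]]
    by blast
qed

text \<open>Otherwise a power \<open>h\<close> of \<open>g\<close> has prime order \<open>r\<close> modulo \<open>V\<close>. If \<open>r = 2\<close>, let \<open>V #> c\<close> be one of the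
  two cosets that does not contain \<open>h\<close>; then \<open>h\<close> fixes a nontrivial element of \<open>C c\<close>, which also lies in
  \<open>C h\<close>. If \<open>r\<close> is odd, then \<open>r = 3\<close>, and an element of order 3 centralizes an involution in each of the
  two cosets. But there is at most one involution in its centralizer.\<close>

lemma two_coset_stabilizer:
  assumes V16: "card V = 16" and five: "5 dvd order G"
    and a: "a \<in> J" and b: "b \<in> J" and ne: "V #> a \<noteq> V #> b"
    and g: "g \<in> carrier G" "conjg g ` (V #> a) = V #> a" "conjg g ` (V #> b) = V #> b"
  shows "g \<in> V"
proof (rule ccontr)
  assume gV: "g \<notin> V"
  have J0: "J \<noteq> {}" using a by blast
  note meet = card_16_order_5(3)[OF V16 five J0]
  obtain r n :: nat where r: "prime r" "g [^] n \<notin> V" "(g [^] n) [^] r \<in> V" using prime_order_mod_subgroup[OF V_subgroup g(1) gV] .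
  define h where "h = g [^] n"
  have h: "h \<in> carrier G" "h \<notin> V" "h [^] r \<in> V" using r g by (auto simp: h_def)
  have stab: "conjg (g [^] m) ` (V #> c) = V #> c" if c: "c \<in> J" and "conjg g ` (V #> c) = V #> c" for c and m :: nat
  proof (induction m)
    case 0
    have "V #> c \<subseteq> carrier G" using coset_sub_J[OF c] J_carrier by blast
    then have "conjg \<one> ` (V #> c) = (\<lambda>x. x) ` (V #> c)" by (intro image_cong) auto
    then show ?case by simp
  next
    case (Suc m)
    have sub: "V #> c \<subseteq> carrier G" using coset_sub_J[OF c] J_carrier by blast
    have "conjg (g [^] Suc m) ` (V #> c) = (\<lambda>x. conjg (g [^] m) (conjg g x)) ` (V #> c)"
      using g(1) sub by (intro image_cong) (auto simp: conjg_conjg)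
    also have "\<dots> = conjg (g [^] m) ` (conjg g ` (V #> c))" by (simp add: image_image)
    finally show ?case using Suc that by simp
  qed
  have act: "conjg (g [^] m) c \<in> V #> c" if "c = a \<or> c = b" for c and m :: nat
  proof -
    have c: "c \<in> J" "conjg g ` (V #> c) = V #> c" using that a b g by auto
    show ?thesis using stab[OF c, of m] rcos_self[OF J_carrier[OF c(1)] V_subgroup] by blast
  qed
  show False
  proof (cases "r = 2")
    case True
    then have hJ: "h \<in> J" using h by (simp add: J_def numeral_2_eq_2)
    obtain c where c: "c = a \<or> c = b" "V #> c \<noteq> V #> h" using ne by metis
    have cJ: "c \<in> J" using c a b by blast
    have Cc: "x \<in> carrier G" "x \<in> V" if "x \<in> C c" for x using that C_subset V_carrier by blast+
    have "card (C c) mod 2 = card {x \<in> C c. conjg h x = x} mod 2"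
    proof (rule card_fixed_points_prime_cycle[OF finite_C two_is_prime_nat])
      show "conjg h x \<in> C c" if "x \<in> C c" for x
        using coset_fixed_action[OF cJ h(1) _ that] act[OF c(1), of n] by (simp add: h_def)
      show "(conjg h ^^ 2) x = x" if "x \<in> C c" for x
        using funpow_conjg[OF h(1) Cc(1)[OF that], of 2] h True Cc[OF that] V_comm[OF _ Cc(2)[OF that], of "h [^] (2::nat)"]
        by (simp add: conjg_eq_self_iff)
    qed
    then have even: "2 dvd card {x \<in> C c. conjg h x = x}" using card_C[OF cJ] by (simp add: dvd_eq_mod_eq_0)
    have "{x \<in> C c. conjg h x = x} \<subseteq> C c \<inter> C h"
    proof
      fix x assume x: "x \<in> {x \<in> C c. conjg h x = x}"
      then have "h \<otimes> x = x \<otimes> h" using conjg_eq_self_iff[OF h(1) Cc(1)] by blast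
      then show "x \<in> C c \<inter> C h" using x by (simp add: C_def)
    qed
    then have "{x \<in> C c. conjg h x = x} \<subseteq> {\<one>}" using meet[OF cJ hJ c(2)] by simp
    moreover have "\<one> \<in> {x \<in> C c. conjg h x = x}" using subgroup.one_closed[OF C_subgroup[OF J_carrier[OF cJ]]] h by simp
    ultimately have "{x \<in> C c. conjg h x = x} = {\<one>}" by blast
    then show False using even by simp
  next
    case False
    define d where "d = h [^] (2::nat)"
    have d: "d \<in> carrier G" using h by (simp add: d_def)
    have odd: "odd r" using r(1) False prime_odd_nat prime_ge_2_nat[OF r(1)] by fastforce
    have dV: "d \<notin> V"
    proof
      assume dV: "d \<in> V"
      obtain m where m: "r = 2 * m + 1" using odd by (auto elim: oddE)
      have "h [^] r = d [^] m \<otimes> h" using h m by (simp add: d_def nat_pow_pow)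
      then have "h = inv (d [^] m) \<otimes> h [^] r" using h d by simp
      moreover have "inv (d [^] m) \<otimes> h [^] r \<in> V"
        by (rule V_mult[OF subgroup.m_inv_closed[OF V_subgroup subgroup_nat_pow_closed[OF V_subgroup dV]] h(3)])
      ultimately show False using h by simp
    qed
    have "d [^] r = (h [^] r) [^] (2::nat)" using h by (simp add: d_def nat_pow_pow mult.commute)
    then have "d [^] r = \<one>" using exponent[OF h(3)] by simp
    moreover have d1: "d \<noteq> \<one>" using dV subgroup.one_closed[OF V_subgroup] by auto
    ultimately have dr: "ord d = r" using d r(1) pow_eq_id[OF d] ord_eq_1[OF d] prime_nat_iff by blast
    have dg: "d = g [^] (n * 2)" using g by (simp add: d_def h_def nat_pow_pow)
    have r3: "r = 3"
      using odd_normalizer_of_coset[OF a d] dr r(1) False act[of a "n * 2"] dg by simp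
    have inv: "\<exists>x\<in>V #> c. d \<otimes> x = x \<otimes> d \<and> x \<in> carrier G \<and> ord x = 2" if c: "c = a \<or> c = b" for c
    proof -
      have cJ: "c \<in> J" using c a b by blast
      have sub: "V #> c \<subseteq> carrier G" using coset_sub_J[OF cJ] J_carrier by blast
      have fixc: "conjg d ` (V #> c) = V #> c" using stab[OF cJ] g c dg by auto
      have "card (V #> c) mod 3 = card {x \<in> V #> c. conjg d x = x} mod 3"
      proof (rule card_fixed_points_prime_cycle)
        show "finite (V #> c)" using sub finite_subset fin by blast
        show "(conjg d ^^ 3) x = x" if "x \<in> V #> c" for x
          using funpow_conjg[OF d, of x 3] pow_ord_eq_1[OF d] dr r3 sub that by auto
      qed (use fixc in auto)
      then have "card {x \<in> V #> c. conjg d x = x} \<noteq> 0" using card_coset[OF J_carrier[OF cJ]] V16 by auto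
      then obtain x where x: "x \<in> V #> c" "conjg d x = x"
        by (metis (mono_tags, lifting) card.empty empty_Collect_eq)
      have xJ: "x \<in> J" using coset_sub_J[OF cJ x(1)] .
      then have xc: "x \<in> carrier G" "x \<otimes> x \<in> V" "x \<notin> V" by (auto simp: J_def)
      have dx: "d \<otimes> x = x \<otimes> d" using x conjg_eq_self_iff[OF d xc(1)] by blast
      then have "d \<otimes> (x \<otimes> x) = (x \<otimes> x) \<otimes> d" using d xc by (metis m_assoc)
      then have "x \<otimes> x = \<one>" using acts_freely[OF xc(2) d] dr r3 by simp
      then have "x [^] (2::nat) = \<one>" using xc by (simp add: numeral_2_eq_2)
      moreover have "x \<noteq> \<one>" using xc subgroup.one_closed[OF V_subgroup] by auto
      ultimately have "ord x = 2" using pow_eq_id[OF xc(1), of 2] ord_eq_1[OF xc(1)] two_is_prime_nat prime_nat_iff by blast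
      then show ?thesis using x dx xc by blast
    qed
    obtain x where x: "x \<in> V #> a" "d \<otimes> x = x \<otimes> d" "x \<in> carrier G" "ord x = 2" using inv[of a] by blast
    obtain z where z: "z \<in> V #> b" "d \<otimes> z = z \<otimes> d" "z \<in> carrier G" "ord z = 2" using inv[of b] by blast
    have "cyc x = cyc z"
      using prime_order_centralizer_unique[OF d refl, of x z] dr r3 x z by simp
    then have "z \<in> cyc x" using cyc_self by blast
    then obtain k :: nat where k: "z = x [^] k" using cyc_iff[OF x(3)] by blast
    have "z \<noteq> \<one>" using z by auto
    then have "\<not> 2 dvd k" using k pow_eq_id[OF x(3)] x(4) by simp
    then obtain m where "k = 2 * m + 1" by (auto elim: oddE)
    then have "z = (x [^] (2::nat)) [^] m \<otimes> x" using k x(3) by (simp add: nat_pow_pow)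
    then have "z = x" using pow_ord_eq_1[OF x(3)] x by simp
    then show False using coset_eq[OF a x(1)] coset_eq[OF b z(1)] ne by simp
  qed
qed

text \<open>\<open>G\<close> permutes the five cosets of \<open>V\<close> in \<open>J\<close>, and the stabilizer of one of them acts on the other
  four with point stabilizers in \<open>V\<close>. So \<open>G/V\<close> has order at most 20.\<close>

lemma solvable_if_card_16_order_5:
  assumes V16: "card V = 16" and five: "5 dvd order G" and J0: "J \<noteq> {}"
  shows "solvable G"
proof -
  define I where "I = (\<lambda>a. V #> a) ` J"
  have I5: "card I = 5" using card_16_order_5(1)[OF V16 five J0] by (simp add: I_def)
  obtain a where a: "a \<in> J" using J0 by blast
  let ?i = "V #> a"
  have iI: "?i \<in> I" using a by (simp add: I_def)
  have Ic: "i \<subseteq> carrier G" if "i \<in> I" for i using that coset_sub_J J_carrier by (auto simp: I_def)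
  have conjI: "conjg g ` i \<in> I" if "i \<in> I" "g \<in> carrier G" for g i
    using that J_conjg J_carrier by (auto simp: I_def conjg_image_r_coset[OF V])
  have act: "set_action G (carrier G) I (\<lambda>g C. conjg g ` C)"
    using Ic conjI subgroup_self by (intro set_action_conjg_image) auto
  let ?H = "{g \<in> carrier G. conjg g ` ?i = ?i}"
  have H: "subgroup ?H G" by (rule set_action.subgroup_stabilizer[OF act iI])
  have 1: "card (carrier G) \<le> 5 * card ?H" using card_orbit_le[OF act iI] I5 by simp
  have "card (I - {?i}) = 4" using I5 iI by simp
  then have "I - {?i} \<noteq> {}" by (metis card.empty zero_neq_numeral)
  then obtain b where b: "b \<in> J" "V #> b \<noteq> ?i" by (auto simp: I_def)
  have "set_action G ?H (I - {?i}) (\<lambda>g C. conjg g ` C)"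
  proof (rule set_action_conjg_image[OF H])
    fix g C assume g: "g \<in> ?H" and C: "C \<in> I - {?i}"
    have "conjg g ` C \<noteq> ?i"
    proof
      assume "conjg g ` C = ?i"
      then have eq: "conjg g ` C = conjg g ` ?i" using g by simp
      have "inj_on (conjg g) (carrier G)" using g by (auto simp: inj_on_def)
      then have "C = ?i" using eq inj_on_image_eq_iff Ic C iI by blast
      then show False using C by simp
    qed
    then show "conjg g ` C \<in> I - {?i}" using conjI C g by auto
  qed (use Ic in auto)
  then have 2: "card ?H \<le> 4 * card {g \<in> ?H. conjg g ` (V #> b) = V #> b}"
    using card_orbit_le[of ?H "I - {?i}" "\<lambda>g C. conjg g ` C" "V #> b"] b \<open>card (I - {?i}) = 4\<close>
    by (simp add: I_def)
  have "{g \<in> ?H. conjg g ` (V #> b) = V #> b} \<subseteq> V"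
    using two_coset_stabilizer[OF V16 five a b(1) b(2)[symmetric]] by blast
  from card_mono[OF finite_V this] have "card {g \<in> ?H. conjg g ` (V #> b) = V #> b} \<le> 16" using V16 by simp
  then have le: "order G \<le> 20 * 16" using 1 2 by (simp add: order_def)
  have ord: "order (G Mod V) * 16 = order G" using order_quotient[OF V] V16 by simp
  then have le20: "order (G Mod V) \<le> 20" using le by linarith
  have "5 dvd order (G Mod V) * 16" using ord five by simp
  then have "5 dvd order (G Mod V)"
    using prime_dvd_mult_iff[of "5::nat" "order (G Mod V)" 16] by simp
  then have "solvable (G Mod V)"
    using small_group_solvable[OF finite_group_quotient[OF V], of 5] le20 by simp
  then show ?thesis
    using solvable_of_normal_quotient[OF V solvable_of_abelian[OF V_subgroup V_comm]] by blast
qed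

text \<open>Here no primes other than 2 and 3 divide \<open>|G|\<close>, and 9 is no divisor, because a subgroup of order 9
  would act freely on the 15 involutions of \<open>V\<close>. So an orbit of odd size on these involutions has three
  elements, unless it has only one, which \<open>y\<close> prevents. Its pointwise stabilizer is a 2-group.\<close>

lemma solvable_if_card_16_not_order_5:
  assumes V16: "card V = 16" and five: "\<not> 5 dvd order G" and y: "y \<in> carrier G" "prime (ord y)" "ord y \<noteq> 2"
  shows "solvable G"
proof -
  let ?X = "V - {\<one>}"
  interpret A: set_action G "carrier G" ?X conjg
    using V_carrier V_conjg subgroup_self by (intro set_action_conjg) auto
  have X15: "card ?X = 15"
    using V16 subgroup.one_closed[OF V_subgroup] by (simp add: card_Diff_singleton)
  have "\<exists>B\<in>A.orbs. odd (card B)"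
  proof (rule ccontr)
    assume "\<not> ?thesis"
    then have "even (\<Sum>B\<in>A.orbs. card B)" by (intro dvd_sum) auto
    then show False using A.card_eq_sum_orbs X15 by simp
  qed
  then obtain z where z: "z \<in> ?X" "odd (card ((\<lambda>g. conjg g z) ` carrier G))"
    unfolding A.orbs_def by blast
  let ?B = "(\<lambda>g. conjg g z) ` carrier G"
  have zc: "z \<in> carrier G" using z V_carrier by blast
  have BX: "?B \<subseteq> ?X" using A.act_closed z by auto
  have Bdvd: "card ?B dvd order G"
    using A.orbit_stabilizer[OF z(1)] by (metis dvd_triv_left order_def)
  have B15: "card ?B \<le> 15" using card_mono[OF A.finite_X BX] X15 by simp
  have nine: "\<not> 9 dvd order G"
  proof
    assume "9 dvd order G"
    then obtain m where "order G = 3 ^ 2 * m" by (auto elim: dvdE)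
    then obtain P where P: "subgroup P G" "card P = 3 ^ 2"
      using sylow_thm[of 3 G 2 m] group_axioms fin by auto
    then have "card P dvd card V - 1" by (intro card_dvd_if_p'_subgroup) auto
    then show False using P V16 by simp
  qed
  have odd_primes: "r dvd 15" if "prime r" "r dvd order G" "r \<noteq> 2" for r
    using prime_dvd_card_V[OF that] V16 by simp
  have B1: "card ?B \<noteq> 1"
  proof
    assume "card ?B = 1"
    then obtain b where b: "?B = {b}" by (rule card_1_singletonE)
    have "z \<in> ?B" using zc by (force intro: image_eqI[of _ _ \<one>])
    moreover have "conjg y z \<in> ?B" using imageI[OF y(1), of "\<lambda>g. conjg g z"] .
    ultimately have "conjg y z = z" unfolding b by simp
    then show False using acts_freely[OF _ y] z zc y conjg_eq_self_iff[OF y(1) zc] by auto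
  qed
  have "card ?B = 3"
  proof -
    have nd: "\<not> card ?B = 5" "\<not> card ?B = 15" "\<not> card ?B = 9"
      using Bdvd five nine dvd_trans[of 5 15 "order G"] by auto
    have "\<not> card ?B = 7" using odd_primes[of 7] Bdvd by auto
    moreover have "\<not> card ?B = 11" using odd_primes[of 11] Bdvd by auto
    moreover have "\<not> card ?B = 13" using odd_primes[of 13] Bdvd by auto
    moreover have "n = 3" if "n \<le> 15" "odd n" "n \<noteq> 1" "n \<noteq> 5" "n \<noteq> 7" "n \<noteq> 9" "n \<noteq> 11" "n \<noteq> 13" "n \<noteq> 15"
      for n :: nat
      using that by presburger
    ultimately show ?thesis using nd z(2) B1 B15 by blast
  qed
  show ?thesis
  proof (rule solvable_if_conjg_invariant_triple[of ?B])
    show "?B \<subseteq> carrier G" using zc by auto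
    show "card ?B = 3" by fact
    show "conjg g x \<in> ?B" if "g \<in> carrier G" "x \<in> ?B" for g x
      using that zc by (auto simp: conjg_conjg)
    obtain k where k: "card (centralizer {z}) = 2 ^ k" using centralizer_p_group[of z] z by blast
    have zB: "z \<in> ?B" using zc by (force intro: image_eqI[of _ _ \<one>])
    then have "centralizer ?B \<subseteq> centralizer {z}" by (auto simp: centralizer_def)
    moreover have "subgroup (centralizer ?B) G" using zc by (intro subgroup_centralizer) auto
    moreover have Sz: "subgroup (centralizer {z}) G" using zc by (intro subgroup_centralizer) auto
    ultimately show "solvable (G\<lparr>carrier := centralizer ?B\<rparr>)"
      using solvable_subgroup_mono p_subgroup_solvable[OF finite_group_axioms Sz p k] by blast
  qed
qed

text \<open>Some power of \<open>u\<close> maps to an involution of \<open>G/V\<close>, and so \<open>|V|\<close> is 8 or 16.\<close>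

lemma solvable_if_inversion:
  assumes y: "y \<in> carrier G" "ord y = q" "prime q" "q \<noteq> 2"
    and u: "u \<in> carrier G" "conjg u y \<in> cyc y" "conjg u y \<noteq> y" "u [^] (2::nat) \<otimes> y = y \<otimes> u [^] (2::nat)" "ord u = 2 ^ k"
  shows "solvable G"
proof -
  have "u \<notin> V" by (rule not_in_V_if_acting[OF y(1) _ _ u(1-3)]) (use y in simp_all)
  then obtain r n :: nat where r: "prime r" "r dvd ord u" "u [^] n \<notin> V" "(u [^] n) [^] r \<in> V"
    using prime_order_mod_subgroup[OF V_subgroup u(1)] by blast
  have "r dvd 2" using r u(5) prime_dvd_power[of r 2 k] by simp
  then have "r = 2" using r(1) primes_dvd_imp_eq two_is_prime_nat by blast
  then have J: "u [^] n \<in> J" using r u by (simp add: J_def numeral_2_eq_2)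
  then have J0: "J \<noteq> {}" by blast
  consider "card V = 8" | "card V = 16" "5 dvd order G" | "card V = 16" "\<not> 5 dvd order G"
    using card_V_cases[OF J] by blast
  then show ?thesis
  proof cases
    case 1
    then show ?thesis using no_inversion_if_card_8[OF _ y u] by blast
  next
    case 2
    then show ?thesis using solvable_if_card_16_order_5 J0 by blast
  next
    case 3
    then show ?thesis using solvable_if_card_16_not_order_5[OF _ _ y(1)] y by simp
  qed
qed

end

section \<open>Groups with a nontrivial abelian normal subgroup\<close>

context claw_free_with_normal
begin

lemma restrict_to_subgroup:
  assumes K: "subgroup K G" "V \<subseteq> K"
  shows "claw_free_with_normal (G\<lparr>carrier := K\<rparr>) V p"
proof -
  have "v [^]\<^bsub>G\<lparr>carrier := K\<rparr>\<^esub> n = v [^] n" for v and n :: nat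
    using nat_pow_consistent by metis
  then show ?thesis
    using claw_free_subgroup[OF K(1)] finite_group_subgroup[OF K(1)] normal_restrict_supergroup[OF K(1) V K(2)]
      V_comm p exponent card_gt
    by (intro claw_free_with_normal.intro abelian_normal.intro abelian_normal_axioms.intro
        claw_free_with_normal_axioms.intro) auto
qed

text \<open>Let \<open>q\<close> be the least prime divisor of \<open>|G|\<close> other than \<open>p\<close>. If every subgroup of order \<open>q\<close> is
  centralized by its normalizer, then transfer yields an abelian quotient with kernel containing \<open>V\<close>;
  otherwise some \<open>p\<close>-element acts on such a subgroup.\<close>

lemma solvable_by_least_prime:
  assumes IH: "\<And>K. \<lbrakk>K \<lhd> G; V \<subseteq> K; K \<noteq> carrier G\<rbrakk> \<Longrightarrow> solvable (G\<lparr>carrier := K\<rparr>)"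
    and fused: "\<And>q y u k. \<lbrakk>prime q; q \<noteq> p; y \<in> carrier G; ord y = q; u \<in> carrier G; conjg u y \<in> cyc y;
      conjg u y \<noteq> y; u [^] p \<otimes> y = y \<otimes> u [^] p; ord u = p ^ k\<rbrakk> \<Longrightarrow> solvable G"
  shows "solvable G"
proof (cases "\<exists>q. prime q \<and> q dvd order G \<and> q \<noteq> p")
  case False
  have "\<exists>k. card (carrier G) = p ^ k"
  proof (rule prime_power_card[OF subgroup_self p])
    fix x r assume "x \<in> carrier G" "prime r" "ord x = r"
    then show "r = p" using False ord_dvd_group_order[of x] by blast
  qed
  then show ?thesis using p_group_solvable[OF p] by (auto simp: order_def)
next
  case True
  define q where "q = (LEAST q. prime q \<and> q dvd order G \<and> q \<noteq> p)"
  have q: "prime q" "q dvd order G" "q \<noteq> p"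
    using LeastI_ex[OF True] by (simp_all add: q_def)
  have least: "r = p" if "prime r" "r dvd order G" "r < q" for r
    using not_less_Least[of r "\<lambda>q. prime q \<and> q dvd order G \<and> q \<noteq> p"] that by (auto simp: q_def)
  show ?thesis
  proof (cases "\<forall>g\<in>carrier G. \<forall>y\<in>carrier G. ord y = q \<longrightarrow> conjg g y \<in> cyc y \<longrightarrow> conjg g y = y")
    case True
    obtain K where K: "K \<lhd> G" "V \<subseteq> K" "K \<noteq> carrier G"
      "\<forall>a\<in>carrier G. \<forall>b\<in>carrier G. a \<otimes> b \<otimes> inv a \<otimes> inv b \<in> K"
      by (rule abelian_quotient_if_no_fusion[OF q(1,3,2)]) (use True in auto)
    have "solvable (G\<lparr>carrier := carrier G\<rparr>)"
      using solvable_of_commutators[OF normal_imp_subgroup[OF K(1)] subgroup_self _ IH[OF K(1-3)]] K(4) by blast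
    then show ?thesis by simp
  next
    case False
    then obtain g y where y: "y \<in> carrier G" "ord y = q" and g: "g \<in> carrier G" "conjg g y \<in> cyc y" "conjg g y \<noteq> y"
      by blast
    obtain u k where "u \<in> carrier G" "conjg u y \<in> cyc y" "conjg u y \<noteq> y" "u [^] p \<otimes> y = y \<otimes> u [^] p" "ord u = p ^ k"
      by (rule p_element_acting_on_prime_cyclic[OF y q(1) g least])
    then show ?thesis using fused[OF q(1,3) y] by blast
  qed
qed

text \<open>For \<open>p = 2\<close> and \<open>|V| \<ge> 8\<close>, elements of the centralizer of \<open>V\<close> have square 1: if \<open>x\<^sup>2 = s \<noteq> 1\<close>,
  then \<open>(xv)\<^sup>2 = s\<close> for all \<open>v \<in> V\<close>. Hence this centralizer may take the place of \<open>V\<close>.\<close>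

lemma self_centralizing_two_centralizer:
  assumes p2: "p = 2" and V8: "card V \<ge> 8"
  shows "self_centralizing_two G (centralizer V)"
proof -
  let ?P = "centralizer V"
  have VC: "V \<subseteq> carrier G" using V_carrier by blast
  have P: "subgroup ?P G" by (rule subgroup_centralizer[OF VC])
  have VP: "V \<subseteq> ?P" using V_comm V_carrier by (auto simp: centralizer_def)
  have sq: "x \<otimes> x = \<one>" if x: "x \<in> ?P" for x
  proof (rule ccontr)
    assume n: "x \<otimes> x \<noteq> \<one>"
    have xc: "x \<in> carrier G" using x by (simp add: centralizer_def)
    let ?s = "x [^] (2::nat)"
    have s: "?s \<noteq> \<one>" "?s \<in> carrier G" using n xc by (simp_all add: numeral_2_eq_2)
    obtain k where k: "card ?P = 2 ^ k" using centralizer_V_p_group p2 by blast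
    have "?s \<in> ?P" by (rule subgroup_nat_pow_closed[OF P x])
    then have "ord ?s dvd 2 ^ k" using ord_dvd_subgroup[OF P] k by metis
    then obtain j where j: "ord ?s = 2 ^ j" using divides_primepow_nat[OF two_is_prime_nat] by blast
    have "j \<noteq> 0" using j s ord_eq_1[OF s(2)] by auto
    then have two: "2 dvd ord ?s" using j by simp
    have "card V \<le> card {x \<in> carrier G. x [^] (2::nat) = ?s}"
    proof (rule card_inj_on_le[where f = "\<lambda>v. x \<otimes> v"])
      show "inj_on (\<lambda>v. x \<otimes> v) V" using V_carrier xc by (auto simp: inj_on_def)
      have "(x \<otimes> v) [^] (2::nat) = ?s" if v: "v \<in> V" for v
        using pow_mult_distrib[of x v 2] x v V_carrier[OF v] xc exponent[OF v] p2 by (simp add: centralizer_def)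
      then show "(\<lambda>v. x \<otimes> v) ` V \<subseteq> {x \<in> carrier G. x [^] (2::nat) = ?s}" using V_carrier xc by blast
    qed simp
    also have "\<dots> \<le> 4" using card_roots_le[OF s(2) two_is_prime_nat two] by simp
    finally show False using V8 by simp
  qed
  have Pc: "x \<in> carrier G" if "x \<in> ?P" for x using subgroup.mem_carrier[OF P that] .
  have abel: "x \<otimes> y = y \<otimes> x" if xy: "x \<in> ?P" "y \<in> ?P" for x y
  proof -
    have "(x \<otimes> y) \<otimes> (x \<otimes> y) = \<one>" using sq subgroup.m_closed[OF P xy] by blast
    then have "inv (x \<otimes> y) = x \<otimes> y" using Pc xy by (intro inv_equality) auto
    moreover have "inv x = x" "inv y = y" using sq xy Pc by (auto intro: inv_equality)
    ultimately show ?thesis using inv_mult_group[OF Pc[OF xy(1)] Pc[OF xy(2)]] by simp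
  qed
  have N: "?P \<lhd> G" by (rule centralizer_normal[OF VC]) (use V_conjg in auto)
  have card: "card ?P \<ge> 8" using V8 card_mono[OF finite_subgroup[OF P] VP] by simp
  have "v [^] (2::nat) = \<one>" if "v \<in> ?P" for v using sq[OF that] Pc[OF that] by (simp add: numeral_2_eq_2)
  moreover have "centralizer ?P \<subseteq> ?P" using VP by (auto simp: centralizer_def)
  ultimately show ?thesis
    using N abel card two_is_prime_nat
    by (intro self_centralizing_two.intro claw_free_with_normal.intro abelian_normal.intro
        abelian_normal_axioms.intro claw_free_with_normal_axioms.intro self_centralizing_two_axioms.intro
        claw_free_group_axioms finite_group_axioms) auto
qed

end

theorem claw_free_with_normal_solvable:
  assumes "claw_free_with_normal G V p" shows "solvable G"
  using assms
proof (induction "order G" arbitrary: G V rule: less_induct)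
  case less
  interpret claw_free_with_normal G V p by fact
  have IH: "solvable (G\<lparr>carrier := K\<rparr>)" if K: "K \<lhd> G" "V \<subseteq> K" "K \<noteq> carrier G" for K
  proof (rule less.hyps)
    have sub: "subgroup K G" using normal_imp_subgroup[OF K(1)] .
    have "K \<subset> carrier G" using subgroup.subset[OF sub] K(3) by blast
    then show "order (G\<lparr>carrier := K\<rparr>) < order G" by (simp add: order_def psubset_card_mono)
    show "claw_free_with_normal (G\<lparr>carrier := K\<rparr>) V p" by (rule restrict_to_subgroup[OF sub K(2)])
  qed
  show ?case
  proof (cases "p = 2")
    case False
    then have "p > 2" using prime_ge_2_nat[OF p] by simp
    show ?thesis
    proof (rule solvable_by_least_prime)
      show "solvable (G\<lparr>carrier := K\<rparr>)" if "K \<lhd> G" "V \<subseteq> K" "K \<noteq> carrier G" for K by (rule IH[OF that])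
      show "solvable G" if "prime q" "q \<noteq> p" "y \<in> carrier G" "ord y = q" "u \<in> carrier G" "conjg u y \<in> cyc y"
        "conjg u y \<noteq> y" "u [^]\<^bsub>G\<^esub> p \<otimes>\<^bsub>G\<^esub> y = y \<otimes>\<^bsub>G\<^esub> u [^]\<^bsub>G\<^esub> p" "ord u = p ^ k" for q y u k
        using no_p_element_acting_if_odd[OF \<open>p > 2\<close> that(3,4,1,2) that(5-9)] by blast
    qed
  next
    case p2: True
    show ?thesis
    proof (cases "card V = 4")
      case True
      then show ?thesis using solvable_if_card_4 p2 by blast
    next
      case False
      obtain k where k: "card V = 2 ^ k" using V_p_group p2 by blast
      have "3 \<le> k"
      proof (rule ccontr)
        assume "\<not> 3 \<le> k"
        then have "k = 0 \<or> k = 1 \<or> k = 2" by linarith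
        then show False using k card_gt p2 False by auto
      qed
      then have "card V \<ge> 8" using k power_increasing[of 3 k "2::nat"] by simp
      then interpret S: self_centralizing_two G "centralizer V"
        using self_centralizing_two_centralizer p2 by blast
      have VP: "V \<subseteq> centralizer V" using V_comm V_carrier by (auto simp: centralizer_def)
      show ?thesis
      proof (rule S.solvable_by_least_prime)
        show "solvable (G\<lparr>carrier := K\<rparr>)" if "K \<lhd> G" "centralizer V \<subseteq> K" "K \<noteq> carrier G" for K
          using IH that VP by blast
        show "solvable G" if "prime q" "q \<noteq> 2" "y \<in> carrier G" "ord y = q" "u \<in> carrier G" "conjg u y \<in> cyc y"
        "conjg u y \<noteq> y" "u [^]\<^bsub>G\<^esub> (2::nat) \<otimes>\<^bsub>G\<^esub> y = y \<otimes>\<^bsub>G\<^esub> u [^]\<^bsub>G\<^esub> (2::nat)" "ord u = 2 ^ k" for q y u k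
          using S.solvable_if_inversion[OF that(3,4,1,2) that(5-9)] .
      qed
    qed
  qed
qed

context claw_free_group
begin

text \<open>For a prime divisor \<open>p\<close> of \<open>|A|\<close>, the elements \<open>x\<close> of \<open>A\<close> with \<open>x\<^sup>p = 1\<close> form a normal elementary
  abelian subgroup. If it is generated by a single element \<open>z\<close>, then all commutators lie in the
  solvable centralizer of \<open>z\<close>.\<close>

theorem solvable_if_abelian_normal:
  assumes A: "A \<lhd> G" "A \<noteq> {\<one>}" and abel: "\<And>x y. \<lbrakk>x \<in> A; y \<in> A\<rbrakk> \<Longrightarrow> x \<otimes> y = y \<otimes> x"
  shows "solvable G"
proof -
  have subA: "subgroup A G" by (rule normal_imp_subgroup[OF A(1)])
  have Ac: "x \<in> carrier G" if "x \<in> A" for x using subgroup.mem_carrier[OF subA that] .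
  obtain a where a: "a \<in> A" "a \<noteq> \<one>" using A(2) subgroup.one_closed[OF subA] by blast
  obtain k :: nat and p where k: "prime p" "ord (a [^] k) = p" using ex_prime_pow[OF Ac[OF a(1)] a(2)] by metis
  define z where "z = a [^] k"
  have z: "z \<in> A" "z \<in> carrier G" "ord z = p" using subgroup_nat_pow_closed[OF subA a(1)] k Ac by (auto simp: z_def)
  define W where "W = {x \<in> A. x [^] p = \<one>}"
  have W: "subgroup W G"
  proof (rule subgroupI)
    show "W \<noteq> {}" using subgroup.one_closed[OF subA] by (auto simp: W_def)
    fix x y assume x: "x \<in> W"
    then show "inv x \<in> W"
      using subgroup.m_inv_closed[OF subA] Ac by (simp add: W_def nat_pow_inv)
    assume y: "y \<in> W"
    show "x \<otimes> y \<in> W"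
      using x y subgroup.m_closed[OF subA] pow_mult_distrib[OF abel, of x y p] Ac by (simp add: W_def)
  qed (use Ac in \<open>auto simp: W_def\<close>)
  have Wn: "W \<lhd> G"
  proof (rule normal_of_conjg[OF W])
    show "conjg g x \<in> W" if "g \<in> carrier G" "x \<in> W" for g x
      using that subgroup_normal_conjg[OF A(1)] Ac by (simp add: W_def conjg_nat_pow[symmetric])
  qed
  have zW: "z \<in> W" using z pow_ord_eq_1[OF z(2)] by (simp add: W_def)
  show ?thesis
  proof (cases "card W > p")
    case True
    then have "claw_free_with_normal G W p"
      using Wn abel k
      by (intro claw_free_with_normal.intro abelian_normal.intro abelian_normal_axioms.intro
        claw_free_with_normal_axioms.intro claw_free_group_axioms finite_group_axioms) (auto simp: W_def)
    then show ?thesis by (rule claw_free_with_normal_solvable)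
  next
    case False
    have "cyc z \<subseteq> W" using cyc_subset_iff[OF W z(2)] zW by blast
    then have "cyc z = W" using False card_cyc[OF z(2)] z(3) finite_subgroup[OF W] by (intro card_seteq) auto
    then have conj: "conjg g z \<in> cyc z" if "g \<in> carrier G" for g
      using subgroup_normal_conjg[OF Wn zW that] by simp
    have pz: "prime (ord z)" using z k by simp
    have "solvable (G\<lparr>carrier := carrier G\<rparr>)"
    proof (rule solvable_of_commutators[OF _ subgroup_self])
      show "subgroup (centralizer {z}) G" using z by (intro subgroup_centralizer) auto
      show "solvable (G\<lparr>carrier := centralizer {z}\<rparr>)" by (rule centralizer_solvable[OF z(2) pz])
      fix x y assume xy: "x \<in> carrier G" "y \<in> carrier G"
      have "(x \<otimes> y \<otimes> inv x \<otimes> inv y) \<otimes> z = z \<otimes> (x \<otimes> y \<otimes> inv x \<otimes> inv y)"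
        by (rule cyc_normalizer_commutator[OF z(2) xy pz conj[OF xy(1)] conj[OF xy(2)]])
      then show "x \<otimes> y \<otimes> inv x \<otimes> inv y \<in> centralizer {z}" using xy by (simp add: centralizer_def)
    qed
    then show ?thesis by simp
  qed
qed

text \<open>The last nontrivial term of the derived series of a solvable normal subgroup is abelian and
  normal.\<close>

lemma solvable_if_solvable_normal:
  assumes N: "N \<lhd> G" "N \<noteq> {\<one>}" and sol: "solvable (G\<lparr>carrier := N\<rparr>)"
  shows "solvable G"
proof -
  have subN: "subgroup N G" by (rule normal_imp_subgroup[OF N(1)])
  define n where "n = (LEAST n. (derived G ^^ n) N = {\<one>})"
  have n: "(derived G ^^ n) N = {\<one>}"
  proof -
    have "\<exists>n. (derived G ^^ n) N = {\<one>}" using sol solvable_subgroup_iff[OF subN] by simp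
    then show ?thesis unfolding n_def by (rule LeastI_ex)
  qed
  have "n \<noteq> 0" using n N(2) by (cases n) auto
  then obtain m where m: "n = Suc m" using not0_implies_Suc by blast
  define A where "A = (derived G ^^ m) N"
  have "A \<noteq> {\<one>}" using not_less_Least[of m "\<lambda>n. (derived G ^^ n) N = {\<one>}"] m by (simp add: A_def n_def)
  moreover have "(derived G ^^ i) N \<lhd> G" for i using N(1) derived_is_normal by (induction i) auto
  then have An: "A \<lhd> G" by (simp add: A_def)
  moreover have "x \<otimes> y = y \<otimes> x" if xy: "x \<in> A" "y \<in> A" for x y
  proof -
    have c: "x \<in> carrier G" "y \<in> carrier G" using xy subgroup.mem_carrier[OF normal_imp_subgroup[OF An]] by auto
    have "x \<otimes> y \<otimes> inv x \<otimes> inv y \<in> derived G A"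
      unfolding derived_def using xy by (intro generate.incl) auto
    then have "x \<otimes> y \<otimes> inv x \<otimes> inv y = \<one>" using n m by (simp add: A_def)
    then have "(x \<otimes> y) \<otimes> inv (y \<otimes> x) = \<one>" using c by (simp add: group_norm)
    then have "inv (inv (y \<otimes> x)) = x \<otimes> y" using c by (intro inv_equality) auto
    then show ?thesis using c by simp
  qed
  ultimately show ?thesis using solvable_if_abelian_normal by blast
qed

lemma normal_in_normal_not_solvable:
  assumes "\<not> solvable G" "N \<lhd> G" "T \<lhd> G\<lparr>carrier := N\<rparr>" "T \<noteq> {\<one>}"
  shows "\<not> solvable (G\<lparr>carrier := T\<rparr>)"
proof
  assume sol: "solvable (G\<lparr>carrier := T\<rparr>)"
  have subN: "subgroup N G" by (rule normal_imp_subgroup[OF assms(2)])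
  interpret NG: claw_free_group "G\<lparr>carrier := N\<rparr>" by (rule claw_free_subgroup[OF subN])
  have "solvable (G\<lparr>carrier := N\<rparr>)" using NG.solvable_if_solvable_normal[OF assms(3)] assms(4) sol by simp
  moreover have "N \<noteq> {\<one>}"
    using assms(3,4) subgroup.subset[OF normal_imp_subgroup[OF assms(3)]]
      subgroup.one_closed[OF normal_imp_subgroup[OF assms(3)]] by auto
  ultimately show False using solvable_if_solvable_normal[OF assms(2)] assms(1) by blast
qed

text \<open>Everything that commutes with a nontrivial element lies in the solvable centralizer of an
  element of prime order.\<close>

lemma solvable_if_commutes_with:
  assumes H: "subgroup H G" and z: "z \<in> carrier G" "z \<noteq> \<one>" and comm: "\<And>h. h \<in> H \<Longrightarrow> h \<otimes> z = z \<otimes> h"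
  shows "solvable (G\<lparr>carrier := H\<rparr>)"
proof -
  obtain k :: nat and r where k: "prime r" "ord (z [^] k) = r" using ex_prime_pow[OF z] by metis
  have "H \<subseteq> centralizer {z [^] k}"
  proof
    fix h assume h: "h \<in> H"
    have hc: "h \<in> carrier G" using subgroup.mem_carrier[OF H h] .
    have "z [^] k \<otimes> h = h \<otimes> z [^] k" using group_commutes_pow[of z h k] comm[OF h] z hc by simp
    then show "h \<in> centralizer {z [^] k}" using hc by (simp add: centralizer_def)
  qed
  then show ?thesis
    using solvable_subgroup_mono[OF H _ _ centralizer_solvable[of "z [^] k"]] z k
      subgroup_centralizer[of "{z [^] k}"] by simp
qed

text \<open>If two nontrivial normal subgroups of a minimal normal subgroup \<open>N\<close> met trivially, they would
  centralize each other and so be solvable. Hence \<open>N\<close> has a unique minimal normal subgroup, which is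
  then invariant under \<open>G\<close> and equal to \<open>N\<close>.\<close>

lemma simple_normal_subgroup:
  assumes ns: "\<not> solvable G"
  obtains N where "N \<lhd> G" "simple_group (G\<lparr>carrier := N\<rparr>)" "\<not> solvable (G\<lparr>carrier := N\<rparr>)" "centralizer N = {\<one>}"
proof -
  define \<N> where "\<N> = {N. N \<lhd> G \<and> N \<noteq> {\<one>}}"
  have "carrier G \<noteq> {\<one>}"
  proof
    assume "carrier G = {\<one>}"
    then have "(derived G ^^ 0) (carrier G) = {\<one>}" by simp
    then show False using ns solvable_iff_trivial_derived_seq by blast
  qed
  then have "carrier G \<in> \<N>" by (simp add: \<N>_def normal_self)
  then obtain N where N: "N \<in> \<N>" and minN: "\<And>M. M \<in> \<N> \<Longrightarrow> card N \<le> card M"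
    using ex_has_least_nat[of "\<lambda>N. N \<in> \<N>" "carrier G" card] by blast
  have Nn: "N \<lhd> G" "N \<noteq> {\<one>}" using N by (auto simp: \<N>_def)
  have subN: "subgroup N G" by (rule normal_imp_subgroup[OF Nn(1)])
  let ?G = "G\<lparr>carrier := N\<rparr>"
  interpret NG: claw_free_group ?G by (rule claw_free_subgroup[OF subN])
  have solN: "\<not> solvable ?G" using solvable_if_solvable_normal[OF Nn] ns by blast
  define \<T> where "\<T> = {T. T \<lhd> ?G \<and> T \<noteq> {\<one>}}"
  have "N \<in> \<T>" using NG.normal_self Nn by (simp add: \<T>_def)
  then obtain T where T: "T \<in> \<T>" and minT: "\<And>M. M \<in> \<T> \<Longrightarrow> card T \<le> card M"
    using ex_has_least_nat[of "\<lambda>N. N \<in> \<T>" N card] by blast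
  have Tn: "T \<lhd> ?G" "T \<noteq> {\<one>}" using T by (auto simp: \<T>_def)
  have conj_eq: "NG.conjg g x = conjg g x" if "g \<in> N" for g x
    using that m_inv_consistent[OF subN] by (simp add: NG.conjg_def conjg_def)
  have subG: "subgroup S G" "S \<subseteq> N" if "S \<lhd> ?G" for S
    using incl_subgroup[OF subN normal_imp_subgroup[OF that]] subgroup.subset[OF normal_imp_subgroup[OF that]] by auto
  have conjS: "conjg g x \<in> S" if "S \<lhd> ?G" "g \<in> N" "x \<in> S" for S g x
    using NG.subgroup_normal_conjg[OF that(1,3)] that(2) conj_eq by simp
  have finT: "finite S" if "S \<lhd> ?G" for S using finite_subgroup[OF subG(1)[OF that]] .
  have meet: "S \<inter> T \<noteq> {\<one>}" if S: "S \<lhd> ?G" "S \<noteq> {\<one>}" for S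
  proof
    assume triv: "S \<inter> T = {\<one>}"
    obtain z where z: "z \<in> S" "z \<noteq> \<one>" using S subgroup.one_closed[OF subG(1)[OF S(1)]] by blast
    have zc: "z \<in> carrier G" "z \<in> N" using z subgroup.mem_carrier[OF subG(1)[OF S(1)]] subG(2)[OF S(1)] by auto
    have "t \<otimes> z = z \<otimes> t" if t: "t \<in> T" for t
    proof -
      have tc: "t \<in> carrier G" "t \<in> N" using t subgroup.mem_carrier[OF subG(1)[OF Tn(1)]] subG(2)[OF Tn(1)] by auto
      have "conjg t z \<otimes> inv z \<in> S"
        by (rule subgroup.m_closed[OF subG(1)[OF S(1)] conjS[OF S(1) tc(2) z(1)]
            subgroup.m_inv_closed[OF subG(1)[OF S(1)] z(1)]])
      moreover have "t \<otimes> conjg z (inv t) \<in> T"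
        by (rule subgroup.m_closed[OF subG(1)[OF Tn(1)] t conjS[OF Tn(1) zc(2)
            subgroup.m_inv_closed[OF subG(1)[OF Tn(1)] t]]])
      moreover have "t \<otimes> conjg z (inv t) = conjg t z \<otimes> inv z" using tc zc by (simp add: conjg_def group_norm)
      ultimately have "conjg t z \<otimes> inv z = \<one>" using triv by auto
      then have "inv (inv z) = conjg t z" using tc zc by (intro inv_equality) auto
      then have "conjg t z = z" using zc by simp
      then show ?thesis using conjg_eq_self_iff tc zc by blast
    qed
    then have "solvable (G\<lparr>carrier := T\<rparr>)" using solvable_if_commutes_with[OF subG(1)[OF Tn(1)] zc(1) z(2)] by blast
    then show False using normal_in_normal_not_solvable[OF ns Nn(1) Tn] by blast
  qed
  have sub: "T \<subseteq> S" if S: "S \<lhd> ?G" "S \<noteq> {\<one>}" for S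
  proof -
    have "S \<inter> T \<lhd> ?G" using NG.normal_subgroup_intersect[OF S(1) Tn(1)] .
    then have "S \<inter> T \<in> \<T>" using meet[OF S] by (simp add: \<T>_def)
    then have "card T \<le> card (S \<inter> T)" by (rule minT)
    then have "S \<inter> T = T" using finT[OF Tn(1)] by (intro card_seteq) auto
    then show ?thesis by blast
  qed
  have "T \<lhd> G"
  proof (rule normal_of_conjg[OF subG(1)[OF Tn(1)]])
    fix g x assume g: "g \<in> carrier G" and x: "x \<in> T"
    let ?S = "conjg (inv g) ` T"
    have Tc: "t \<in> carrier G" "t \<in> N" if "t \<in> T" for t
      using that subgroup.mem_carrier[OF subG(1)[OF Tn(1)]] subG(2)[OF Tn(1)] by auto
    have S: "subgroup ?S G"
    proof (rule subgroupI)
      show "?S \<noteq> {}" using x by blast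
      show "inv a \<in> ?S" if "a \<in> ?S" for a
        using that g Tc subgroup.m_inv_closed[OF subG(1)[OF Tn(1)]] by (auto simp: conjg_m_inv[symmetric])
      show "a \<otimes> b \<in> ?S" if "a \<in> ?S" "b \<in> ?S" for a b
        using that g Tc subgroup.m_closed[OF subG(1)[OF Tn(1)]] by (auto simp: conjg_mult[symmetric])
    qed (use Tc g in auto)
    have SN: "?S \<subseteq> N" using subgroup_normal_conjg[OF Nn(1)] Tc g by auto
    have "?S \<lhd> ?G"
    proof (rule NG.normal_of_conjg)
      show "subgroup ?S ?G" using subgroup_incl[OF S subN SN] .
      fix n s assume n: "n \<in> carrier ?G" and s: "s \<in> ?S"
      then obtain t where t: "t \<in> T" "s = conjg (inv g) t" by blast
      have nc: "n \<in> carrier G" "n \<in> N" using n subgroup.mem_carrier[OF subN] by auto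
      have "conjg (inv g) (conjg (conjg g n) t) \<in> ?S"
        using conjS[OF Tn(1) subgroup_normal_conjg[OF Nn(1) nc(2) g] t(1)] by blast
      moreover have "conjg (inv g) (conjg (conjg g n) t) = conjg n s"
        using g nc t Tc by (simp add: conjg_def group_norm)
      ultimately show "NG.conjg n s \<in> ?S" using conj_eq nc by simp
    qed
    moreover have "?S \<noteq> {\<one>}"
    proof
      assume S1: "?S = {\<one>}"
      have "t = \<one>" if "t \<in> T" for t
      proof -
        have "conjg (inv g) t = \<one>" using S1 that by blast
        then show ?thesis using g Tc[OF that] by simp
      qed
      then have "T \<subseteq> {\<one>}" by blast
      then show False using Tn(2) x by blast
    qed
    ultimately have "T \<subseteq> ?S" by (rule sub)
    then obtain t where "t \<in> T" "x = conjg (inv g) t" using x by blast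
    then show "conjg g x \<in> T" using g Tc by simp
  qed
  then have "T \<in> \<N>" using Tn by (simp add: \<N>_def)
  then have TN: "T = N" using minN[of T] subG(2)[OF Tn(1)] finite_subgroup[OF subN] card_seteq by metis
  have "simple_group ?G"
  proof (intro simple_group.intro simple_group_axioms.intro)
    show "group ?G" by (rule NG.group_axioms)
    obtain z where "z \<in> N" "z \<noteq> \<one>" using Nn subgroup.one_closed[OF subN] by blast
    then have "card {\<one>, z} \<le> card N" using subgroup.one_closed[OF subN] finite_subgroup[OF subN] by (intro card_mono) auto
    then show "1 < order ?G" using \<open>z \<noteq> \<one>\<close> by (simp add: order_def)
    fix H assume H: "H \<lhd> ?G"
    show "H = carrier ?G \<or> H = {\<one>\<^bsub>?G\<^esub>}"
    proof (cases "H = {\<one>}")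
      case False
      then have "N \<subseteq> H" using sub[OF H] TN by simp
      then show ?thesis using subG(2)[OF H] by auto
    qed simp
  qed
  moreover have "centralizer N = {\<one>}"
  proof -
    have "c = \<one>" if c: "c \<in> centralizer N" for c
    proof (rule ccontr)
      assume "c \<noteq> \<one>"
      then have "solvable ?G"
        using solvable_if_commutes_with[OF subN, of c] c by (simp add: centralizer_def)
      then show False using solN by blast
    qed
    moreover have "\<one> \<in> centralizer N"
      using subgroup.one_closed[OF subgroup_centralizer[OF subgroup.subset[OF subN]]] .
    ultimately show ?thesis by blast
  qed
  ultimately show thesis using that Nn(1) solN by blast
qed

end

section \<open>Almost simple groups\<close>

lemma (in group) almost_simple_if_simple_normal:
  assumes fin: "finite (carrier G)" and N: "N \<lhd> G" "simple_group (G\<lparr>carrier := N\<rparr>)"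
    and nonabelian: "\<exists>x\<in>N. \<exists>y\<in>N. x \<otimes> y \<noteq> y \<otimes> x" and cent: "centralizer N = {\<one>}"
  shows "almost_simple G"
proof -
  have subN: "subgroup N G" by (rule normal_imp_subgroup[OF N(1)])
  have Nc: "x \<in> carrier G" if "x \<in> N" for x using subgroup.mem_carrier[OF subN that] .
  \<comment> \<open>\<open>N\<close> as a group without the additional record fields that \<open>G\<close> may have\<close>
  define S :: "'a monoid" where "S = \<lparr>carrier = N, monoid.mult = (\<otimes>), one = \<one>\<rparr>"
  have S_simps [simp]: "carrier S = N" "x \<otimes>\<^bsub>S\<^esub> y = x \<otimes> y" "\<one>\<^bsub>S\<^esub> = \<one>" for x y
    by (simp_all add: S_def)
  interpret S: group S
  proof (rule groupI)
    show "\<exists>y\<in>carrier S. y \<otimes>\<^bsub>S\<^esub> x = \<one>\<^bsub>S\<^esub>" if "x \<in> carrier S" for x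
      using that Nc subgroup.m_inv_closed[OF subN] by (intro bexI[of _ "inv x"]) auto
  qed (use Nc subgroup.one_closed[OF subN] subgroup.m_closed[OF subN] in \<open>auto simp: m_assoc\<close>)
  have S_inv: "inv\<^bsub>S\<^esub> x = inv x" if "x \<in> N" for x
    using that Nc subgroup.m_inv_closed[OF subN] by (intro S.inv_equality) auto
  have "id \<in> iso (G\<lparr>carrier := N\<rparr>) S" by (auto simp: iso_def hom_def bij_betw_def)
  then have simple: "simple_group S" using simple_group.iso_simple[OF N(2) S.group_axioms] by blast
  have noncomm: "\<not> comm_group S"
  proof
    assume "comm_group S"
    then interpret S: comm_group S .
    show False using nonabelian S.m_comm by auto
  qed
  define \<Phi> where "\<Phi> g = (\<lambda>x\<in>N. conjg g x)" for g
  have conjN: "conjg g x \<in> N" if "g \<in> carrier G" "x \<in> N" for g x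
    using subgroup_normal_conjg[OF N(1) that(2,1)] .
  have bij: "\<Phi> g \<in> Bij N" if g: "g \<in> carrier G" for g
  proof -
    have "bij_betw (\<Phi> g) N N"
      by (rule bij_betwI[where g = "conjg (inv g)"]) (use g conjN Nc in \<open>auto simp: \<Phi>_def\<close>)
    then show ?thesis by (simp add: Bij_def \<Phi>_def)
  qed
  have auto: "\<Phi> g \<in> auto S" if g: "g \<in> carrier G" for g
  proof -
    have "\<Phi> g \<in> hom S S"
      using g conjN Nc subgroup.m_closed[OF subN] by (auto simp: hom_def \<Phi>_def conjg_mult)
    then show ?thesis using bij[OF g] by (simp add: auto_def)
  qed
  interpret A: group "AutoGroup S" by (rule S.AutoGroup)
  have mult: "\<Phi> (g \<otimes> h) = \<Phi> g \<otimes>\<^bsub>AutoGroup S\<^esub> \<Phi> h" if "g \<in> carrier G" "h \<in> carrier G" for g h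
    using that bij[of g] bij[of h] conjN Nc
    by (auto simp: AutoGroup_def BijGroup_def compose_def \<Phi>_def conjg_conjg intro!: restrict_ext)
  interpret \<Phi>: group_hom G "AutoGroup S" \<Phi>
    by unfold_locales (auto simp: hom_def mult, simp add: auto AutoGroup_def)
  let ?H = "\<Phi> ` carrier G"
  have subH: "subgroup ?H (AutoGroup S)" using \<Phi>.img_is_subgroup .
  have inner: "inner_automorphisms S \<subseteq> ?H"
  proof
    fix f assume "f \<in> inner_automorphisms S"
    then obtain g where g: "g \<in> N" "f = (\<lambda>x\<in>N. g \<otimes> x \<otimes> inv\<^bsub>S\<^esub> g)" by (auto simp: inner_automorphisms_def)
    then have "f = \<Phi> g" using S_inv by (simp add: \<Phi>_def conjg_def)
    then show "f \<in> ?H" using Nc[OF g(1)] by blast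
  qed
  have inj: "inj_on \<Phi> (carrier G)"
  proof (rule inj_onI)
    fix g h assume gh: "g \<in> carrier G" "h \<in> carrier G" "\<Phi> g = \<Phi> h"
    have "inv h \<otimes> g \<in> centralizer N"
    proof -
      have "conjg (inv h \<otimes> g) x = x" if x: "x \<in> N" for x
      proof -
        have "conjg g x = conjg h x" using fun_cong[OF gh(3), of x] x by (simp add: \<Phi>_def)
        then have "conjg (inv h) (conjg g x) = x" using gh Nc[OF x] by simp
        then show ?thesis using gh Nc[OF x] by (simp add: conjg_conjg)
      qed
      then show ?thesis using gh Nc conjg_eq_self_iff[of "inv h \<otimes> g"] by (auto simp: centralizer_def)
    qed
    then have "inv h \<otimes> g = \<one>" using cent by blast
    then show "g = h" using gh by (metis inv_closed inv_equality inv_inv)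
  qed
  have "\<Phi> \<in> iso G ((AutoGroup S)\<lparr>carrier := ?H\<rparr>)"
    using inj \<Phi>.homh by (auto simp: iso_def bij_betw_def hom_def)
  then have "G \<cong> (AutoGroup S)\<lparr>carrier := ?H\<rparr>" by (rule is_isoI)
  moreover have "finite (carrier S)" using fin finite_subset subgroup.subset[OF subN] by auto
  ultimately show ?thesis
    unfolding almost_simple_def using fin simple noncomm subH inner group_axioms by blast
qed

theorem theorem1p4:
  fixes G :: "('a, 'b) monoid_scheme"
  assumes "group G"
    and "finite (carrier G)"
    and "\<not> solvable G"
    and "claw_free (reduced_power_graph G)"
  shows "almost_simple G"
proof -
  interpret finite_group G using assms by (simp add: finite_group_def finite_group_axioms_def)
  interpret claw_free_group G using claw_free_group_if assms(4) by blast
  obtain N where N: "N \<lhd> G" "simple_group (G\<lparr>carrier := N\<rparr>)" "\<not> solvable (G\<lparr>carrier := N\<rparr>)" "centralizer N = {\<one>\<^bsub>G\<^esub>}"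
    using simple_normal_subgroup[OF assms(3)] .
  have "\<exists>x\<in>N. \<exists>y\<in>N. x \<otimes>\<^bsub>G\<^esub> y \<noteq> y \<otimes>\<^bsub>G\<^esub> x"
    using solvable_of_abelian[OF normal_imp_subgroup[OF N(1)]] N(3) by blast
  then show ?thesis using almost_simple_if_simple_normal[OF assms(2) N(1,2) _ N(4)] by blast
qed

end
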